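(* Let $n\ge 3$. For a twisted Dynkin quiver $Q^{\gets}$ of type $D_{n+1}$ let $[Q^{\gets}]$ be the commutation class of reduced words of $w_0$ adapted to $Q^{\gets}$, let $\phi_{Q^{\gets}}\vee$ be the twisted Coxeter element such that the reduced words of $\phi_{Q^\gets}$ are adapted to $Q^{\gets}$, let $\Upsilon_{[Q^{\gets}]}$ be the combinatorial Auslander-Reiten quiver of $[Q^{\gets}]$, and let $\prec_{[Q^{\gets}]}$ be the partial order on $\Phi^+$ attached to $[Q^{\gets}]$. Then these objects are in canonical one-to-one correspondence: the maps $$Q^{\gets}\mapsto \phi_{Q^{\gets}}\vee,\qquad Q^{\gets}\mapsto[Q^{\gets}],\qquad Q^{\gets}\mapsto\Upsilon_{[Q^{\gets}]},\qquad Q^{\gets}\mapsto\ \prec_{[Q^{\gets}]}$$ are bijections from the set of twisted Dynkin quivers of type $D_{n+1}$ onto, respectively, the set of twisted Coxeter elements of type $D_{n+1}$, the set of twisted adapted classes of type $D_{n+1}$, the set of combinatorial Auslander-Reiten quivers of twisted adapted classes, and the set of partial orders $\prec_{[\mathbf i_0]}$ with $[\mathbf i_0]$ a twisted adapted class.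
   Context: Fix $n\ge 3$. The Dynkin diagram $\Delta$ of type $D_{n+1}$ has index set $I=\{1,\dots,n+1\}$ and edges $i-(i+1)$ for $1\le i\le n-1$ together with $(n-1)-(n+1)$; $\alpha_i,s_i$ are the simple roots and reflections, $\Phi^+$ the positive roots, $W$ the Weyl group, $w_0$ its longest element. $\vee:I\to I$ exchanges $n,n+1$ and fixes other indices; it also denotes the linear map $\alpha_i\mapsto\alpha_{i^\vee}$. For words, $(j_1\cdots j_m)^{k\vee}$ means applying $\vee$ to each letter $k$ times; $\prod$ of words is concatenation. $[\mathbf i]$ is the commutation class of a reduced word $\mathbf i$ (repeated exchange of adjacent letters whose reflections commute). Twisted Coxeter element: $w\vee$ with $w=s_{i_1}\cdots s_{i_n}$, where $i_1,\dots,i_n$ contains exactly one index of each orbit $\{1\},\dots,\{n-1\},\{n,n+1\}$. Twisted adapted classes: the classes of reduced words of $w_0$ obtained from $[\prod_{k=0}^n(1\,2\cdots n)^{k\vee}]$ by repeated operations $[i_1i_2\cdots i_\ell]\mapsto[i_2\cdots i_\ell i_1^*]$ and $[i_1\cdots i_\ell]\mapsto[i_\ell^*i_1\cdots i_{\ell-1}]$ (any representatives; $w_0\alpha_i=-\alpha_{i^*}$); equivalently the classes $[\prod_{k=0}^n(i_1\cdots i_n)^{k\vee}]$ for twisted Coxeter elements $(s_{i_1}\cdots s_{i_n})\vee$. Twisted Dynkin quiver $Q^\gets$: an orientation of every edge of the line diagram with $n$ vertices $1-2-\cdots-(n-1)-v$, together with a type of the last vertex $v$: either $v=\binom{n}{n+1}$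 (symbol $\odot$; such a quiver is denoted $Q^{\gets n}$) or $v=\binom{n+1}{n}$ (symbol $\otimes$; denoted $Q^{\gets n+1}$). For $i\le n-1$, $i$ is a sink (source) if all arrows at vertex $i$ enter (exit) it. The index $n$ is a sink (source) of $Q^{\gets n}$ if the arrow between $n-1$ and $v$ points to $v$ (to $n-1$), and $n$ is neither in $Q^{\gets n+1}$; the index $n+1$ is a sink (source) of $Q^{\gets n+1}$ if the arrow between $n-1$ and $v$ points to $v$ (to $n-1$), and $n+1$ is neither in $Q^{\gets n}$. Reflection $i\,Q^\gets$: if $i\le n-1$ is a sink or source, reverse all arrows at $i$; if $i=n$ and $Q^\gets=Q^{\gets n}$, or $i=n+1$ and $Q^\gets=Q^{\gets n+1}$, switch the type of $v$ ($\odot\leftrightarrow\otimes$) and reverse the arrow at $v$; otherwise $i\,Q^\gets=Q^\gets$. A reduced word $i_1\cdots i_\ell$ is adapted to $Q^\gets$ if $i_k$ is a sink of $i_{k-1}\cdots i_2i_1Q^\gets$ for all $k$. For a reduced word $\mathbf i_0=i_1\cdots i_N$ of $w_0$ put $\beta_k^{\mathbf i_0}=s_{i_1}\cdots s_{i_{k-1}}(\alpha_{i_k})$, an enumeration of $\Phi^+$, and $\beta^{\mathbf i_0}_k<_{\mathbf i_0}\beta^{\mathbf i_0}_l$ iff $k<l$. The partial order is $\alpha\prec_{[\mathbf i_0]}\beta$ iff $\alpha<_{\mathbf i_0'}\beta$ for all $\mathbf i_0'\in[\mathbf i_0]$. The combinatorial Auslander-Reiten quiver $\Upsilon_{[\mathbf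 i_0]}$ has vertex set $\Phi^+$, with $\beta_k^{\mathbf i_0}$ assigned residue $i_k$, and an arrow $\beta_k^{\mathbf i_0}\to\beta_j^{\mathbf i_0}$ iff $i_k,i_j$ are adjacent in $\Delta$, $j=\max\{j'<k: i_{j'}=i_j\}$ and $k=\min\{k'>j: i_{k'}=i_k\}$; it depends only on $[\mathbf i_0]$. For a twisted adapted class it is called a twisted AR-quiver. *)

theory Defs
  imports Main "HOL-Combinatorics.Transposition"
begin

section \<open>The root system and the Weyl group of type \<open>D\<close>\<close>

text \<open>
  Throughout, \<open>n\<close> is the parameter of the type \<open>D\<close> diagram with \<open>n + 1\<close> vertices, and is assumed
  to be at least 3 where it matters.  An element of the root lattice is given by its coordinates
  in the basis of simple roots.
\<close>

type_synonym vec = "nat \<Rightarrow> int"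

definition idx :: "nat \<Rightarrow> nat set" where
  "idx n = {1..n + 1}"

definition dynkin_edges :: "nat \<Rightarrow> nat set set" where
  "dynkin_edges n = {{i, i + 1} |i. 1 \<le> i \<and> i \<le> n - 1} \<union> {{n - 1, n + 1}}"

definition adjacent :: "nat \<Rightarrow> nat \<Rightarrow> nat \<Rightarrow> bool" where
  "adjacent n i j \<longleftrightarrow> {i, j} \<in> dynkin_edges n"

definition cartan :: "nat \<Rightarrow> nat \<Rightarrow> nat \<Rightarrow> int" where
  "cartan n i j = (if i = j then 2 else if adjacent n i j then - 1 else 0)"

definition simple_root :: "nat \<Rightarrow> vec" where
  "simple_root i = (\<lambda>j. if j = i then 1 else 0)"

text \<open>
  The reflections are defined on all functions \<open>nat \<Rightarrow> int\<close>; products of them leave the coordinates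
  outside \<^term>\<open>idx n\<close> alone and do not depend on them, so two such products are equal iff they agree
  on the root lattice.
\<close>

definition refl :: "nat \<Rightarrow> nat \<Rightarrow> vec \<Rightarrow> vec" where
  "refl n i v = v(i := v i - (\<Sum>j\<in>idx n. cartan n i j * v j))"

text \<open>The product \<open>s\<^sub>i\<^sub>1 \<circ> \<dots> \<circ> s\<^sub>i\<^sub>l\<close> of the reflections of a word:\<close>

definition word_prod :: "nat \<Rightarrow> nat list \<Rightarrow> vec \<Rightarrow> vec" where
  "word_prod n w = foldr (\<lambda>i f. refl n i \<circ> f) w id"

text \<open>Simple reflections are involutions, so the group they generate consists of their products.\<close>

definition weyl :: "nat \<Rightarrow> (vec \<Rightarrow> vec) set" where
  "weyl n = word_prod n ` lists (idx n)"

definition roots :: "nat \<Rightarrow> vec set" where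
  "roots n = {u (simple_root i) |u i. u \<in> weyl n \<and> i \<in> idx n}"

definition pos_roots :: "nat \<Rightarrow> vec set" where
  "pos_roots n = {\<beta> \<in> roots n. \<forall>i. \<beta> i \<ge> 0}"

definition len :: "nat \<Rightarrow> (vec \<Rightarrow> vec) \<Rightarrow> nat" where
  "len n u = (LEAST l. \<exists>w \<in> lists (idx n). length w = l \<and> word_prod n w = u)"

definition reduced_words :: "nat \<Rightarrow> (vec \<Rightarrow> vec) \<Rightarrow> nat list set" where
  "reduced_words n u = {w \<in> lists (idx n). word_prod n w = u \<and> length w = len n u}"

definition longest :: "nat \<Rightarrow> vec \<Rightarrow> vec" where
  "longest n = (ARG_MAX (len n) u. u \<in> weyl n)"

definition star :: "nat \<Rightarrow> nat \<Rightarrow> nat" where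
  "star n i = (THE j. j \<in> idx n \<and> longest n (simple_root i) = (\<lambda>k. - simple_root j k))"

section \<open>The diagram automorphism and twisted Coxeter elements\<close>

abbreviation vee :: "nat \<Rightarrow> nat \<Rightarrow> nat" where
  "vee n \<equiv> transpose n (n + 1)"

text \<open>
  The linear map sending \<open>\<alpha>\<^sub>i\<close> to \<open>\<alpha>\<close> with index \<^term>\<open>vee n i\<close>; as \<^term>\<open>vee n\<close> is an involution,
  it acts on coordinates by precomposition.
\<close>

definition vee_map :: "nat \<Rightarrow> vec \<Rightarrow> vec" where
  "vee_map n v = (\<lambda>i. v (vee n i))"

definition vee_orbits :: "nat \<Rightarrow> nat set set" where
  "vee_orbits n = (\<lambda>i. {i, vee n i}) ` idx n"

text \<open>
  The twisted Coxeter element \<open>w\<or>\<close> is represented by the automorphism \<open>w \<circ> \<or>\<close> of the root lattice.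
\<close>

definition twisted_coxeter_elements :: "nat \<Rightarrow> (vec \<Rightarrow> vec) set" where
  "twisted_coxeter_elements n =
     {word_prod n w \<circ> vee_map n |w.
        w \<in> lists (idx n) \<and> length w = n \<and>
        (\<forall>orb \<in> vee_orbits n. \<exists>!k. k < length w \<and> w ! k \<in> orb)}"

section \<open>Commutation classes and twisted adapted classes\<close>

definition commutation_step :: "nat \<Rightarrow> (nat list \<times> nat list) set" where
  "commutation_step n =
     {(u @ [i, j] @ v, u @ [j, i] @ v) |u v i j. refl n i \<circ> refl n j = refl n j \<circ> refl n i}"

definition commutation_class :: "nat \<Rightarrow> nat list \<Rightarrow> nat list set" where
  "commutation_class n w = (commutation_step n)\<^sup>* `` {w}"

definition initial_word :: "nat \<Rightarrow> nat list" where
  "initial_word n = concat (map (\<lambda>k. map (vee n ^^ k) [1..<n + 1]) [0..<n + 1])"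

inductive_set twisted_adapted_classes :: "nat \<Rightarrow> nat list set set" for n where
  initial: "commutation_class n (initial_word n) \<in> twisted_adapted_classes n"
| reflect_first: "C \<in> twisted_adapted_classes n \<Longrightarrow> i # w \<in> C \<Longrightarrow>
    commutation_class n (w @ [star n i]) \<in> twisted_adapted_classes n"
| reflect_last: "C \<in> twisted_adapted_classes n \<Longrightarrow> w @ [i] \<in> C \<Longrightarrow>
    commutation_class n (star n i # w) \<in> twisted_adapted_classes n"

section \<open>Twisted Dynkin quivers\<close>

text \<open>
  The vertices of the line diagram are \<open>1, \<dots>, n\<close>, where \<open>n\<close> stands for the last vertex \<open>v\<close>.
  The type of \<open>v\<close> is recorded as the upper entry of its label: \<open>top = n\<close> for \<open>\<odot>\<close> and
  \<open>top = n + 1\<close> for \<open>\<otimes>\<close>.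
\<close>

record twisted_quiver =
  arrows :: "(nat \<times> nat) set"
  top :: nat

definition twisted_quivers :: "nat \<Rightarrow> twisted_quiver set" where
  "twisted_quivers n =
     {Q. arrows Q \<subseteq> {(i, i + 1) |i. i \<in> {1..<n}} \<union> {(i + 1, i) |i. i \<in> {1..<n}} \<and>
         (\<forall>i \<in> {1..<n}. (i, i + 1) \<in> arrows Q \<longleftrightarrow> (i + 1, i) \<notin> arrows Q) \<and>
         top Q \<in> {n, n + 1}}"

definition is_sink :: "nat \<Rightarrow> twisted_quiver \<Rightarrow> nat \<Rightarrow> bool" where
  "is_sink n Q i \<longleftrightarrow>
     (i \<in> {1..n - 1} \<and> (\<forall>j. (i, j) \<notin> arrows Q)) \<or>
     (i \<in> {n, n + 1} \<and> i = top Q \<and> (n - 1, n) \<in> arrows Q)"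

definition is_source :: "nat \<Rightarrow> twisted_quiver \<Rightarrow> nat \<Rightarrow> bool" where
  "is_source n Q i \<longleftrightarrow>
     (i \<in> {1..n - 1} \<and> (\<forall>j. (j, i) \<notin> arrows Q)) \<or>
     (i \<in> {n, n + 1} \<and> i = top Q \<and> (n, n - 1) \<in> arrows Q)"

definition reverse_at :: "nat \<Rightarrow> (nat \<times> nat) set \<Rightarrow> (nat \<times> nat) set" where
  "reverse_at x E = {(a, b) \<in> E. a \<noteq> x \<and> b \<noteq> x} \<union> {(b, a) |a b. (a, b) \<in> E \<and> (a = x \<or> b = x)}"

definition reflect_quiver :: "nat \<Rightarrow> nat \<Rightarrow> twisted_quiver \<Rightarrow> twisted_quiver" where
  "reflect_quiver n i Q =
     (if i \<in> {1..n - 1} \<and> (is_sink n Q i \<or> is_source n Q i) then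
        Q\<lparr>arrows := reverse_at i (arrows Q)\<rparr>
      else if i \<in> {n, n + 1} \<and> i = top Q then
        Q\<lparr>arrows := reverse_at n (arrows Q), top := vee n (top Q)\<rparr>
      else Q)"

fun adapted :: "nat \<Rightarrow> twisted_quiver \<Rightarrow> nat list \<Rightarrow> bool" where
  "adapted n Q [] \<longleftrightarrow> True"
| "adapted n Q (i # w) \<longleftrightarrow> is_sink n Q i \<and> adapted n (reflect_quiver n i Q) w"

definition adapted_class :: "nat \<Rightarrow> twisted_quiver \<Rightarrow> nat list set" where
  "adapted_class n Q = {w \<in> reduced_words n (longest n). adapted n Q w}"

text \<open>
  \<open>is_phi n Q \<phi>\<close>: \<open>\<phi>\<or>\<close> is a twisted Coxeter element and the reduced words of \<open>\<phi>\<close> are adapted to \<open>Q\<close>.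
\<close>

definition is_phi :: "nat \<Rightarrow> twisted_quiver \<Rightarrow> (vec \<Rightarrow> vec) \<Rightarrow> bool" where
  "is_phi n Q \<phi> \<longleftrightarrow>
     \<phi> \<circ> vee_map n \<in> twisted_coxeter_elements n \<and> (\<forall>w \<in> reduced_words n \<phi>. adapted n Q w)"

definition phi :: "nat \<Rightarrow> twisted_quiver \<Rightarrow> vec \<Rightarrow> vec" where
  "phi n Q = (THE \<phi>. is_phi n Q \<phi>)"

section \<open>Partial orders and combinatorial Auslander-Reiten quivers\<close>

text \<open>Positions in words are counted from 0, as for \<open>nth\<close>.\<close>

definition beta :: "nat \<Rightarrow> nat list \<Rightarrow> nat \<Rightarrow> vec" where
  "beta n w k = word_prod n (take k w) (simple_root (w ! k))"

definition word_order :: "nat \<Rightarrow> nat list \<Rightarrow> (vec \<times> vec) set" where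
  "word_order n w = {(beta n w k, beta n w l) |k l. k < l \<and> l < length w}"

definition class_order :: "nat \<Rightarrow> nat list set \<Rightarrow> (vec \<times> vec) set" where
  "class_order n C =
     {(\<alpha>, \<beta>). \<alpha> \<in> pos_roots n \<and> \<beta> \<in> pos_roots n \<and> (\<forall>w \<in> C. (\<alpha>, \<beta>) \<in> word_order n w)}"

text \<open>The residue function is given by its graph.\<close>

record ar_quiver =
  ar_vertices :: "vec set"
  ar_residues :: "(vec \<times> nat) set"
  ar_arrows :: "(vec \<times> vec) set"

definition word_ar_quiver :: "nat \<Rightarrow> nat list \<Rightarrow> ar_quiver" where
  "word_ar_quiver n w =
     \<lparr>ar_vertices = pos_roots n,
      ar_residues = {(beta n w k, w ! k) |k. k < length w},
      ar_arrows = {(beta n w k, beta n w j) |k j. j < k \<and> k < length w \<and>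
        adjacent n (w ! k) (w ! j) \<and>
        j = Max {j'. j' < k \<and> w ! j' = w ! j} \<and>
        k = Min {k'. j < k' \<and> k' < length w \<and> w ! k' = w ! k}}\<rparr>"

text \<open>The quiver is the same for all words of a commutation class of reduced words of \<open>w\<^sub>0\<close>.\<close>

definition class_ar_quiver :: "nat \<Rightarrow> nat list set \<Rightarrow> ar_quiver" where
  "class_ar_quiver n C = the_elem (word_ar_quiver n ` C)"

end

theory Submission
  imports Defs
begin

text \<open>
  A twisted quiver is encoded by a height function on the line diagram: neighbouring vertices
  differ by 1 in height, arrows point downwards, and the height of the last vertex modulo 4 gives
  its type. A sink is then a local minimum, and reflecting at it raises its height by 2, so that
  adapted words are sequences of such raisings. Whenever one height function lies below another one
  of the same parity, some sequence of raisings leads from the first to the second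
  (\<open>sink_word_ex\<close>). Raising every vertex once yields a Coxeter word adapted to the given quiver, and
  since adding 4 everywhere does not change the quiver, every quiver is reached from every other
  one by reflections at sinks.

  Conversely a quiver is determined by any adapted word that meets all vertices of the line: of two
  neighbouring vertices the lower one occurs first, and the first letter in \<open>{n, n + 1}\<close> is the
  type (\<open>quiver_determined\<close>). This gives all injectivity statements once it is known that the
  objects attached to a quiver determine an adapted word.

  The reduced words of \<open>w\<^sub>0\<close> adapted to one quiver form a single commutation class. Two sinks are
  never adjacent, so a sink can be moved to the front of every adapted word in which it occurs
  (\<open>sink_to_front\<close>), and two reduced words of the same element have the same letters
  (\<open>reduced_letter_ex\<close>); thus first letters can be cancelled one after the other. The words in these
  classes raise every vertex exactly \<open>n + 1\<close> times, hence end at the quiver with type switched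
  \<open>n + 1\<close> times. As \<open>w\<^sub>0\<close> is minus the \<open>(n + 1)\<close>-st power of \<open>\<or>\<close>, the letter \<open>i\<^sup>*\<close> is a sink there
  whenever \<open>i\<close> is a sink at the start, and moving a first letter \<open>i\<close> to the end as \<open>i\<^sup>*\<close> produces a
  word adapted to the reflected quiver (\<open>rotate_first_realizable\<close>, \<open>rotate_last_realizable\<close>). So the
  twisted adapted classes are exactly the classes of the quivers.

  A commutation class of reduced words of \<open>w\<^sub>0\<close> can be recovered from its partial order and also from
  its Auslander-Reiten quiver: a word lies in the class as soon as it respects the order of each root
  and the nearest preceding roots with adjacent residue (\<open>word_in_class\<close>). Finally a product of
  pairwise different simple reflections determines its word up to commutation
  (\<open>distinct_words_class\<close>), which handles the twisted Coxeter elements.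

  The facts on the Weyl group are obtained from the positive integral vectors of norm 2, for which
  coordinates in an orthonormal basis make the signs visible.
\<close>

section \<open>Orthonormal coordinates and integral vectors of norm two\<close>

text \<open>
  The coordinates with respect to an orthonormal basis in which the simple roots are
  \<open>\<epsilon>\<^sub>i - \<epsilon>\<^sub>i\<^sub>+\<^sub>1\<close> for \<open>i \<le> n\<close> and \<open>\<epsilon>\<^sub>n + \<epsilon>\<^sub>n\<^sub>+\<^sub>1\<close>. Coordinates outside the index set are kept, which makes
  the map injective on all functions.
\<close>

definition eps :: "nat \<Rightarrow> vec \<Rightarrow> vec" where
  "eps n v k =
     (if k \<notin> idx n then v k
      else if k = n + 1 then v (n + 1) - v n
      else v k - (if k = 1 then 0 else v (k - 1)) + (if k = n then v (n + 1) else 0))"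

definition form :: "nat \<Rightarrow> vec \<Rightarrow> vec \<Rightarrow> int" where
  "form n x y = (\<Sum>k\<in>idx n. eps n x k * eps n y k)"

text \<open>
  These turn out to be the roots, but a description that is visibly stable under the reflections is
  easier to work with than the definition of the roots as an orbit.
\<close>

definition norm2_vecs :: "nat \<Rightarrow> vec set" where
  "norm2_vecs n = {v. (\<forall>k. k \<notin> idx n \<longrightarrow> v k = 0) \<and> form n v v = 2}"

definition pos_vecs :: "nat \<Rightarrow> vec set" where
  "pos_vecs n = {v \<in> norm2_vecs n. \<forall>k. 0 \<le> v k}"

text \<open>
  The inverse of \<^const>\<open>eps\<close>; the divisions by 2 are exact on vectors with even coordinate sum.
\<close>

definition eps_inv :: "nat \<Rightarrow> vec \<Rightarrow> vec" where
  "eps_inv n e k =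
     (if k \<notin> idx n then e k
      else if k < n then \<Sum>l = 1..k. e l
      else ((\<Sum>l = 1..n. e l) + (if k = n then - e (n + 1) else e (n + 1))) div 2)"

lemma word_prod_Nil [simp]: "word_prod n [] = id"
  by (simp add: word_prod_def)

lemma word_prod_Cons [simp]: "word_prod n (i # w) = refl n i \<circ> word_prod n w"
  by (simp add: word_prod_def)

lemma word_prod_append [simp]: "word_prod n (v @ w) = word_prod n v \<circ> word_prod n w"
  by (induction v) (simp_all add: comp_assoc)

lemma finite_idx [simp]: "finite (idx n)"
  by (simp add: idx_def)

lemma simple_root_eq_iff [simp]: "simple_root i = simple_root j \<longleftrightarrow> i = j"
  by (auto simp: simple_root_def fun_eq_iff split: if_splits)

lemma adjacent_sym: "adjacent n i j \<longleftrightarrow> adjacent n j i"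
  by (simp add: adjacent_def insert_commute)

lemma adjacent_iff:
  "adjacent n i j \<longleftrightarrow> (1 \<le> i \<and> i \<le> n - 1 \<and> j = i + 1) \<or> (1 \<le> j \<and> j \<le> n - 1 \<and> i = j + 1) \<or>
     (i = n - 1 \<and> j = n + 1) \<or> (i = n + 1 \<and> j = n - 1)"
  unfolding adjacent_def dynkin_edges_def by (auto simp: doubleton_eq_iff)

lemma eps_linear:
  "eps n (\<lambda>k. x k + c * y k) = (\<lambda>k. eps n x k + c * eps n y k)"
  by (auto simp: eps_def fun_eq_iff algebra_simps)

lemma form_sym: "form n x y = form n y x"
  by (simp add: form_def mult.commute)

lemma form_linear: "form n (\<lambda>k. x k + c * y k) z = form n x z + c * form n y z"
  by (simp add: form_def eps_linear algebra_simps sum.distrib sum_distrib_left)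

lemma form_linear_right: "form n z (\<lambda>k. x k + c * y k) = form n z x + c * form n z y"
  using form_linear form_sym by metis

lemma form_zero [simp]: "form n (\<lambda>k. 0) z = 0"
  using form_linear[of n "\<lambda>_. 0" "-1" "\<lambda>_. 0" z] by simp

lemma form_scale: "form n (\<lambda>k. c * y k) z = c * form n y z"
  using form_linear[of n "\<lambda>_. 0" c y z] by simp

lemma refl_other: "k \<noteq> i \<Longrightarrow> refl n i v k = v k"
  by (simp add: refl_def)

lemma word_other: "k \<notin> set w \<Longrightarrow> word_prod n w v k = v k"
  by (induction w) (auto simp: refl_other)

context
  fixes n :: nat
  assumes n3: "n \<ge> 3"
begin

lemma eps_simple_root:
  assumes "i \<in> idx n"
  shows "eps n (simple_root i) k =
    (if i = n + 1 then (if k = n \<or> k = n + 1 then 1 else 0)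
     else if k = i then 1 else if k = i + 1 then - 1 else 0)"
  using assms n3 by (auto simp: eps_def simple_root_def idx_def)

lemma form_simple_root:
  assumes "i \<in> idx n"
  shows "form n (simple_root i) v =
    (if i = n + 1 then eps n v n + eps n v (n + 1) else eps n v i - eps n v (i + 1))"
proof (cases "i = n + 1")
  case True
  have "form n (simple_root i) v =
    (\<Sum>k\<in>idx n. (if k = n then eps n v k else 0) + (if k = n + 1 then eps n v k else 0))"
    unfolding form_def using assms True by (intro sum.cong) (auto simp: eps_simple_root)
  then show ?thesis
    using True n3 by (simp add: sum.distrib idx_def)
next
  case False
  have "form n (simple_root i) v =
    (\<Sum>k\<in>idx n. (if k = i then eps n v k else 0) + (if k = i + 1 then - eps n v k else 0))"
    unfolding form_def using assms False by (intro sum.cong) (auto simp: eps_simple_root)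
  then show ?thesis
    using False assms n3 by (simp add: sum.distrib idx_def)
qed

lemma cartan_sum_neighbours:
  assumes "i \<in> idx n"
  shows "(\<Sum>j\<in>idx n. cartan n i j * v j) = 2 * v i - (\<Sum>j | j \<in> idx n \<and> adjacent n i j. v j)"
proof -
  have "\<not> adjacent n i i"
    using n3 by (auto simp: adjacent_iff)
  then have "(\<Sum>j\<in>idx n. cartan n i j * v j) =
     (\<Sum>j\<in>idx n. (if j = i then 2 * v j else 0) - (if adjacent n i j then v j else 0))"
    by (intro sum.cong refl) (simp add: cartan_def)
  also have "\<dots> = 2 * v i - (\<Sum>j\<in>idx n. if adjacent n i j then v j else 0)"
    using assms by (simp add: sum_subtractf)
  also have "(\<Sum>j\<in>idx n. if adjacent n i j then v j else 0) = (\<Sum>j | j \<in> idx n \<and> adjacent n i j. v j)"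
    by (simp add: sum.inter_filter)
  finally show ?thesis .
qed

lemma cartan_sum:
  assumes "i \<in> idx n"
  shows "(\<Sum>j\<in>idx n. cartan n i j * v j) = form n (simple_root i) v"
proof -
  define N where "N = {j \<in> idx n. adjacent n i j}"
  have *: "(\<Sum>j\<in>idx n. cartan n i j * v j) = 2 * v i - sum v N"
    using cartan_sum_neighbours[OF assms] by (simp add: N_def)
  consider "i = 1" | "1 < i" "i < n - 1" | "i = n - 1" | "i = n" | "i = n + 1"
    using assms unfolding idx_def by force
  then show ?thesis
  proof cases
    case 1
    then have "N = {i + 1}" using n3 by (auto simp: N_def adjacent_iff idx_def)
    then show ?thesis using 1 n3 * assms by (simp add: form_simple_root eps_def idx_def)
  next
    case 2
    then have "N = {i - 1, i + 1}" using n3 by (auto simp: N_def adjacent_iff idx_def)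
    moreover have "i \<noteq> 1" "i \<noteq> n" "i \<noteq> n + 1" "i + 1 \<noteq> n" "i + 1 \<noteq> 1" "i + 1 \<noteq> n + 1"
        "i + 1 \<in> idx n" "i - 1 \<noteq> i + 1"
      using 2 n3 by (simp_all add: idx_def)
    ultimately show ?thesis unfolding * using assms
      by (simp only: form_simple_root[OF assms] eps_def) simp
  next
    case 3
    then have "N = {n - 2, n, n + 1}" using n3 by (auto simp: N_def adjacent_iff idx_def)
    moreover have "n - 2 \<noteq> n" "n - 2 \<noteq> n + 1" "n - 1 - 1 = n - 2"
      using n3 by simp_all
    ultimately have "sum v N = v (n - 2) + (v n + v (n + 1))"
      by simp
    then show ?thesis using 3 n3 * assms \<open>n - 1 - 1 = n - 2\<close>
      by (auto simp: form_simple_root eps_def idx_def)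
  next
    case 4
    then have "N = {n - 1}" using n3 by (auto simp: N_def adjacent_iff idx_def)
    then show ?thesis using 4 n3 * assms by (simp add: form_simple_root eps_def idx_def)
  next
    case 5
    then have "N = {n - 1}" using n3 by (auto simp: N_def adjacent_iff idx_def)
    then show ?thesis using 5 n3 * assms by (simp add: form_simple_root eps_def idx_def)
  qed
qed

lemma refl_eq:
  assumes "i \<in> idx n"
  shows "refl n i v = (\<lambda>k. v k + (- form n (simple_root i) v) * simple_root i k)"
  using assms by (auto simp: refl_def cartan_sum simple_root_def fun_eq_iff)

lemma form_simple_self [simp]: "i \<in> idx n \<Longrightarrow> form n (simple_root i) (simple_root i) = 2"
  using n3 by (auto simp: form_simple_root eps_simple_root idx_def)

lemma form_refl:
  assumes "i \<in> idx n"
  shows "form n (refl n i x) (refl n i y) = form n x y"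
  unfolding refl_eq[OF assms] form_linear form_linear_right
  using assms by (simp add: form_sym[of n x "simple_root i"] algebra_simps)

lemma refl_linear:
  assumes "i \<in> idx n"
  shows "refl n i (\<lambda>k. x k + c * y k) = (\<lambda>k. refl n i x k + c * refl n i y k)"
  using assms by (auto simp: refl_eq form_linear_right algebra_simps)

lemma refl_invol [simp]:
  assumes "i \<in> idx n"
  shows "refl n i (refl n i x) = x"
  using assms by (subst (2) refl_eq, simp, subst refl_linear, simp)
    (auto simp: refl_eq fun_eq_iff algebra_simps)

lemma refl_simple_root: "i \<in> idx n \<Longrightarrow> refl n i (simple_root i) = (\<lambda>k. - simple_root i k)"
  by (simp add: refl_eq)

lemma form_word: "w \<in> lists (idx n) \<Longrightarrow> form n (word_prod n w x) (word_prod n w y) = form n x y"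
  by (induction w) (auto simp: form_refl)

lemma word_linear:
  "w \<in> lists (idx n) \<Longrightarrow>
    word_prod n w (\<lambda>k. x k + c * y k) = (\<lambda>k. word_prod n w x k + c * word_prod n w y k)"
  by (induction w) (auto simp: refl_linear)

lemma word_uminus:
  "w \<in> lists (idx n) \<Longrightarrow> word_prod n w (\<lambda>k. - x k) = (\<lambda>k. - word_prod n w x k)"
  using word_linear[of w x "-2" x] by simp

lemma word_rev [simp]: "w \<in> lists (idx n) \<Longrightarrow> word_prod n (rev w) (word_prod n w x) = x"
  by (induction w arbitrary: x) auto

lemma word_rev' [simp]: "w \<in> lists (idx n) \<Longrightarrow> word_prod n w (word_prod n (rev w) x) = x"
  using word_rev[of "rev w" x] by (simp add: in_lists_conv_set)

lemma word_inj: "w \<in> lists (idx n) \<Longrightarrow> word_prod n w x = word_prod n w y \<Longrightarrow> x = y"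
  using word_rev by metis

lemma word_prod_rev_cong:
  assumes "v \<in> lists (idx n)" "w \<in> lists (idx n)" "word_prod n v = word_prod n w"
  shows "word_prod n (rev v) = word_prod n (rev w)"
proof
  fix x
  have "word_prod n v (word_prod n (rev w) x) = x"
    using assms by simp
  then show "word_prod n (rev v) x = word_prod n (rev w) x"
    using assms(1) word_rev by metis
qed

text \<open>
  Reflections in \<open>\<alpha>\<close> and \<open>- \<alpha>\<close> coincide, so the sign \<open>c\<close> is immaterial. Besides the exchange
  argument this is used for the longest element, which maps simple roots to negatives of simple roots.
\<close>

lemma word_conj:
  assumes w: "w \<in> lists (idx n)" and "i \<in> idx n" "j \<in> idx n"
    and c: "c * c = (1::int)" and eq: "word_prod n w (simple_root i) = (\<lambda>k. c * simple_root j k)"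
  shows "word_prod n w \<circ> refl n i = refl n j \<circ> word_prod n w"
proof
  fix v
  let ?g = "word_prod n w v"
  have "form n (simple_root i) v = form n (\<lambda>k. c * simple_root j k) ?g"
    using form_word[OF w, of "simple_root i" v] eq by simp
  also have "\<dots> = c * form n (simple_root j) ?g"
    by (simp add: form_scale)
  finally have *: "form n (simple_root i) v = c * form n (simple_root j) ?g" .
  have "word_prod n w (refl n i v) =
      (\<lambda>k. ?g k + (- form n (simple_root i) v) * (c * simple_root j k))"
    by (simp only: refl_eq[OF assms(2)] word_linear[OF w] eq)
  also have "\<dots> = (\<lambda>k. ?g k + - form n (simple_root j) ?g * ((c * c) * simple_root j k))"
    unfolding * by (simp add: algebra_simps)
  finally show "(word_prod n w \<circ> refl n i) v = (refl n j \<circ> word_prod n w) v"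
    by (simp add: c refl_eq[OF assms(3)])
qed

lemma refl_simple_other:
  assumes "i \<in> idx n" "j \<in> idx n" "i \<noteq> j"
  shows "refl n i (simple_root j) = (if adjacent n i j then (\<lambda>k. simple_root i k + simple_root j k) else simple_root j)"
proof -
  have "(\<Sum>l\<in>idx n. cartan n i l * simple_root j l) = (\<Sum>l\<in>idx n. if l = j then cartan n i j else 0)"
    by (intro sum.cong) (auto simp: simple_root_def)
  also have "\<dots> = cartan n i j"
    using assms by simp
  finally show ?thesis
    using assms by (auto simp: refl_def fun_eq_iff cartan_def simple_root_def)
qed

text \<open>
  For adjacent \<open>i\<close> and \<open>j\<close> the two products differ on \<open>\<alpha>\<^sub>i\<close>.
\<close>

lemma refl_commute_iff:
  assumes "i \<in> idx n" "j \<in> idx n"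
  shows "refl n i \<circ> refl n j = refl n j \<circ> refl n i \<longleftrightarrow> \<not> adjacent n i j"
proof
  assume eq: "refl n i \<circ> refl n j = refl n j \<circ> refl n i"
  show "\<not> adjacent n i j"
  proof
    assume adj: "adjacent n i j"
    then have ne: "i \<noteq> j"
      using n3 by (auto simp: adjacent_iff)
    have "refl n j (simple_root i) = (\<lambda>k. simple_root j k + 1 * simple_root i k)"
      using assms ne adj by (simp add: refl_simple_other adjacent_sym)
    then have "refl n i (refl n j (simple_root i)) i =
        refl n i (simple_root j) i + refl n i (simple_root i) i"
      using assms refl_linear[of i "simple_root j" 1 "simple_root i"] by simp
    also have "\<dots> = 0"
      using assms ne adj by (simp add: refl_simple_other refl_simple_root) (simp add: simple_root_def)
    finally have "refl n i (refl n j (simple_root i)) i = 0" .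
    moreover have "refl n j (refl n i (simple_root i)) i = - 1"
      using ne assms by (simp add: refl_other refl_simple_root) (simp add: simple_root_def)
    ultimately show False
      using fun_cong[OF eq, of "simple_root i"] by simp
  qed
next
  assume nadj: "\<not> adjacent n i j"
  show "refl n i \<circ> refl n j = refl n j \<circ> refl n i"
  proof (cases "i = j")
    case False
    then have "word_prod n [i] (simple_root j) = (\<lambda>k. 1 * simple_root j k)"
      using assms nadj by (simp add: refl_simple_other)
    then show ?thesis
      using word_conj[of "[i]" j j 1] assms by simp
  qed simp
qed

lemma eps_sum:
  assumes "1 \<le> k" "k < n"
  shows "(\<Sum>l = 1..k. eps n v l) = v k"
  using assms
proof (induction k)
  case (Suc k)
  then show ?case
    using n3 by (cases "k = 0") (auto simp: eps_def idx_def)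
qed simp

lemma eps_sum_n: "(\<Sum>l = 1..n. eps n v l) = v n + v (n + 1)"
proof -
  have "(\<Sum>l = 1..n. eps n v l) = (\<Sum>l = 1..n - 1. eps n v l) + eps n v n"
    using n3 sum.cl_ivl_Suc[of "eps n v" 1 "n - 1"] by simp
  then show ?thesis
    using n3 by (simp only: eps_sum) (simp add: eps_sum eps_def idx_def)
qed

lemma eps_inv_eps: "eps_inv n (eps n v) = v"
proof
  fix k
  have last: "eps n v (n + 1) = v (n + 1) - v n"
    by (simp add: eps_def idx_def)
  consider "k \<notin> idx n" | "1 \<le> k" "k < n" | "k = n" | "k = n + 1"
    by (force simp: idx_def)
  then show "eps_inv n (eps n v) k = v k"
  proof cases
    case 1
    then show ?thesis by (simp add: eps_inv_def eps_def)
  next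
    case 2
    then have "k \<in> idx n" by (simp add: idx_def)
    with 2 show ?thesis by (simp add: eps_inv_def eps_sum[simplified])
  next
    case 3
    then have "k \<in> idx n" using n3 by (simp add: idx_def)
    with 3 show ?thesis
      unfolding eps_inv_def eps_sum_n last by simp
  next
    case 4
    then have "k \<in> idx n" using n3 by (simp add: idx_def)
    with 4 show ?thesis
      unfolding eps_inv_def eps_sum_n last by simp
  qed
qed

lemma eps_inj: "eps n v = eps n w \<Longrightarrow> v = w"
  using eps_inv_eps by metis

lemma eps_eps_inv:
  assumes "even (\<Sum>l = 1..n + 1. e l)"
  shows "eps n (eps_inv n e) = e"
proof
  fix k
  have even: "even ((\<Sum>l = 1..n. e l) + e (n + 1))"
    using assms by simp
  have Sn: "(\<Sum>l = 1..n. e l) = (\<Sum>l = 1..n - 1. e l) + e n"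
    using n3 sum.cl_ivl_Suc[of e 1 "n - 1"] by simp
  have k: "(\<Sum>l = 1..k. e l) = (\<Sum>l = 1..k - 1. e l) + e k" if "1 \<le> k"
    using that sum.cl_ivl_Suc[of e 1 "k - 1"] by simp
  have inv: "eps_inv n e (n - 1) = (\<Sum>l = 1..n - 1. e l)"
      "eps_inv n e n = ((\<Sum>l = 1..n. e l) + - e (n + 1)) div 2"
      "eps_inv n e (n + 1) = ((\<Sum>l = 1..n. e l) + e (n + 1)) div 2"
    unfolding eps_inv_def using n3 by (auto simp: idx_def)
  have last: "eps n (eps_inv n e) n = eps_inv n e n - eps_inv n e (n - 1) + eps_inv n e (n + 1)"
      "eps n (eps_inv n e) (n + 1) = eps_inv n e (n + 1) - eps_inv n e n"
    unfolding eps_def using n3 by (auto simp: idx_def)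
  consider "k \<notin> idx n" | "1 \<le> k" "k < n" | "k = n" | "k = n + 1"
    by (force simp: idx_def)
  then show "eps n (eps_inv n e) k = e k"
  proof cases
    case 1
    then show ?thesis by (simp add: eps_def eps_inv_def)
  next
    case 2
    then have "k \<in> idx n" "k = 1 \<or> k - 1 \<in> idx n" by (auto simp: idx_def)
    with 2 show ?thesis using k by (auto simp: eps_def eps_inv_def)
  next
    case 3
    have "((\<Sum>l = 1..n. e l) + - e (n + 1)) div 2 + ((\<Sum>l = 1..n. e l) + e (n + 1)) div 2
        = (\<Sum>l = 1..n. e l)"
      using even by presburger
    then show ?thesis using Sn unfolding 3 last inv by simp
  next
    case 4
    have "((\<Sum>l = 1..n. e l) + e (n + 1)) div 2 - ((\<Sum>l = 1..n. e l) + - e (n + 1)) div 2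
        = e (n + 1)"
      using even by presburger
    then show ?thesis unfolding 4 last inv by simp
  qed
qed

lemma eps_inv_nonneg:
  assumes "1 \<le> i" "i < j" "j \<le> n + 1" "b = 1 \<or> b = (- 1::int)"
  shows "0 \<le> eps_inv n (\<lambda>k. if k = i then 1 else if k = j then b else 0) k"
proof -
  let ?e = "\<lambda>k. if k = i then 1 else if k = j then b else 0"
  have S: "(\<Sum>l = 1..m. ?e l) = (if i \<le> m then 1 else 0) + (if j \<le> m then b else 0)" for m
  proof -
    have "(\<Sum>l = 1..m. ?e l) = (\<Sum>l = 1..m. (if l = i then 1 else 0) + (if l = j then b else 0))"
      using assms by (intro sum.cong) auto
    then show ?thesis using assms by (simp add: sum.distrib)
  qed
  show ?thesis
    using assms unfolding eps_inv_def S by (auto simp: idx_def)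
qed

text \<open>
  The sum of the squares of the orthonormal coordinates is 2, so exactly two of them are nonzero.
\<close>

lemma norm2_form:
  assumes "v \<in> norm2_vecs n"
  obtains i j a b where "1 \<le> i" "i < j" "j \<le> n + 1" "a = 1 \<or> a = - 1" "b = 1 \<or> b = - 1"
    "eps n v = (\<lambda>k. if k = i then a else if k = j then b else 0)"
proof -
  have form: "(\<Sum>k\<in>idx n. (eps n v k)\<^sup>2) = 2" and out: "\<And>k. k \<notin> idx n \<Longrightarrow> eps n v k = 0"
    using assms by (auto simp: norm2_vecs_def form_def power2_eq_square eps_def)
  have one: "eps n v k = 1 \<or> eps n v k = - 1" if "eps n v k \<noteq> 0" for k
  proof -
    have "k \<in> idx n" using that out by blast
    then have "(eps n v k)\<^sup>2 \<le> 2"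
      using member_le_sum[of k "idx n" "\<lambda>k. (eps n v k)\<^sup>2"] form by simp
    then have "\<bar>eps n v k\<bar> < 2"
      using power_mono[of 2 "\<bar>eps n v k\<bar>" 2] by (rule_tac ccontr) auto
    then show ?thesis using that by linarith
  qed
  define S where "S = {k \<in> idx n. eps n v k \<noteq> 0}"
  have "(\<Sum>k\<in>idx n. (eps n v k)\<^sup>2) = (\<Sum>k\<in>S. (eps n v k)\<^sup>2)"
    by (rule sum.mono_neutral_right) (auto simp: S_def)
  also have "\<dots> = (\<Sum>k\<in>S. 1)"
    using one by (intro sum.cong) (auto simp: S_def power2_eq_square, metis mult_1 mult_minus1 minus_minus)
  finally have "card S = 2" using form by simp
  then obtain x y where xy: "S = {x, y}" "x \<noteq> y"
    by (auto simp: card_2_iff)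
  define i j where "i = min x y" and "j = max x y"
  have ij: "S = {i, j}" "i < j"
    using xy by (auto simp: i_def j_def min_def max_def)
  show thesis
  proof (rule that[of i j "eps n v i" "eps n v j"])
    show "1 \<le> i" "i < j" "j \<le> n + 1" "eps n v i = 1 \<or> eps n v i = - 1" "eps n v j = 1 \<or> eps n v j = - 1"
      using ij one by (auto simp: S_def idx_def set_eq_iff)
    show "eps n v = (\<lambda>k. if k = i then eps n v i else if k = j then eps n v j else 0)"
      using ij(1) out by (fastforce simp: S_def)
  qed
qed

lemma eps_uminus: "eps n (\<lambda>k. - v k) = (\<lambda>k. - eps n v k)"
  using eps_linear[of n v "-2" v] by simp

lemma norm2_uminus: "v \<in> norm2_vecs n \<Longrightarrow> (\<lambda>k. - v k) \<in> norm2_vecs n"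
  by (auto simp: norm2_vecs_def form_def eps_uminus)

text \<open>
  The sign of the first nonzero orthonormal coordinate decides: the coordinates of \<open>v\<close> in the simple
  roots are partial sums of the orthonormal ones, and half-sums of this kind at the last two positions.
\<close>

lemma norm2_sign: "v \<in> norm2_vecs n \<Longrightarrow> v \<in> pos_vecs n \<or> (\<lambda>k. - v k) \<in> pos_vecs n"
proof -
  assume v: "v \<in> norm2_vecs n"
  then obtain i j a b where ij: "1 \<le> i" "i < j" "j \<le> n + 1" "a = 1 \<or> a = - 1" "b = 1 \<or> b = - 1"
    "eps n v = (\<lambda>k. if k = i then a else if k = j then b else 0)"
    by (rule norm2_form)
  from ij(4) show ?thesis
  proof
    assume "a = 1"
    then have "0 \<le> v k" for k
      using eps_inv_nonneg[OF ij(1-3,5), of k] eps_inv_eps[of v] unfolding ij(6) \<open>a = 1\<close> by simp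
    then show ?thesis using v by (simp add: pos_vecs_def)
  next
    assume a: "a = - 1"
    have eps: "eps n (\<lambda>k. - v k) = (\<lambda>k. if k = i then 1 else if k = j then - b else 0)"
      unfolding eps_uminus ij(6) using a by auto
    have "- b = 1 \<or> - b = - 1"
      using ij(5) by auto
    then have "0 \<le> - v k" for k
      using eps_inv_nonneg[OF ij(1-3), of "- b" k] eps_inv_eps[of "\<lambda>k. - v k"] unfolding eps by simp
    then show ?thesis using v norm2_uminus by (simp add: pos_vecs_def)
  qed
qed

lemma pos_not_neg: "v \<in> pos_vecs n \<Longrightarrow> (\<lambda>k. - v k) \<notin> pos_vecs n"
proof
  assume "v \<in> pos_vecs n" "(\<lambda>k. - v k) \<in> pos_vecs n"
  then have "v = (\<lambda>k. 0)"
    by (auto simp: pos_vecs_def fun_eq_iff intro: order_antisym)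
  then show False
    using \<open>v \<in> pos_vecs n\<close> by (simp add: pos_vecs_def norm2_vecs_def)
qed

lemma simple_root_pos: "i \<in> idx n \<Longrightarrow> simple_root i \<in> pos_vecs n"
  by (auto simp: pos_vecs_def norm2_vecs_def) (auto simp: simple_root_def)

lemma norm2_refl: "i \<in> idx n \<Longrightarrow> v \<in> norm2_vecs n \<Longrightarrow> refl n i v \<in> norm2_vecs n"
  by (auto simp: norm2_vecs_def form_refl) (auto simp: refl_def)

text \<open>
  A reflection changes one coordinate only. If this makes a positive vector negative, then all its
  other coordinates vanish, and having norm 2 it is the simple root itself.
\<close>

lemma refl_pos:
  assumes "i \<in> idx n" "v \<in> pos_vecs n" "v \<noteq> simple_root i"
  shows "refl n i v \<in> pos_vecs n"
proof (rule ccontr)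
  assume "refl n i v \<notin> pos_vecs n"
  then have "(\<lambda>k. - refl n i v k) \<in> pos_vecs n"
    using assms norm2_refl norm2_sign by (auto simp: pos_vecs_def)
  then have neg: "refl n i v k \<le> 0" for k
    by (auto simp: pos_vecs_def)
  have "v k = 0" if "k \<noteq> i" for k
    using neg[of k] assms(2) that by (auto simp: refl_other pos_vecs_def intro: order_antisym)
  then have v: "v = (\<lambda>k. v i * simple_root i k)"
    by (auto simp: simple_root_def)
  have "form n v v = v i * form n (simple_root i) v"
    by (subst v) (rule form_scale)
  also have "form n (simple_root i) v = form n v (simple_root i)"
    by (rule form_sym)
  also have "\<dots> = v i * form n (simple_root i) (simple_root i)"
    by (subst v) (rule form_scale)
  finally have "form n v v = v i * (v i * 2)"
    using assms(1) by simp
  then have "v i * v i = 1" "0 \<le> v i"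
    using assms(2) by (auto simp: pos_vecs_def norm2_vecs_def)
  then have "v i = 1"
    by (simp add: zmult_eq_1_iff)
  then have "v = simple_root i"
    by (subst v) simp
  then show False using assms(3) by contradiction
qed

text \<open>
  The pairs of different indices are sent to \<open>\<epsilon>\<^sub>i - \<epsilon>\<^sub>j\<close> for \<open>i < j\<close> and to \<open>\<epsilon>\<^sub>j + \<epsilon>\<^sub>i\<close> for \<open>j < i\<close>.
\<close>

lemma card_pos_ge: "finite (pos_vecs n) \<Longrightarrow> n * (n + 1) \<le> card (pos_vecs n)"
proof -
  assume fin: "finite (pos_vecs n)"
  define e :: "nat \<times> nat \<Rightarrow> vec" where
    "e = (\<lambda>(i, j) k. if i < j then if k = i then 1 else if k = j then - 1 else 0
                       else if k = j then 1 else if k = i then 1 else 0)"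
  define P where "P = Sigma (idx n) (\<lambda>i. idx n - {i})"
  have even: "even (\<Sum>l = 1..n + 1. e p l)" if "p \<in> P" for p
  proof -
    obtain i j where p: "p = (i, j)" by (cases p)
    have "(\<Sum>l = 1..n + 1. e p l) =
      (\<Sum>l = 1..n + 1. (if l = i then 1 else 0) + (if l = j then if i < j then - 1 else 1 else 0))"
      using that by (intro sum.cong) (auto simp: e_def P_def p)
    also have "\<dots> = (if i < j then 0 else 2)"
      using that by (simp add: sum.distrib P_def p idx_def)
    finally show ?thesis by simp
  qed
  have "inj_on (eps_inv n \<circ> e) P"
  proof (rule inj_onI)
    fix p q assume pq: "p \<in> P" "q \<in> P" "(eps_inv n \<circ> e) p = (eps_inv n \<circ> e) q"
    then have eq: "e p = e q"
      using even eps_eps_inv by (metis comp_apply)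
    obtain i j i' j' where *: "p = (i, j)" "q = (i', j')" by (cases p, cases q)
    have "e p i = e q i" "e p j = e q j" "e p i' = e q i'" "e p j' = e q j'"
      using eq by auto
    then show "p = q"
      using pq(1,2) unfolding * P_def e_def by (auto split: if_splits)
  qed
  moreover have "(eps_inv n \<circ> e) ` P \<subseteq> pos_vecs n"
  proof (intro image_subsetI)
    fix p assume p: "p \<in> P"
    obtain i j where ij: "p = (i, j)" by (cases p)
    have eps: "eps n (eps_inv n (e p)) = e p"
      using even[OF p] eps_eps_inv by blast
    have "form n (eps_inv n (e p)) (eps_inv n (e p)) =
        (\<Sum>l\<in>idx n. (if l = i then 1 else 0) + (if l = j then 1 else 0))"
      unfolding form_def eps using p by (intro sum.cong) (auto simp: e_def P_def ij)
    also have "\<dots> = 2"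
      using p by (simp add: sum.distrib P_def ij)
    finally have "eps_inv n (e p) \<in> norm2_vecs n"
      using p by (auto simp: norm2_vecs_def eps_inv_def e_def P_def ij)
    moreover have "0 \<le> eps_inv n (e p) k" for k
    proof (cases "i < j")
      case True
      then show ?thesis
        using eps_inv_nonneg[of i j "-1" k] p by (simp add: e_def P_def ij idx_def)
    next
      case False
      then show ?thesis
        using eps_inv_nonneg[of j i 1 k] p by (simp add: e_def P_def ij idx_def)
    qed
    ultimately show "(eps_inv n \<circ> e) p \<in> pos_vecs n"
      by (simp add: pos_vecs_def)
  qed
  ultimately have "card P \<le> card (pos_vecs n)"
    using card_inj_on_le fin by blast
  moreover have "card P = (n + 1) * n"
    by (simp add: P_def card_SigmaI) (simp add: idx_def)
  ultimately show ?thesis by simp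
qed

end

section \<open>Reduced words and inversions\<close>

definition reduced :: "nat \<Rightarrow> nat list \<Rightarrow> bool" where
  "reduced n w \<longleftrightarrow> w \<in> lists (idx n) \<and>
     (\<forall>v \<in> lists (idx n). word_prod n v = word_prod n w \<longrightarrow> length w \<le> length v)"

lemma reduced_lists: "reduced n w \<Longrightarrow> w \<in> lists (idx n)"
  by (simp add: reduced_def)

lemma in_reduced_words_iff: "w \<in> reduced_words n u \<longleftrightarrow> reduced n w \<and> word_prod n w = u"
proof
  assume w: "w \<in> reduced_words n u"
  have "length w \<le> length v" if "v \<in> lists (idx n)" "word_prod n v = word_prod n w" for v
  proof -
    have "len n u \<le> length v"
      unfolding len_def using that w by (intro Least_le) (auto simp: reduced_words_def)
    then show ?thesis using w by (simp add: reduced_words_def)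
  qed
  then show "reduced n w \<and> word_prod n w = u"
    using w by (auto simp: reduced_words_def reduced_def)
next
  assume w: "reduced n w \<and> word_prod n w = u"
  have "len n u = length w"
    unfolding len_def using w by (intro Least_equality) (auto simp: reduced_def)
  then show "w \<in> reduced_words n u"
    using w by (simp add: reduced_words_def reduced_def)
qed

lemma reduced_word_ex:
  assumes "w \<in> lists (idx n)"
  obtains v where "reduced n v" "word_prod n v = word_prod n w"
proof -
  let ?P = "\<lambda>v. v \<in> lists (idx n) \<and> word_prod n v = word_prod n w"
  obtain v where "?P v" "\<forall>v'. ?P v' \<longrightarrow> length v \<le> length v'"
    using ex_has_least_nat[of ?P w length] assms by auto
  then show thesis
    using that[of v] by (auto simp: reduced_def)
qed

lemma reduced_append1:
  assumes "reduced n (v @ w)" shows "reduced n v"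
  unfolding reduced_def
proof (intro conjI ballI impI)
  show "v \<in> lists (idx n)" using assms by (auto simp: reduced_def)
  fix x assume x: "x \<in> lists (idx n)" "word_prod n x = word_prod n v"
  then have "x @ w \<in> lists (idx n)" "word_prod n (x @ w) = word_prod n (v @ w)"
    using assms by (auto simp: reduced_def)
  then show "length v \<le> length x"
    using assms unfolding reduced_def by fastforce
qed

lemma reduced_append2:
  assumes "reduced n (v @ w)" shows "reduced n w"
  unfolding reduced_def
proof (intro conjI ballI impI)
  show "w \<in> lists (idx n)" using assms by (auto simp: reduced_def)
  fix x assume x: "x \<in> lists (idx n)" "word_prod n x = word_prod n w"
  then have "v @ x \<in> lists (idx n)" "word_prod n (v @ x) = word_prod n (v @ w)"
    using assms by (auto simp: reduced_def)
  then show "length w \<le> length x"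
    using assms unfolding reduced_def by fastforce
qed

context
  fixes n :: nat
  assumes n3: "n \<ge> 3"
begin

lemma reduced_rev:
  assumes "reduced n w" shows "reduced n (rev w)"
  unfolding reduced_def
proof (intro conjI ballI impI)
  show "rev w \<in> lists (idx n)" using assms by (auto simp: reduced_def)
  fix x assume x: "x \<in> lists (idx n)" "word_prod n x = word_prod n (rev w)"
  have "rev w \<in> lists (idx n)"
    using assms by (auto simp: reduced_def)
  then have "word_prod n (rev x) = word_prod n w"
    using word_prod_rev_cong[OF n3 x(1) _ x(2)] by simp
  moreover have "rev x \<in> lists (idx n)" using x by auto
  ultimately show "length (rev w) \<le> length x"
    using assms unfolding reduced_def by fastforce
qed

lemma sign_change:
  assumes "w \<in> lists (idx n)" "v \<in> pos_vecs n" "word_prod n w v \<notin> pos_vecs n"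
  shows "\<exists>x j y. w = x @ j # y \<and> word_prod n y v = simple_root j"
  using assms
proof (induction w)
  case (Cons i w)
  show ?case
  proof (cases "word_prod n w v \<in> pos_vecs n")
    case True
    moreover have "i \<in> idx n" "refl n i (word_prod n w v) \<notin> pos_vecs n"
      using Cons by simp_all
    ultimately have "word_prod n w v = simple_root i"
      using refl_pos[OF n3] by blast
    then show ?thesis by blast
  next
    case False
    then obtain x j y where "w = x @ j # y" "word_prod n y v = simple_root j"
      using Cons by auto
    then show ?thesis by (metis append_Cons)
  qed
qed simp

text \<open>
  The exchange argument: if the image were negative, the sign would change at some letter \<open>j\<close> of
  \<open>w\<close>; conjugation shows that this letter cancels against the last one, and the word is not of
  minimal length.
\<close>

lemma reduced_last_pos:
  assumes "reduced n (w @ [i])"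
  shows "word_prod n w (simple_root i) \<in> pos_vecs n"
proof (rule ccontr)
  assume neg: "word_prod n w (simple_root i) \<notin> pos_vecs n"
  have lists: "w \<in> lists (idx n)" "i \<in> idx n"
    using assms by (auto simp: reduced_def)
  obtain x j y where w: "w = x @ j # y" and eq: "word_prod n y (simple_root i) = simple_root j"
    using sign_change[OF lists(1) simple_root_pos[OF n3 lists(2)] neg] by blast
  have lists': "y \<in> lists (idx n)" "j \<in> idx n" "x \<in> lists (idx n)"
    using lists w by auto
  have "word_prod n y \<circ> refl n i = refl n j \<circ> word_prod n y"
    using word_conj[OF n3 lists'(1) lists(2) lists'(2), of 1] eq by simp
  then have "word_prod n y (refl n i v) = refl n j (word_prod n y v)" for v
    by (metis comp_apply)
  then have "word_prod n (w @ [i]) = word_prod n (x @ y)"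
    using lists' refl_invol[OF n3] by (intro ext) (simp add: w)
  moreover have "x @ y \<in> lists (idx n)" using lists' by simp
  ultimately have "length (w @ [i]) \<le> length (x @ y)"
    using assms unfolding reduced_def by metis
  then show False by (simp add: w)
qed

lemma reduced_first_pos:
  assumes "reduced n (i # w)"
  shows "word_prod n (rev w) (simple_root i) \<in> pos_vecs n"
  using reduced_last_pos[of "rev w" i] reduced_rev[OF assms] by simp

lemma beta_pos:
  assumes "reduced n w" "k < length w"
  shows "beta n w k \<in> pos_vecs n"
proof -
  have "w = (take k w @ [w ! k]) @ drop (Suc k) w"
    using assms(2) by (metis append_take_drop_id take_Suc_conv_app_nth)
  then have "reduced n (take k w @ [w ! k])"
    using reduced_append1 assms(1) by metis
  then show ?thesis
    unfolding beta_def by (rule reduced_last_pos)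
qed

lemma beta_neg:
  assumes "reduced n w" "k < length w"
  shows "(\<lambda>i. - word_prod n (rev w) (beta n w k) i) \<in> pos_vecs n"
proof -
  let ?i = "w ! k"
  have w: "w = take k w @ [?i] @ drop (Suc k) w"
    using assms(2) by (simp add: Cons_nth_drop_Suc)
  have lists: "w \<in> lists (idx n)" using assms(1) by (rule reduced_lists)
  then have lists': "take k w \<in> lists (idx n)" "drop (Suc k) w \<in> lists (idx n)" "?i \<in> idx n"
    by (subst (asm) w, simp)+
  have "reduced n (?i # drop (Suc k) w)"
    using assms(1) reduced_append2 w by (metis append_Cons append_Nil)
  then have "word_prod n (rev (drop (Suc k) w)) (simple_root ?i) \<in> pos_vecs n"
    by (rule reduced_first_pos)
  moreover have "word_prod n (rev w) (beta n w k) =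
      (\<lambda>i. - word_prod n (rev (drop (Suc k) w)) (simple_root ?i) i)"
  proof -
    have "rev w = rev (drop (Suc k) w) @ [?i] @ rev (take k w)"
      by (subst w) simp
    then show ?thesis
      using lists' by (simp add: beta_def word_rev[OF n3] refl_simple_root[OF n3] word_uminus[OF n3] in_lists_conv_set)
  qed
  ultimately show ?thesis by simp
qed

text \<open>
  The inverse of a prefix makes the roots in the prefix negative and the next root positive.
\<close>

lemma beta_inj:
  assumes "reduced n w"
  shows "inj_on (beta n w) {..<length w}"
proof -
  have "beta n w j \<noteq> beta n w k" if "j < k" "k < length w" for j k
  proof
    assume eq: "beta n w j = beta n w k"
    let ?v = "take k w"
    have "reduced n ?v" using assms reduced_append1 append_take_drop_id by metis
    moreover have "beta n w j = beta n ?v j"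
      using that by (simp add: beta_def min_def)
    ultimately have "(\<lambda>i. - word_prod n (rev ?v) (beta n w k) i) \<in> pos_vecs n"
      using beta_neg[of ?v j] that eq by simp
    moreover have "w \<in> lists (idx n)" using assms by (rule reduced_lists)
    then have "?v \<in> lists (idx n)" "w ! k \<in> idx n"
      using that by (auto simp: in_lists_conv_set dest: in_set_takeD)
    then have "word_prod n (rev ?v) (beta n w k) \<in> pos_vecs n"
      using simple_root_pos[OF n3] by (simp add: beta_def word_rev[OF n3])
    ultimately show False using pos_not_neg[OF n3] by blast
  qed
  then show ?thesis
    by (intro inj_onI) (metis lessThan_iff nat_neq_iff)
qed

text \<open>
  The root is found at the letter where the sign changes. Applied to any word of the longest element,
  this bounds its length from below by the number of positive vectors.
\<close>

lemma inversion_is_beta: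
  assumes "w \<in> lists (idx n)" "v \<in> pos_vecs n" "word_prod n (rev w) v \<notin> pos_vecs n"
  shows "\<exists>k<length w. beta n w k = v"
proof -
  have "rev w \<in> lists (idx n)" using assms(1) by auto
  then obtain x j y where *: "rev w = x @ j # y" "word_prod n y v = simple_root j"
    using sign_change assms by blast
  then have w: "w = rev y @ [j] @ rev x"
    by (metis append.assoc append_Cons append_Nil rev_append rev_rev_ident rev.simps)
  have "rev y \<in> lists (idx n)" using assms(1) w by simp
  then have "beta n w (length y) = v"
    using *(2)[symmetric] word_rev'[OF n3, of "rev y" v] by (simp add: beta_def w nth_append)
  then show ?thesis by (intro exI[of _ "length y"]) (simp add: w)
qed

text \<open>
  At the first occurrence of \<open>i\<close> the root \<open>\<beta>\<close> has \<open>i\<close>-th coordinate 1, and the inverse of the element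
  makes it negative. A word without \<open>i\<close> cannot change this coordinate.
\<close>

lemma reduced_letter_ex:
  assumes w: "reduced n w" and v: "v \<in> lists (idx n)" and eq: "word_prod n v = word_prod n w"
    and i: "i \<in> set w"
  shows "i \<in> set v"
proof (rule ccontr)
  assume "i \<notin> set v"
  obtain x y where xy: "w = x @ i # y" "i \<notin> set x"
    using split_list_first[OF i] by blast
  let ?b = "beta n w (length x)"
  have "?b i = 1"
    using word_other[OF xy(2), of n "simple_root i"] unfolding beta_def xy(1)
    by (simp add: simple_root_def)
  moreover have "word_prod n (rev w) = word_prod n (rev v)"
    using word_prod_rev_cong[OF n3 v reduced_lists[OF w] eq] by simp
  then have "word_prod n (rev w) ?b i = ?b i"
    using \<open>i \<notin> set v\<close> by (simp add: word_other)
  moreover have "0 \<le> - word_prod n (rev w) ?b i"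
    using beta_neg[OF w, of "length x"] by (auto simp: xy(1) pos_vecs_def)
  ultimately show False by simp
qed

text \<open>
  The last letter of a nonempty reduced word is sent to a negative root.
\<close>

lemma positive_trivial:
  assumes "w \<in> lists (idx n)" "\<And>i. i \<in> idx n \<Longrightarrow> word_prod n w (simple_root i) \<in> pos_vecs n"
  shows "word_prod n w = id"
proof -
  obtain v where v: "reduced n v" "word_prod n v = word_prod n w"
    using reduced_word_ex[OF assms(1)] .
  have "v = []"
  proof (rule ccontr)
    assume "v \<noteq> []"
    then obtain x i where x: "v = x @ [i]" by (metis rev_exhaust)
    then have lists: "x \<in> lists (idx n)" "i \<in> idx n" using reduced_lists[OF v(1)] by auto
    then have "word_prod n w (simple_root i) = (\<lambda>k. - word_prod n x (simple_root i) k)"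
      unfolding v(2)[symmetric] x by (simp add: refl_simple_root[OF n3] word_uminus[OF n3])
    then show False
      using assms(2)[OF lists(2)] reduced_last_pos[of x i] v(1) pos_not_neg[OF n3] x by auto
  qed
  then show ?thesis using v(2) by simp
qed

lemma reduced_length_le_card: "reduced n w \<Longrightarrow> finite (pos_vecs n) \<Longrightarrow> length w \<le> card (pos_vecs n)"
  using card_inj_on_le[OF beta_inj, of w "pos_vecs n"] beta_pos by fastforce

end

section \<open>The longest element\<close>

text \<open>
  An explicit candidate for the longest element. The coordinates outside the index set are fixed, as
  they are by all products of reflections.
\<close>

definition w0 :: "nat \<Rightarrow> vec \<Rightarrow> vec" where
  "w0 n v k = (if k \<in> idx n then - v ((vee n ^^ (n + 1)) k) else v k)"

text \<open>
  The twisted Coxeter element of the word \<open>1 2 \<dots> n\<close>. In orthonormal coordinates it is the cyclic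
  rotation with one change of sign, see \<open>eps_twisted_rotation\<close>, so its \<open>(n + 1)\<close>-st power is \<open>- 1\<close>.
\<close>

definition twisted_rotation :: "nat \<Rightarrow> vec \<Rightarrow> vec" where
  "twisted_rotation n v = word_prod n [1..<n + 1] (vee_map n v)"

lemma vee_map_invol [simp]: "vee_map n (vee_map n v) = v"
  by (simp add: vee_map_def)

lemma vee_map_funpow: "(vee_map n ^^ m) v = (\<lambda>k. v ((vee n ^^ m) k))"
proof (induction m)
  case (Suc m)
  then show ?case
    by (simp add: vee_map_def fun_eq_iff) (metis comp_apply funpow.simps(2) funpow_Suc_right)
qed simp

lemma vee_funpow_invol [simp]: "(transpose n (Suc n) ^^ m) ((transpose n (Suc n) ^^ m) k) = k"
proof (induction m arbitrary: k)
  case (Suc m)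
  let ?v = "transpose n (Suc n)"
  have "(?v ^^ Suc m) ((?v ^^ Suc m) k) = (?v ^^ Suc m) (?v ((?v ^^ m) k))"
    by simp
  also have "\<dots> = (?v ^^ m) ((?v ^^ m) k)"
    by (simp add: funpow_swap1)
  finally show ?case using Suc by simp
qed simp

lemma vee_map_funpow_invol [simp]: "(vee_map n ^^ m) ((vee_map n ^^ m) v) = v"
  by (simp add: vee_map_funpow)

lemma len_word_prod: "reduced n w \<Longrightarrow> len n (word_prod n w) = length w"
  using in_reduced_words_iff[of w n "word_prod n w"] by (simp add: reduced_words_def)

lemma weyl_reduced_word:
  assumes "u \<in> weyl n"
  obtains w where "reduced n w" "u = word_prod n w"
proof -
  from assms obtain w where w: "u = word_prod n w" "w \<in> lists (idx n)"
    unfolding weyl_def by (rule imageE)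
  obtain v where "reduced n v" "word_prod n v = word_prod n w"
    by (rule reduced_word_ex[OF w(2)])
  then show thesis using that w(1) by simp
qed

context
  fixes n :: nat
  assumes n3: "n \<ge> 3"
begin

lemma vee_idx [simp]: "transpose n (Suc n) k \<in> idx n \<longleftrightarrow> k \<in> idx n"
  using n3 by (auto simp: transpose_def idx_def)

lemma vee_funpow_idx [simp]: "(transpose n (Suc n) ^^ m) k \<in> idx n \<longleftrightarrow> k \<in> idx n"
  by (induction m) auto

lemma vee_funpow_outside: "k \<notin> idx n \<Longrightarrow> (vee n ^^ m) k = k"
  using n3 by (induction m) (auto simp: transpose_def idx_def)

lemma eps_refl:
  assumes "1 \<le> i" "i \<le> n"
  shows "eps n (refl n i v) k =
    (if k = i then eps n v (i + 1) else if k = i + 1 then eps n v i else eps n v k)"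
proof -
  have i: "i \<in> idx n" "i \<noteq> n + 1" using assms by (auto simp: idx_def)
  show ?thesis
    unfolding refl_eq[OF n3 i(1)] eps_linear form_simple_root[OF n3 i(1)] eps_simple_root[OF n3 i(1)]
    using i(2) by simp
qed

lemma eps_vee_map: "eps n (vee_map n v) k = (if k = n + 1 then - eps n v (n + 1) else eps n v k)"
proof -
  consider "k = n + 1" | "k = n" | "k \<noteq> n" "k \<noteq> n + 1" by blast
  then show ?thesis
  proof cases
    case 1
    then show ?thesis by (simp add: eps_def vee_map_def idx_def)
  next
    case 2
    then have "n - 1 \<noteq> n" "n - 1 \<noteq> n + 1" "n \<in> idx n" using n3 by (auto simp: idx_def)
    then show ?thesis using 2 by (simp add: eps_def vee_map_def transpose_def)
  next
    case 3
    then have "k \<in> idx n \<longrightarrow> k - 1 \<noteq> n \<and> k - 1 \<noteq> n + 1" by (auto simp: idx_def)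
    then show ?thesis using 3 by (simp add: eps_def vee_map_def transpose_def)
  qed
qed

lemma eps_chain:
  assumes "1 \<le> i" "i \<le> n + 1"
  shows "eps n (word_prod n [i..<n + 1] v) k =
    (if k = i then eps n v (n + 1) else if i < k \<and> k \<le> n + 1 then eps n v (k - 1) else eps n v k)"
  using assms(2,1)
proof (induction i arbitrary: k rule: inc_induct)
  case (step i)
  have "[i..<n + 1] = i # [Suc i..<n + 1]"
    using step.hyps by (simp add: upt_conv_Cons)
  then have *: "eps n (word_prod n [i..<n + 1] v) k = eps n (refl n i (word_prod n [Suc i..<n + 1] v)) k"
    by simp
  show ?case
    unfolding * using step.hyps step.prems step.IH by (subst eps_refl) auto
qed simp

lemma eps_twisted_rotation:
  "eps n (twisted_rotation n v) k =
    (if k \<notin> idx n then eps n v k else if k = 1 then - eps n v (n + 1) else eps n v (k - 1))"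
  unfolding twisted_rotation_def using n3
  by (subst eps_chain) (auto simp: eps_vee_map idx_def)

lemma eps_twisted_rotation_funpow:
  assumes "m \<le> n + 1"
  shows "eps n ((twisted_rotation n ^^ m) v) k =
    (if k \<notin> idx n then eps n v k else if m < k then eps n v (k - m) else - eps n v (n + 1 + k - m))"
  using assms
proof (induction m arbitrary: k)
  case 0
  then show ?case by (auto simp: idx_def)
next
  case (Suc m)
  then have IH: "eps n ((twisted_rotation n ^^ m) v) l =
    (if l \<notin> idx n then eps n v l else if m < l then eps n v (l - m) else - eps n v (n + 1 + l - m))" for l
    by simp
  consider "k \<notin> idx n" | "k = 1" | "k \<in> idx n" "k \<noteq> 1" "k - 1 \<in> idx n"
    by (force simp: idx_def)
  then show ?case
  proof cases
    case 1
    then show ?thesis by (simp add: eps_twisted_rotation IH)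
  next
    case 2
    then show ?thesis using Suc.prems n3 by (simp add: eps_twisted_rotation IH) (simp add: idx_def)
  next
    case 3
    then have "m < k - 1 \<longleftrightarrow> Suc m < k" "k - 1 - m = k - Suc m" "n + 1 + (k - 1) - m = n + 1 + k - Suc m"
      by (auto simp: idx_def)
    then show ?thesis using 3 by (simp add: eps_twisted_rotation IH)
  qed
qed

lemma twisted_rotation_power:
  "(twisted_rotation n ^^ (n + 1)) v = (\<lambda>k. if k \<in> idx n then - v k else v k)"
proof (rule eps_inj[OF n3], rule ext)
  fix k
  have "eps n (\<lambda>k. if k \<in> idx n then - v k else v k) k = (if k \<in> idx n then - eps n v k else eps n v k)"
    using n3 by (auto simp: eps_def idx_def)
  moreover have "n + 1 + k - (n + 1) = k" "k \<in> idx n \<Longrightarrow> \<not> n + 1 < k"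
    by (auto simp: idx_def)
  ultimately show "eps n ((twisted_rotation n ^^ (n + 1)) v) k = eps n (\<lambda>k. if k \<in> idx n then - v k else v k) k"
    by (subst eps_twisted_rotation_funpow) auto
qed

lemma form_vee_map: "form n (vee_map n x) (vee_map n y) = form n x y"
  unfolding form_def by (intro sum.cong) (auto simp: eps_vee_map)

lemma vee_map_simple_root: "vee_map n (simple_root i) = simple_root (vee n i)"
  by (auto simp: vee_map_def simple_root_def fun_eq_iff)

lemma refl_vee:
  assumes "i \<in> idx n"
  shows "refl n (vee n i) (vee_map n v) = vee_map n (refl n i v)"
proof -
  have "form n (simple_root (vee n i)) (vee_map n v) = form n (simple_root i) v"
    using form_vee_map[of "simple_root i" v] by (simp add: vee_map_simple_root)
  moreover have "simple_root (vee n i) k = simple_root i (vee n k)" for k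
    using vee_map_simple_root[of i] by (simp add: vee_map_def fun_eq_iff)
  moreover have "vee n i \<in> idx n" using assms by simp
  ultimately show ?thesis
    by (simp only: refl_eq[OF n3] assms) (simp only: vee_map_def)
qed

lemma word_prod_map_vee:
  "w \<in> lists (idx n) \<Longrightarrow>
    word_prod n (map (vee n ^^ m) w) ((vee_map n ^^ m) v) = (vee_map n ^^ m) (word_prod n w v)"
proof (induction m)
  case (Suc m)
  have step: "word_prod n (map (vee n) u) (vee_map n x) = vee_map n (word_prod n u x)"
    if "u \<in> lists (idx n)" for u x
    using that by (induction u) (auto simp: refl_vee[simplified])
  have "map (vee n ^^ m) w \<in> lists (idx n)" using Suc.prems by auto
  then show ?case using step[of "map (vee n ^^ m) w" "(vee_map n ^^ m) v"] Suc by (simp add: comp_def)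
qed simp

lemma first_round_lists: "[1..<n + 1] \<in> lists (idx n)"
  by (auto simp: idx_def)

text \<open>
  Conjugation by \<open>\<or>\<close> realises the exchange of letters, so the \<open>\<or>\<close> between consecutive rounds
  can be collected on the right.
\<close>

lemma word_prod_rounds:
  "word_prod n (concat (map (\<lambda>k. map (vee n ^^ k) [1..<n + 1]) [0..<m])) v =
    (twisted_rotation n ^^ m) ((vee_map n ^^ m) v)"
proof (induction m arbitrary: v)
  case (Suc m)
  let ?u = "[1..<n + 1]" and ?V = "vee_map n ^^ m"
  have "word_prod n (map (vee n ^^ m) ?u) v = ?V (word_prod n ?u (?V v))"
    using word_prod_map_vee[OF first_round_lists, of m "?V v"] by simp
  also have "word_prod n ?u (?V v) = twisted_rotation n ((vee_map n ^^ Suc m) v)"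
    by (simp add: twisted_rotation_def)
  finally show ?case
    using Suc by (simp add: funpow_swap1 del: upt_Suc) (simp add: upt_Suc)
qed simp

lemma word_prod_initial: "word_prod n (initial_word n) = w0 n"
proof (intro ext)
  fix v k
  have "word_prod n (initial_word n) v k =
      (if k \<in> idx n then - v ((vee n ^^ (n + 1)) k) else v ((vee n ^^ (n + 1)) k))"
    unfolding initial_word_def word_prod_rounds twisted_rotation_power vee_map_funpow ..
  then show "word_prod n (initial_word n) v k = w0 n v k"
    using vee_funpow_outside[of k "n + 1"] by (cases "k \<in> idx n") (simp_all only: w0_def if_True if_False not_False_eq_True simp_thms)
qed

lemma initial_lists: "initial_word n \<in> lists (idx n)"
  unfolding initial_word_def using first_round_lists by (auto simp: in_lists_conv_set)

lemma length_initial: "length (initial_word n) = n * (n + 1)"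
  by (simp add: initial_word_def length_concat comp_def sum_list_triv)

lemma w0_simple_root:
  assumes "i \<in> idx n"
  shows "w0 n (simple_root i) = (\<lambda>k. - simple_root ((vee n ^^ (n + 1)) i) k)"
proof
  fix k
  have "(vee n ^^ (n + 1)) k = i \<longleftrightarrow> k = (vee n ^^ (n + 1)) i"
    by (metis vee_funpow_invol[unfolded Suc_eq_plus1])
  then show "w0 n (simple_root i) k = - simple_root ((vee n ^^ (n + 1)) i) k"
    using assms vee_funpow_idx[of "Suc n" i]
    by (auto simp: w0_def simple_root_def simp del: funpow.simps)
qed

lemma w0_invol: "w0 n (w0 n v) = v"
  by (auto simp: w0_def fun_eq_iff simp del: funpow.simps)

lemma vee_map_pos: "v \<in> pos_vecs n \<Longrightarrow> vee_map n v \<in> pos_vecs n"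
  by (simp add: pos_vecs_def norm2_vecs_def form_vee_map) (simp add: vee_map_def)

lemma w0_neg: "v \<in> pos_vecs n \<Longrightarrow> w0 n v \<notin> pos_vecs n"
proof -
  assume v: "v \<in> pos_vecs n"
  have "(vee_map n ^^ m) v \<in> pos_vecs n" for m
    by (induction m) (auto simp: v vee_map_pos)
  then have "(\<lambda>k. - (vee_map n ^^ (n + 1)) v k) \<notin> pos_vecs n"
    using pos_not_neg[OF n3] by blast
  moreover have "(\<lambda>k. - (vee_map n ^^ (n + 1)) v k) = w0 n v"
    unfolding vee_map_funpow w0_def using v vee_funpow_idx[of "Suc n"]
    by (auto simp: fun_eq_iff pos_vecs_def norm2_vecs_def simp del: funpow.simps)
  ultimately show ?thesis by simp
qed

lemma word_prod_rev_w0: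
  assumes "w \<in> lists (idx n)" "word_prod n w = w0 n"
  shows "word_prod n (rev w) = w0 n"
proof
  fix v
  show "word_prod n (rev w) v = w0 n v"
    using word_rev[OF n3 assms(1), of "w0 n v"] by (simp only: assms(2) w0_invol)
qed

text \<open>
  Every positive vector is an inversion of the longest element.
\<close>

lemma pos_subset_beta:
  assumes "w \<in> lists (idx n)" "word_prod n w = w0 n"
  shows "pos_vecs n \<subseteq> beta n w ` {..<length w}"
  using inversion_is_beta[OF n3 assms(1)] w0_neg word_prod_rev_w0[OF assms] by fastforce

lemma finite_pos: "finite (pos_vecs n)"
  using pos_subset_beta[OF initial_lists word_prod_initial] finite_subset by blast

lemma w0_word_length_ge:
  assumes "w \<in> lists (idx n)" "word_prod n w = w0 n"
  shows "n * (n + 1) \<le> length w"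
  using card_pos_ge[OF n3 finite_pos] surj_card_le[OF _ pos_subset_beta[OF assms]] by simp

lemma card_pos: "card (pos_vecs n) = n * (n + 1)"
  using card_pos_ge[OF n3 finite_pos] surj_card_le[OF _ pos_subset_beta[OF initial_lists word_prod_initial]]
  by (simp add: length_initial)

lemma reduced_initial: "reduced n (initial_word n)"
  using w0_word_length_ge by (simp add: reduced_def initial_lists length_initial word_prod_initial)

lemma beta_image_pos:
  assumes "reduced n w" "length w = n * (n + 1)"
  shows "beta n w ` {..<length w} = pos_vecs n"
  using assms finite_pos beta_inj[OF n3 assms(1)] beta_pos[OF n3 assms(1)]
  by (intro card_subset_eq) (auto simp: card_image card_pos)

text \<open>
  A longest element has as many inversions as there are positive vectors, hence makes all of them
  negative just as the candidate does. The quotient of the two keeps all simple roots positive and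
  is therefore trivial.
\<close>

lemma longest_eq: "longest n = w0 n"
proof -
  have w0_len: "len n (w0 n) = n * (n + 1)"
    using len_word_prod[OF reduced_initial] by (simp add: word_prod_initial length_initial)
  have w0_in: "w0 n \<in> weyl n"
    unfolding weyl_def using word_prod_initial initial_lists by (metis imageI)
  have le: "len n u \<le> n * (n + 1)" if "u \<in> weyl n" for u
  proof -
    obtain v where "reduced n v" "u = word_prod n v" by (rule weyl_reduced_word[OF \<open>u \<in> weyl n\<close>])
    then show ?thesis
      using len_word_prod reduced_length_le_card[OF n3 _ finite_pos] card_pos by metis
  qed
  have "is_arg_max (len n) (\<lambda>u. u \<in> weyl n) (w0 n)"
    unfolding is_arg_max_def using w0_len w0_in le by (auto simp: not_less)
  then have max: "is_arg_max (len n) (\<lambda>u. u \<in> weyl n) (longest n)"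
    unfolding longest_def arg_max_def by (rule someI[where P = "is_arg_max (len n) (\<lambda>u. u \<in> weyl n)"])
  then have "longest n \<in> weyl n"
    by (simp add: is_arg_max_def)
  then obtain w where w: "reduced n w" "longest n = word_prod n w"
    by (rule weyl_reduced_word)
  have "n * (n + 1) \<le> len n (longest n)"
    using max w0_len w0_in by (auto simp: is_arg_max_def not_less)
  then have "length w = n * (n + 1)"
    using w(2) len_word_prod[OF w(1)] le[OF \<open>longest n \<in> weyl n\<close>] by simp
  then have all: "beta n w ` {..<length w} = pos_vecs n"
    using beta_image_pos w(1) by blast
  have lists: "w \<in> lists (idx n)" using w(1) by (rule reduced_lists)
  then have lists': "rev w @ initial_word n \<in> lists (idx n)"
    using initial_lists by auto
  have "word_prod n (rev w @ initial_word n) = id"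
  proof (rule positive_trivial[OF n3 lists'])
    fix i assume i: "i \<in> idx n"
    let ?j = "(vee n ^^ (n + 1)) i"
    have "simple_root ?j \<in> pos_vecs n" using i by (intro simple_root_pos[OF n3]) simp
    then obtain k where "k < length w" "beta n w k = simple_root ?j" using all by force
    then have "(\<lambda>l. - word_prod n (rev w) (simple_root ?j) l) \<in> pos_vecs n"
      using beta_neg[OF n3 w(1)] by force
    moreover have "rev w \<in> lists (idx n)" using lists by auto
    ultimately show "word_prod n (rev w @ initial_word n) (simple_root i) \<in> pos_vecs n"
      using i by (simp add: word_prod_initial w0_simple_root word_uminus[OF n3] del: funpow.simps)
  qed
  then have "word_prod n (rev w) (w0 n v) = v" for v
    by (simp add: word_prod_initial fun_eq_iff)
  then have "w0 n v = word_prod n w v" for v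
    using word_rev'[OF n3 lists] by metis
  then show ?thesis using w(2) by auto
qed

text \<open>
  The number of positive vectors is \<open>n * (n + 1)\<close>, so reducedness of a word of the longest element is
  a matter of counting letters.
\<close>

lemma w0_words_iff:
  "w \<in> reduced_words n (longest n) \<longleftrightarrow>
    w \<in> lists (idx n) \<and> word_prod n w = w0 n \<and> length w = n * (n + 1)"
proof -
  have "length w = n * (n + 1)" if "reduced n w" "word_prod n w = w0 n"
    using that len_word_prod[OF reduced_initial] len_word_prod[OF that(1)]
    by (simp add: word_prod_initial length_initial)
  moreover have "reduced n w" if "w \<in> lists (idx n)" "word_prod n w = w0 n" "length w = n * (n + 1)"
    using that w0_word_length_ge by (auto simp: reduced_def)
  ultimately show ?thesis
    unfolding in_reduced_words_iff longest_eq using reduced_lists by blast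
qed

lemma star_eq:
  assumes "i \<in> idx n"
  shows "star n i = (vee n ^^ (n + 1)) i"
  unfolding star_def longest_eq w0_simple_root[OF assms] using assms
  by (intro the_equality) (auto simp: fun_eq_iff simple_root_def split: if_splits)

lemma star_idx: "i \<in> idx n \<Longrightarrow> star n i \<in> idx n"
  by (simp add: star_eq del: funpow.simps)

lemma w0_refl:
  assumes "i \<in> idx n"
  shows "w0 n (refl n i v) = refl n (star n i) (w0 n v)" "w0 n (refl n (star n i) v) = refl n i (w0 n v)"
proof -
  have *: "w0 n (refl n j v) = refl n (star n j) (w0 n v)" if "j \<in> idx n" for j
  proof -
    have "word_prod n (initial_word n) (simple_root j) = (\<lambda>k. - 1 * simple_root (star n j) k)"
      unfolding word_prod_initial w0_simple_root[OF that] star_eq[OF that] by simp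
    then have "w0 n \<circ> refl n j = refl n (star n j) \<circ> w0 n"
      using word_conj[OF n3 initial_lists that star_idx[OF that], of "- 1"] word_prod_initial by simp
    then show ?thesis by (simp add: fun_eq_iff)
  qed
  show "w0 n (refl n i v) = refl n (star n i) (w0 n v)" using * assms .
  have "star n (star n i) = i"
    using assms star_idx[OF assms] by (simp add: star_eq del: funpow.simps)
  then show "w0 n (refl n (star n i) v) = refl n i (w0 n v)"
    using *[OF star_idx[OF assms]] by simp
qed

lemma rotate_first:
  assumes "i # w \<in> reduced_words n (longest n)"
  shows "w @ [star n i] \<in> reduced_words n (longest n)"
proof -
  have *: "i \<in> idx n" "w \<in> lists (idx n)" "refl n i \<circ> word_prod n w = w0 n" "Suc (length w) = n * (n + 1)"
    using assms by (auto simp: w0_words_iff)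
  have "word_prod n w v = refl n i (w0 n v)" for v
    using *(3)[symmetric] refl_invol[OF n3 *(1)] by simp
  then have "word_prod n (w @ [star n i]) = w0 n"
    using w0_refl(2)[OF *(1)] refl_invol[OF n3 *(1)] by (intro ext) simp
  then show ?thesis using * star_idx by (simp add: w0_words_iff)
qed

lemma rotate_last:
  assumes "w @ [i] \<in> reduced_words n (longest n)"
  shows "star n i # w \<in> reduced_words n (longest n)"
proof -
  have *: "i \<in> idx n" "w \<in> lists (idx n)" "word_prod n w \<circ> refl n i = w0 n" "Suc (length w) = n * (n + 1)"
    using assms by (auto simp: w0_words_iff)
  have "word_prod n w v = w0 n (refl n i v)" for v
    using *(3)[symmetric] refl_invol[OF n3 *(1)] by simp
  then have "word_prod n (star n i # w) = w0 n"
    using w0_refl(1)[OF *(1)] refl_invol[OF n3 star_idx[OF *(1)]] by (intro ext) simp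
  then show ?thesis using * star_idx by (simp add: w0_words_iff)
qed

end

section \<open>Commutation classes\<close>

definition dependent :: "nat \<Rightarrow> nat \<Rightarrow> nat \<Rightarrow> bool" where
  "dependent n i j \<longleftrightarrow> i = j \<or> adjacent n i j"

text \<open>
  A rearrangement of positions that carries letters and roots along and keeps the order of equal and
  of adjacent letters. Everything that is shared by the words of a commutation class is read off such
  rearrangements.
\<close>

definition rearranged :: "nat \<Rightarrow> nat list \<Rightarrow> nat list \<Rightarrow> bool" where
  "rearranged n w w' \<longleftrightarrow> (\<exists>\<pi>. bij_betw \<pi> {..<length w} {..<length w'} \<and>
     (\<forall>k<length w. w' ! \<pi> k = w ! k \<and> beta n w' (\<pi> k) = beta n w k) \<and>
     (\<forall>j<length w. \<forall>k<length w. dependent n (w ! j) (w ! k) \<longrightarrow> (j < k \<longleftrightarrow> \<pi> j < \<pi> k)))"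

lemma commutation_step_sym: "(v, w) \<in> commutation_step n \<Longrightarrow> (w, v) \<in> commutation_step n"
  unfolding commutation_step_def by fastforce

lemma commutation_steps_sym: "(v, w) \<in> (commutation_step n)\<^sup>* \<Longrightarrow> (w, v) \<in> (commutation_step n)\<^sup>*"
  by (metis commutation_step_sym symI sym_rtrancl symD)

lemma self_in_class: "w \<in> commutation_class n w"
  by (simp add: commutation_class_def)

lemma commutation_class_eq: "v \<in> commutation_class n w \<Longrightarrow> commutation_class n v = commutation_class n w"
proof -
  assume "v \<in> commutation_class n w"
  then have "(w, v) \<in> (commutation_step n)\<^sup>*" by (simp add: commutation_class_def)
  moreover from this have "(v, w) \<in> (commutation_step n)\<^sup>*" by (rule commutation_steps_sym)
  ultimately show ?thesis
    unfolding commutation_class_def by (auto intro: rtrancl_trans)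
qed

lemma commutation_step_context:
  "(v, w) \<in> commutation_step n \<Longrightarrow> (x @ v @ y, x @ w @ y) \<in> commutation_step n"
proof -
  assume "(v, w) \<in> commutation_step n"
  then obtain p q i j where "v = p @ [i, j] @ q" "w = p @ [j, i] @ q"
      "refl n i \<circ> refl n j = refl n j \<circ> refl n i"
    unfolding commutation_step_def by blast
  then show ?thesis
    unfolding commutation_step_def by (intro CollectI exI[of _ "x @ p"] exI[of _ "q @ y"]) auto
qed

lemma commutation_steps_context:
  "(v, w) \<in> (commutation_step n)\<^sup>* \<Longrightarrow> (x @ v @ y, x @ w @ y) \<in> (commutation_step n)\<^sup>*"
  by (induction rule: rtrancl_induct) (auto intro: rtrancl_into_rtrancl commutation_step_context)

lemma class_Cons: "v \<in> commutation_class n w \<Longrightarrow> i # v \<in> commutation_class n (i # w)"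
  unfolding commutation_class_def using commutation_steps_context[of w v n "[i]" "[]"] by simp

lemma rearranged_obtain:
  assumes "rearranged n v w"
  obtains p where "bij_betw p {..<length v} {..<length w}"
    "\<forall>k<length v. p k < length w \<and> w ! p k = v ! k \<and> beta n w (p k) = beta n v k"
    "\<forall>j<length v. \<forall>k<length v. dependent n (v ! j) (v ! k) \<longrightarrow> (j < k \<longleftrightarrow> p j < p k)"
proof -
  obtain p where p: "bij_betw p {..<length v} {..<length w}"
    "\<forall>k<length v. w ! p k = v ! k \<and> beta n w (p k) = beta n v k"
    "\<forall>j<length v. \<forall>k<length v. dependent n (v ! j) (v ! k) \<longrightarrow> (j < k \<longleftrightarrow> p j < p k)"
    using assms unfolding rearranged_def by (elim exE conjE) (rule that)
  have "p k < length w" if "k < length v" for k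
    using bij_betwE[OF p(1)] that by simp
  with p show thesis by (intro that[of p]) blast+
qed

lemma rearranged_trans:
  assumes "rearranged n u v" "rearranged n v w"
  shows "rearranged n u w"
proof -
  obtain p where p: "bij_betw p {..<length u} {..<length v}"
    "\<forall>k<length u. p k < length v \<and> v ! p k = u ! k \<and> beta n v (p k) = beta n u k"
    "\<forall>j<length u. \<forall>k<length u. dependent n (u ! j) (u ! k) \<longrightarrow> (j < k \<longleftrightarrow> p j < p k)"
    by (rule rearranged_obtain[OF assms(1)])
  obtain q where q: "bij_betw q {..<length v} {..<length w}"
    "\<forall>k<length v. q k < length w \<and> w ! q k = v ! k \<and> beta n w (q k) = beta n v k"
    "\<forall>j<length v. \<forall>k<length v. dependent n (v ! j) (v ! k) \<longrightarrow> (j < k \<longleftrightarrow> q j < q k)"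
    by (rule rearranged_obtain[OF assms(2)])
  show ?thesis
    unfolding rearranged_def
  proof (intro exI[of _ "q \<circ> p"] conjI allI impI)
    show "bij_betw (q \<circ> p) {..<length u} {..<length w}"
      using p(1) q(1) by (rule bij_betw_trans)
  next
    fix j k assume jk: "j < length u" "k < length u" "dependent n (u ! j) (u ! k)"
    then have "j < k \<longleftrightarrow> p j < p k" using p(3) by blast
    also have "\<dots> \<longleftrightarrow> q (p j) < q (p k)" using jk p(2) q(3) by metis
    finally show "j < k \<longleftrightarrow> (q \<circ> p) j < (q \<circ> p) k" by simp
  qed (simp_all add: p(2) q(2))
qed

lemma beta_take: "k < m \<Longrightarrow> beta n (take m w) k = beta n w k"
  by (simp add: beta_def min_def)

lemma word_order_beta:
  "j < k \<Longrightarrow> k < length w \<Longrightarrow> (beta n w j, beta n w k) \<in> word_order n w"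
  by (auto simp: word_order_def)

text \<open>
  The maximum and minimum say that none of the two letters occurs in between.
\<close>

lemma ar_arrows_nearest:
  "ar_arrows (word_ar_quiver n w) = {(beta n w k, beta n w j) |k j. j < k \<and> k < length w \<and>
     adjacent n (w ! k) (w ! j) \<and> (\<forall>l. j < l \<and> l < k \<longrightarrow> w ! l \<noteq> w ! j \<and> w ! l \<noteq> w ! k)}"
proof -
  have max: "j = Max {j'. j' < k \<and> w ! j' = w ! j} \<longleftrightarrow> (\<forall>l. j < l \<and> l < k \<longrightarrow> w ! l \<noteq> w ! j)"
    if "j < k" for j k
  proof -
    have "Max {j'. j' < k \<and> w ! j' = w ! j} = j \<longleftrightarrow> (\<forall>l\<in>{j'. j' < k \<and> w ! j' = w ! j}. l \<le> j)"
      using that by (subst Max_eq_iff) auto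
    also have "\<dots> \<longleftrightarrow> (\<forall>l. j < l \<and> l < k \<longrightarrow> w ! l \<noteq> w ! j)"
      by (simp add: Ball_def) (meson not_le)
    finally show ?thesis by (simp only: eq_commute[of j])
  qed
  have min: "k = Min {k'. j < k' \<and> k' < length w \<and> w ! k' = w ! k} \<longleftrightarrow>
      (\<forall>l. j < l \<and> l < k \<longrightarrow> w ! l \<noteq> w ! k)" if "j < k" "k < length w" for j k
  proof -
    have "Min {k'. j < k' \<and> k' < length w \<and> w ! k' = w ! k} = k \<longleftrightarrow>
        (\<forall>l\<in>{k'. j < k' \<and> k' < length w \<and> w ! k' = w ! k}. k \<le> l)"
      using that by (subst Min_eq_iff) auto
    also have "\<dots> \<longleftrightarrow> (\<forall>l. j < l \<and> l < k \<longrightarrow> w ! l \<noteq> w ! k)"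
      using that(2) by (simp add: Ball_def) (meson not_le order_less_trans)
    finally show ?thesis by (simp only: eq_commute[of k])
  qed
  show ?thesis
    unfolding word_ar_quiver_def ar_quiver.simps
  proof (intro Collect_cong ex_cong1)
    fix x k j
    show "(x = (beta n w k, beta n w j) \<and> j < k \<and> k < length w \<and> adjacent n (w ! k) (w ! j) \<and>
        j = Max {j'. j' < k \<and> w ! j' = w ! j} \<and>
        k = Min {k'. j < k' \<and> k' < length w \<and> w ! k' = w ! k}) \<longleftrightarrow>
      (x = (beta n w k, beta n w j) \<and> j < k \<and> k < length w \<and> adjacent n (w ! k) (w ! j) \<and>
        (\<forall>l. j < l \<and> l < k \<longrightarrow> w ! l \<noteq> w ! j \<and> w ! l \<noteq> w ! k))"
    proof (cases "j < k \<and> k < length w")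
      case True
      show ?thesis
        unfolding max[OF conjunct1[OF True]] min[OF conjunct1[OF True] conjunct2[OF True]] by blast
    qed blast
  qed
qed

lemma rearranged_ar_subset:
  assumes "rearranged n w w'"
  shows "ar_residues (word_ar_quiver n w) \<subseteq> ar_residues (word_ar_quiver n w')"
    "ar_arrows (word_ar_quiver n w) \<subseteq> ar_arrows (word_ar_quiver n w')"
proof -
  obtain p where p: "bij_betw p {..<length w} {..<length w'}"
    and p': "\<forall>k<length w. p k < length w' \<and> w' ! p k = w ! k \<and> beta n w' (p k) = beta n w k"
      "\<forall>j<length w. \<forall>k<length w. dependent n (w ! j) (w ! k) \<longrightarrow> (j < k \<longleftrightarrow> p j < p k)"
    by (rule rearranged_obtain[OF assms])
  have range: "\<And>k. k < length w \<Longrightarrow> p k < length w'"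
    and letter: "\<And>k. k < length w \<Longrightarrow> w' ! p k = w ! k"
    and root: "\<And>k. k < length w \<Longrightarrow> beta n w' (p k) = beta n w k"
    and mono: "\<And>j k. j < length w \<Longrightarrow> k < length w \<Longrightarrow> dependent n (w ! j) (w ! k) \<Longrightarrow> j < k \<longleftrightarrow> p j < p k"
    using p' by blast+
  have surj: "\<exists>k<length w. p k = l" if "l < length w'" for l
    using bij_betw_imp_surj_on[OF p] that by (metis imageE lessThan_iff)
  show "ar_residues (word_ar_quiver n w) \<subseteq> ar_residues (word_ar_quiver n w')"
  proof
    fix x assume "x \<in> ar_residues (word_ar_quiver n w)"
    then obtain k where "k < length w" "x = (beta n w k, w ! k)"
      by (auto simp: word_ar_quiver_def)
    then have "p k < length w' \<and> x = (beta n w' (p k), w' ! p k)"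
      by (simp add: range letter root)
    then show "x \<in> ar_residues (word_ar_quiver n w')"
      by (auto simp: word_ar_quiver_def)
  qed
  show "ar_arrows (word_ar_quiver n w) \<subseteq> ar_arrows (word_ar_quiver n w')"
    unfolding ar_arrows_nearest
  proof safe
    fix k j assume jk: "j < k" "k < length w" and adj: "adjacent n (w ! k) (w ! j)"
      and near: "\<forall>l. j < l \<and> l < k \<longrightarrow> w ! l \<noteq> w ! j \<and> w ! l \<noteq> w ! k"
    have adj': "adjacent n (w ! j) (w ! k)" using adj adjacent_sym by blast
    have "w' ! l \<noteq> w' ! p j \<and> w' ! l \<noteq> w' ! p k" if l: "p j < l" "l < p k" for l
    proof -
      obtain m where m: "m < length w" "p m = l"
        using surj[of l] l(2) range[OF jk(2)] by auto
      have "j < m \<and> m < k" if "w ! m = w ! j \<or> w ! m = w ! k"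
      proof -
        have "dependent n (w ! j) (w ! m)" "dependent n (w ! m) (w ! k)"
          using that adj' by (auto simp: dependent_def)
        then show ?thesis using mono[of j m] mono[of m k] m jk l by simp
      qed
      then have "w ! m \<noteq> w ! j \<and> w ! m \<noteq> w ! k"
        using near by blast
      moreover have "w' ! l = w ! m" "w' ! p j = w ! j" "w' ! p k = w ! k"
        using letter[of m] letter[of j] letter[of k] m jk by simp_all
      ultimately show ?thesis by simp
    qed
    moreover have "p j < p k"
      using mono[of j k] jk adj' by (simp add: dependent_def)
    ultimately show "\<exists>k' j'. (beta n w k, beta n w j) = (beta n w' k', beta n w' j') \<and> j' < k' \<and>
        k' < length w' \<and> adjacent n (w' ! k') (w' ! j') \<and>
        (\<forall>l. j' < l \<and> l < k' \<longrightarrow> w' ! l \<noteq> w' ! j' \<and> w' ! l \<noteq> w' ! k')"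
      using jk letter[of j] letter[of k] root[of j] root[of k] range[of k] adj
      by (intro exI[of _ "p k"] exI[of _ "p j"]) simp
  qed
qed

context
  fixes n :: nat
  assumes n3: "n \<ge> 3"
begin

lemma refl_fixes:
  assumes "i \<in> idx n" "j \<in> idx n" "\<not> dependent n i j"
  shows "refl n i (simple_root j) = simple_root j"
  using assms refl_simple_other[OF n3 assms(1,2)] by (auto simp: dependent_def)

lemma word_fixes:
  assumes "w \<in> lists (idx n)" "j \<in> idx n" "\<And>i. i \<in> set w \<Longrightarrow> \<not> dependent n i j"
  shows "word_prod n w (simple_root j) = simple_root j"
  using assms by (induction w) (auto simp: refl_fixes)

text \<open>
  The transposition of the two positions. The roots do not change, because each of the exchanged
  reflections fixes the simple root of the other letter.
\<close>

lemma step_rearranged: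
  assumes "(w, w') \<in> commutation_step n" "w \<in> lists (idx n)"
  shows "rearranged n w w' \<and> w' \<in> lists (idx n) \<and> word_prod n w' = word_prod n w \<and> length w' = length w"
proof -
  obtain u v i j where w: "w = u @ [i, j] @ v" "w' = u @ [j, i] @ v"
      and com: "refl n i \<circ> refl n j = refl n j \<circ> refl n i"
    using assms(1) unfolding commutation_step_def by blast
  have ij: "i \<in> idx n" "j \<in> idx n" using assms(2) w by auto
  then have nadj: "\<not> adjacent n i j" using com refl_commute_iff[OF n3] by blast
  have prod: "word_prod n (u @ [j, i] @ x) = word_prod n (u @ [i, j] @ x)" for x
    using com by (simp add: comp_assoc[symmetric])
  have "rearranged n w w'"
  proof (cases "i = j")
    case True
    then show ?thesis unfolding w rearranged_def by (intro exI[of _ id]) auto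
  next
    case False
    let ?m = "length u"
    let ?p = "transpose ?m (Suc ?m)"
    have indep: "\<not> dependent n i j" "\<not> dependent n j i"
      using nadj False adjacent_sym by (auto simp: dependent_def)
    have "bij_betw ?p {..<length w} {..<length w'}"
      by (rule bij_betw_byWitness[of _ ?p]) (auto simp: w transpose_def)
    moreover have "w' ! ?p k = w ! k \<and> beta n w' (?p k) = beta n w k" if "k < length w" for k
    proof -
      consider "k < ?m" | "k = ?m" | "k = Suc ?m" | l where "k = ?m + 2 + l"
        by (metis add_2_eq_Suc' le_add_diff_inverse less_Suc_eq less_antisym not_less)
      then show ?thesis
      proof cases
        case 1
        then show ?thesis by (auto simp: w beta_def nth_append transpose_def)
      next
        case 2
        then show ?thesis using refl_fixes[OF ij(2,1) indep(2)] by (simp add: w beta_def nth_append)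
      next
        case 3
        then show ?thesis using refl_fixes[OF ij indep(1)] by (simp add: w beta_def nth_append)
      next
        case 4
        then have "?p k = k" "w' ! k = w ! k" "take k w' = u @ [j, i] @ take l v" "take k w = u @ [i, j] @ take l v"
          by (auto simp: w transpose_def nth_append)
        then show ?thesis using prod[of "take l v"] by (simp add: beta_def)
      qed
    qed
    moreover have "a < b \<longleftrightarrow> ?p a < ?p b" if "dependent n (w ! a) (w ! b)" for a b
    proof -
      have "\<not> (a = ?m \<and> b = Suc ?m)" "\<not> (b = ?m \<and> a = Suc ?m)"
        using that indep by (auto simp: w nth_append)
      then show ?thesis by (auto simp: transpose_def)
    qed
    ultimately show ?thesis unfolding rearranged_def by blast
  qed
  moreover have "w' \<in> lists (idx n)" using assms(2) w by auto
  moreover have "word_prod n w' = word_prod n w" unfolding w by (rule prod)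
  ultimately show ?thesis by (simp add: w)
qed

lemma class_rearranged:
  assumes "w' \<in> commutation_class n w" "w \<in> lists (idx n)"
  shows "rearranged n w w' \<and> w' \<in> lists (idx n) \<and> word_prod n w' = word_prod n w \<and> length w' = length w"
proof -
  have "(w, w') \<in> (commutation_step n)\<^sup>*" using assms(1) by (simp add: commutation_class_def)
  then show ?thesis
  proof (induction rule: rtrancl_induct)
    case base
    have "rearranged n w w" unfolding rearranged_def by (intro exI[of _ id]) auto
    then show ?case using assms(2) by simp
  next
    case (step y z)
    then show ?case using step_rearranged[of y z] rearranged_trans by metis
  qed
qed

lemma class_w0_words:
  "w \<in> reduced_words n (longest n) \<Longrightarrow> w' \<in> commutation_class n w \<Longrightarrow> w' \<in> reduced_words n (longest n)"
  using class_rearranged unfolding w0_words_iff[OF n3] by metis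

lemma class_word_ar_quiver:
  assumes "w' \<in> commutation_class n w" "w \<in> lists (idx n)"
  shows "word_ar_quiver n w' = word_ar_quiver n w"
proof -
  have "rearranged n w w'" "w' \<in> lists (idx n)" using class_rearranged assms by auto
  moreover have "w \<in> commutation_class n w'" using commutation_class_eq[OF assms(1)] self_in_class by blast
  ultimately have "rearranged n w w'" "rearranged n w' w" using class_rearranged by auto
  then have "ar_residues (word_ar_quiver n w') = ar_residues (word_ar_quiver n w)"
    "ar_arrows (word_ar_quiver n w') = ar_arrows (word_ar_quiver n w)"
    using rearranged_ar_subset by blast+
  moreover have "ar_vertices (word_ar_quiver n w') = ar_vertices (word_ar_quiver n w)"
    by (simp add: word_ar_quiver_def)
  ultimately show ?thesis by simp
qed

lemma class_ar_quiver_eq: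
  assumes "v \<in> commutation_class n w" "w \<in> lists (idx n)"
  shows "class_ar_quiver n (commutation_class n w) = word_ar_quiver n v"
proof -
  have "word_ar_quiver n ` commutation_class n w = {word_ar_quiver n v}"
    using assms class_word_ar_quiver[OF _ assms(2)] by auto
  then show ?thesis by (simp add: class_ar_quiver_def)
qed

lemma move_front:
  assumes "a \<in> lists (idx n)" "i \<in> idx n" "\<And>j. j \<in> set a \<Longrightarrow> \<not> adjacent n j i"
  shows "p @ i # a @ b \<in> commutation_class n (p @ a @ i # b)"
  using assms
proof (induction a arbitrary: b rule: rev_induct)
  case (snoc j a)
  have "refl n j \<circ> refl n i = refl n i \<circ> refl n j"
    using snoc.prems refl_commute_iff[OF n3, of j i] by auto
  then have "((p @ a) @ [j, i] @ b, (p @ a) @ [i, j] @ b) \<in> commutation_step n"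
    unfolding commutation_step_def by blast
  then have "p @ a @ i # j # b \<in> commutation_class n (p @ (a @ [j]) @ i # b)"
    unfolding commutation_class_def Image_singleton by (simp add: r_into_rtrancl)
  moreover have "p @ i # a @ j # b \<in> commutation_class n (p @ a @ i # j # b)"
    using snoc by auto
  ultimately show ?case using commutation_class_eq by auto
qed (simp add: self_in_class)

text \<open>
  The word \<open>w\<close> is matched letter by letter, by an induction on the length of the common prefix with a
  suitable word \<open>v'\<close> of the class. The next root of \<open>w\<close> occurs in \<open>v'\<close> at a later position \<open>k\<close>. If some
  letter between the prefix and \<open>k\<close> were equal or adjacent to the letter at \<open>k\<close>, consider the last such
  letter. It cannot be equal, as the two roots would be opposite to each other; and if it is adjacent,
  its root would have to come earlier in \<open>w\<close>, that is, within the prefix. So the letter at \<open>k\<close> can be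
  moved to the end of the prefix.
\<close>

lemma word_in_class:
  assumes w: "w \<in> reduced_words n (longest n)" and v: "v \<in> reduced_words n (longest n)"
    and ord: "\<And>v' j k. v' \<in> commutation_class n v \<Longrightarrow> j < k \<Longrightarrow> k < length v' \<Longrightarrow>
      adjacent n (v' ! j) (v' ! k) \<Longrightarrow> (\<And>l. j < l \<Longrightarrow> l < k \<Longrightarrow> \<not> dependent n (v' ! l) (v' ! k)) \<Longrightarrow>
      (beta n v' j, beta n v' k) \<in> word_order n w"
  shows "w \<in> commutation_class n v"
proof -
  have red_w: "reduced n w" and lists_w: "w \<in> lists (idx n)" and len_w: "length w = n * (n + 1)"
    using w w0_words_iff[OF n3] in_reduced_words_iff by auto
  have inj_w: "inj_on (beta n w) {..<length w}" using beta_inj[OF n3 red_w] .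
  have "\<exists>v' \<in> commutation_class n v. take m v' = take m w" if "m \<le> length w" for m
    using that
  proof (induction m)
    case 0
    then show ?case using self_in_class by auto
  next
    case (Suc m)
    then obtain v' where v': "v' \<in> commutation_class n v" "take m v' = take m w" by auto
    have v'_w0: "v' \<in> reduced_words n (longest n)" using class_w0_words v v'(1) by blast
    then have red_v: "reduced n v'" and lists_v: "v' \<in> lists (idx n)" and len_v: "length v' = n * (n + 1)"
      using w0_words_iff[OF n3] in_reduced_words_iff by auto
    have m: "m < length w" "m < length v'" using Suc.prems len_w len_v by auto
    have same: "beta n v' l = beta n w l" if "l < m" for l
      using that v'(2) beta_take by metis
    have "beta n w m \<in> beta n v' ` {..<length v'}"
      using beta_image_pos[OF n3 red_v len_v] beta_pos[OF n3 red_w] m by auto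
    then obtain k where k: "k < length v'" "beta n v' k = beta n w m" by auto
    have mk: "m \<le> k"
    proof (rule ccontr)
      assume "\<not> m \<le> k"
      then have "beta n w k = beta n w m" "k < m" using same k by auto
      then show False using inj_w m by (auto dest: inj_onD)
    qed
    let ?i = "v' ! k"
    have idx_v: "v' ! l \<in> idx n" if "l < length v'" for l
      using lists_v that by (auto simp: in_lists_conv_set)
    have indep: "\<not> dependent n (v' ! l) ?i" if "m \<le> l" "l < k" for l
    proof
      assume dep: "dependent n (v' ! l) ?i"
      \<comment> \<open>The last position before \<open>k\<close> whose letter does not move past the letter at \<open>k\<close>.\<close>
    define S where "S = {l. m \<le> l \<and> l < k \<and> dependent n (v' ! l) ?i}"
      have S: "finite S" "S \<noteq> {}" using that dep by (auto simp: S_def)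
      define j where "j = Max S"
      have j: "m \<le> j" "j < k" "dependent n (v' ! j) ?i"
        using Max_in[OF S] by (auto simp: S_def j_def)
      have last: "\<not> dependent n (v' ! l) ?i" if "j < l" "l < k" for l
      proof
        assume "dependent n (v' ! l) ?i"
        then have "l \<in> S" using that j by (simp add: S_def)
        then have "l \<le> j" unfolding j_def using S(1) by simp
        then show False using that by simp
      qed
      show False
      proof (cases "v' ! j = ?i")
        case True
        define b where "b = drop (Suc j) (take k v')"
        have "take k v' = take j v' @ ?i # b"
          using j k True unfolding b_def
          by (subst id_take_nth_drop[of j]) (simp_all add: min_def)
        moreover have b: "b \<in> lists (idx n)" "\<And>l. l \<in> set b \<Longrightarrow> \<not> dependent n l ?i"
          using lists_v last k by (auto simp: b_def in_lists_conv_set in_set_conv_nth dest: in_set_dropD in_set_takeD)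
        ultimately have "beta n v' k = word_prod n (take j v') (refl n ?i (simple_root ?i))"
          using word_fixes[OF b(1) idx_v[OF k(1)] b(2)] by (simp add: beta_def)
        also have "\<dots> = (\<lambda>l. - beta n v' j l)"
        proof -
          have "take j v' \<in> lists (idx n)" using lists_v by (auto simp: in_lists_conv_set dest: in_set_takeD)
          then show ?thesis
            using True by (simp add: refl_simple_root[OF n3 idx_v[OF k(1)]] word_uminus[OF n3] beta_def)
        qed
        finally have "(\<lambda>l. - beta n v' j l) \<in> pos_vecs n" using beta_pos[OF n3 red_v k(1)] by simp
        then show False using pos_not_neg[OF n3] beta_pos[OF n3 red_v, of j] j k by auto
      next
        case False
        then have "(beta n v' j, beta n v' k) \<in> word_order n w"
          using ord[OF v'(1) j(2) k(1)] j(3) last by (auto simp: dependent_def)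
        then obtain p q where pq: "p < q" "q < length w" "beta n v' j = beta n w p" "beta n w m = beta n w q"
          using k(2) by (auto simp: word_order_def)
        then have "q = m" using inj_w m by (auto dest: inj_onD)
        then have "p < m" "beta n v' p = beta n v' j" using pq same by auto
        then have "p = j" using beta_inj[OF n3 red_v] m j k by (auto dest!: inj_onD)
        then show False using \<open>p < m\<close> j by simp
      qed
    qed
    define a where "a = drop m (take k v')"
    have "take k v' = take m v' @ a"
      unfolding a_def using mk by (metis append_take_drop_id min.absorb1 take_take)
    then have decomp: "v' = take m w @ a @ ?i # drop (Suc k) v'"
      using k(1) v'(2) by (metis append.assoc append_take_drop_id Cons_nth_drop_Suc)
    have a: "a \<in> lists (idx n)" "\<And>l. l \<in> set a \<Longrightarrow> \<not> dependent n l ?i"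
      using lists_v indep k by (auto simp: a_def in_lists_conv_set in_set_conv_nth dest: in_set_dropD in_set_takeD)
    have "beta n w m = word_prod n (take m w @ a) (simple_root ?i)"
      using \<open>take k v' = take m v' @ a\<close> v'(2) k(2) by (simp add: beta_def)
    also have "\<dots> = word_prod n (take m w) (simple_root ?i)"
      using word_fixes[OF a(1) idx_v[OF k(1)] a(2)] by simp
    finally have "word_prod n (take m w) (simple_root (w ! m)) = word_prod n (take m w) (simple_root ?i)"
      by (simp add: beta_def)
    moreover have "take m w \<in> lists (idx n)"
      using lists_w by (auto simp: in_lists_conv_set dest: in_set_takeD)
    ultimately have i: "w ! m = ?i" using word_inj[OF n3] simple_root_eq_iff by metis
    have "take m w @ ?i # a @ drop (Suc k) v' \<in> commutation_class n (take m w @ a @ ?i # drop (Suc k) v')"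
      using a idx_v[OF k(1)] by (intro move_front) (auto simp: dependent_def)
    then have "take m w @ ?i # a @ drop (Suc k) v' \<in> commutation_class n v"
      using commutation_class_eq[OF v'(1)] decomp by simp
    moreover have "take (Suc m) (take m w @ ?i # a @ drop (Suc k) v') = take (Suc m) w"
      using m(1) i by (simp add: take_Suc_conv_app_nth)
    ultimately show ?case by blast
  qed
  then obtain v' where v': "v' \<in> commutation_class n v" "take (length w) v' = w" by force
  moreover have "length v' = length w"
    using class_w0_words[OF v v'(1)] len_w w0_words_iff[OF n3] by auto
  ultimately show ?thesis by simp
qed

lemma refl_self:
  assumes "i \<in> idx n"
  shows "refl n i v i = - v i + (\<Sum>j | j \<in> idx n \<and> adjacent n i j. v j)"
  using cartan_sum_neighbours[OF n3 assms, of v] by (simp add: refl_def)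

text \<open>
  Each reflection in the word replaces a vanishing coordinate by the sum of the neighbouring ones.
\<close>

lemma distinct_word_nonneg:
  assumes "u \<in> lists (idx n)" "i \<in> idx n" "distinct u" "i \<notin> set u"
  shows "(\<forall>k. 0 \<le> word_prod n u (simple_root i) k) \<and>
    (\<forall>j \<in> set u. adjacent n j i \<longrightarrow> 1 \<le> word_prod n u (simple_root i) j)"
  using assms
proof (induction u)
  case Nil
  then show ?case by (simp add: simple_root_def)
next
  case (Cons k u)
  let ?x = "word_prod n u (simple_root i)"
  have IH: "\<And>l. 0 \<le> ?x l" "\<And>j. j \<in> set u \<Longrightarrow> adjacent n j i \<Longrightarrow> 1 \<le> ?x j"
    using Cons by auto
  have "?x k = simple_root i k" "?x i = simple_root i i"
    using Cons.prems by (auto simp: word_other)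
  then have x: "?x k = 0" "?x i = 1" using Cons.prems by (auto simp: simple_root_def)
  have "k \<in> idx n" using Cons by simp
  then have k: "refl n k ?x k = (\<Sum>j | j \<in> idx n \<and> adjacent n k j. ?x j)"
    using x(1) by (simp add: refl_self)
  have "0 \<le> refl n k ?x k"
    unfolding k using IH(1) by (intro sum_nonneg)
  moreover have "1 \<le> refl n k ?x k" if "adjacent n k i"
  proof -
    have "?x i \<le> (\<Sum>j | j \<in> idx n \<and> adjacent n k j. ?x j)"
      using that Cons.prems IH(1) by (intro member_le_sum) auto
    then show ?thesis using x(2) k by simp
  qed
  ultimately have "0 \<le> refl n k ?x l" "l \<in> set (k # u) \<Longrightarrow> adjacent n l i \<Longrightarrow> 1 \<le> refl n k ?x l" for l
    using IH refl_other[of l k n ?x] by (cases "l = k"; auto)+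
  then show ?case by simp
qed

text \<open>
  For each letter there is a vector whose coordinate at this letter changes from 1 to \<open>- 1\<close>.
\<close>

lemma distinct_letter_ex:
  assumes w: "w \<in> lists (idx n)" "distinct w" and v: "v \<in> lists (idx n)" "word_prod n v = word_prod n w"
  shows "set w \<subseteq> set v"
proof
  fix i assume "i \<in> set w"
  then obtain x y where xy: "w = x @ i # y" by (auto dest: split_list)
  then have i: "i \<notin> set x" "i \<notin> set y" "i \<in> idx n" "x \<in> lists (idx n)" "y \<in> lists (idx n)"
    using w by auto
  show "i \<in> set v"
  proof (rule ccontr)
    assume "i \<notin> set v"
    let ?u = "word_prod n (rev y) (simple_root i)"
    have "word_prod n w ?u i = - simple_root i i"
      using i word_other[OF i(1)] word_rev'[OF n3 i(5), of "simple_root i"]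
      by (simp add: xy refl_simple_root[OF n3])
    moreover have "word_prod n v ?u i = simple_root i i"
      using \<open>i \<notin> set v\<close> i(2) by (simp add: word_other)
    ultimately show False using v(2) by (simp add: simple_root_def)
  qed
qed

text \<open>
  In the second word the letters before the first letter \<open>i\<close> of the first word cannot be adjacent
  to \<open>i\<close>: this is seen on the \<open>i\<close>-th coordinate of the inverse element applied to \<open>\<alpha>\<^sub>i\<close>, which is \<open>- 1\<close>
  according to the first word, and larger in the presence of such a letter. Hence \<open>i\<close> can be moved
  to the front and cancelled.
\<close>

lemma distinct_words_class:
  assumes "w \<in> lists (idx n)" "distinct w" "v \<in> lists (idx n)" "distinct v" "set v = set w"
    "word_prod n v = word_prod n w"
  shows "v \<in> commutation_class n w"
  using assms
proof (induction w arbitrary: v)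
  case Nil
  then show ?case by (simp add: self_in_class)
next
  case (Cons i w)
  have "i \<in> set v" using Cons.prems by simp
  then obtain a b where v: "v = a @ i # b"
    by (blast dest: split_list)
  have i: "i \<in> idx n" "i \<notin> set w" "i \<notin> set a" "i \<notin> set b" and lists: "w \<in> lists (idx n)" "a \<in> lists (idx n)" "b \<in> lists (idx n)"
    using Cons.prems v by auto
  let ?x = "word_prod n (rev a) (simple_root i)"
  have "rev a \<in> lists (idx n)" "distinct (rev a)" "i \<notin> set (rev a)"
    using i lists Cons.prems(3) v by auto
  then have x: "\<And>k. 0 \<le> ?x k" "\<And>j. j \<in> set a \<Longrightarrow> adjacent n j i \<Longrightarrow> 1 \<le> ?x j"
    using distinct_word_nonneg[of "rev a" i] i by auto
  have "word_prod n (rev v) = word_prod n (rev (i # w))"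
    using word_prod_rev_cong[OF n3] Cons.prems by blast
  then have "word_prod n (rev b) (refl n i ?x) i = word_prod n (rev w) (refl n i (simple_root i)) i"
    by (simp add: v fun_eq_iff)
  then have "refl n i ?x i = refl n i (simple_root i) i"
    using i by (simp add: word_other)
  moreover have "?x i = 1" using i by (simp add: word_other) (simp add: simple_root_def)
  moreover have "refl n i (simple_root i) i = - 1"
    using i by (simp add: refl_simple_root[OF n3]) (simp add: simple_root_def)
  ultimately have "(\<Sum>j | j \<in> idx n \<and> adjacent n i j. ?x j) = 0"
    using refl_self[OF i(1), of ?x] by simp
  then have zero: "?x j = 0" if "j \<in> idx n" "adjacent n i j" for j
    using that x(1) by (subst (asm) sum_nonneg_eq_0_iff) auto
  have nadj: "\<not> adjacent n j i" if "j \<in> set a" for j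
    using x(2)[OF that] zero[of j] that lists(2) adjacent_sym by (fastforce simp: in_lists_conv_set)
  have front: "i # a @ b \<in> commutation_class n v"
    using move_front[OF lists(2) i(1) nadj, of "[]" b] by (simp add: v)
  have "word_prod n v = word_prod n (i # a @ b)"
    using class_rearranged[OF front] Cons.prems by simp
  then have "refl n i (word_prod n (a @ b) x) = refl n i (word_prod n w x)" for x
    using Cons.prems(5) by (simp add: fun_eq_iff)
  then have "word_prod n (a @ b) = word_prod n w"
    using refl_invol[OF n3 i(1)] by (metis ext)
  moreover have "set (a @ b) = set w"
    using Cons.prems(4) i unfolding v by (subst insert_ident[symmetric, of i]) auto
  ultimately have "a @ b \<in> commutation_class n w"
    using Cons.IH[of "a @ b"] Cons.prems i lists v by auto
  then have "i # a @ b \<in> commutation_class n (i # w)"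
    by (rule class_Cons)
  then show ?case using commutation_class_eq front self_in_class by metis
qed

lemma distinct_reduced_words_class:
  assumes w: "w \<in> lists (idx n)" "distinct w" and v: "v \<in> reduced_words n (word_prod n w)"
  shows "v \<in> commutation_class n w"
proof -
  have v': "v \<in> lists (idx n)" "word_prod n v = word_prod n w" "length v \<le> length w"
    using v w(1) unfolding in_reduced_words_iff reduced_def by auto
  have sub: "set w \<subseteq> set v" using distinct_letter_ex w v' by blast
  then have "card (set w) \<le> card (set v)" by (simp add: card_mono)
  then have "card (set v) = length v" "card (set v) = card (set w)"
    using v'(3) card_length[of v] distinct_card[OF w(2)] by auto
  then have "distinct v" "set v = set w"
    using card_distinct sub card_subset_eq by (blast, metis List.finite_set)
  then show ?thesis using distinct_words_class w v' by blast
qed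

lemma distinct_reduced:
  assumes "w \<in> lists (idx n)" "distinct w"
  shows "w \<in> reduced_words n (word_prod n w)"
  unfolding in_reduced_words_iff reduced_def
proof (intro conjI ballI impI refl assms)
  fix v assume "v \<in> lists (idx n)" "word_prod n v = word_prod n w"
  then have "card (set w) \<le> card (set v)" using distinct_letter_ex[OF assms] by (simp add: card_mono)
  then show "length w \<le> length v"
    using card_length[of v] distinct_card[OF assms(2)] by simp
qed

end

section \<open>Quivers as height functions\<close>

definition line_edge :: "nat \<Rightarrow> nat \<Rightarrow> nat \<Rightarrow> bool" where
  "line_edge n k l \<longleftrightarrow> k \<in> {1..n} \<and> l \<in> {1..n} \<and> (l = k + 1 \<or> k = l + 1)"

text \<open>
  Functions on all natural numbers represent functions on the vertices \<open>1, \<dots>, n\<close> of the line.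
\<close>

definition height :: "nat \<Rightarrow> (nat \<Rightarrow> int) \<Rightarrow> bool" where
  "height n h \<longleftrightarrow> (\<forall>k l. line_edge n k l \<longrightarrow> \<bar>h k - h l\<bar> = 1)"

text \<open>
  Raising the last vertex by 2 switches the class modulo 4 of its height between \<open>{0, 1}\<close> and
  \<open>{2, 3}\<close>, whatever its parity, as the reflection at this vertex switches the type.
\<close>

definition quiver_of :: "nat \<Rightarrow> (nat \<Rightarrow> int) \<Rightarrow> twisted_quiver" where
  "quiver_of n h = \<lparr>arrows = {(k, l). line_edge n k l \<and> h l < h k},
     top = (if h n mod 4 < 2 then n else n + 1)\<rparr>"

text \<open>
  The vertex of the line that is reflected by a letter.
\<close>

abbreviation orbit :: "nat \<Rightarrow> nat \<Rightarrow> nat" where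
  "orbit n i \<equiv> min i n"

text \<open>
  The local minima are the sinks, see \<open>is_sink_iff\<close>.
\<close>

definition valley :: "nat \<Rightarrow> (nat \<Rightarrow> int) \<Rightarrow> nat \<Rightarrow> bool" where
  "valley n h i \<longleftrightarrow> i \<in> idx n \<and> (\<forall>l. line_edge n (orbit n i) l \<longrightarrow> h (orbit n i) < h l) \<and>
     (n \<le> i \<longrightarrow> i = top (quiver_of n h))"

definition bump :: "nat \<Rightarrow> nat \<Rightarrow> (nat \<Rightarrow> int) \<Rightarrow> nat \<Rightarrow> int" where
  "bump n i h = h(orbit n i := h (orbit n i) + 2)"

definition shift :: "nat \<Rightarrow> int \<Rightarrow> (nat \<Rightarrow> int) \<Rightarrow> nat \<Rightarrow> int" where
  "shift n m h k = (if k \<in> {1..n} then h k + 2 * m else h k)"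

lemma line_edge_sym: "line_edge n k l \<longleftrightarrow> line_edge n l k"
  by (auto simp: line_edge_def)

lemma heightD: "height n h \<Longrightarrow> line_edge n k l \<Longrightarrow> h l = h k + 1 \<or> h l = h k - 1"
  by (force simp: height_def)

lemma top_bump: "orbit n i \<noteq> n \<Longrightarrow> top (quiver_of n (bump n i h)) = top (quiver_of n h)"
  by (simp add: quiver_of_def bump_def)

lemma top_bump_last: "n \<le> i \<Longrightarrow> top (quiver_of n (bump n i h)) = vee n (top (quiver_of n h))"
proof -
  assume "n \<le> i"
  moreover have "(h n + 2) mod 4 < 2 \<longleftrightarrow> \<not> h n mod 4 < 2"
    by presburger
  ultimately show ?thesis
    by (simp add: quiver_of_def bump_def min_absorb2)
qed

lemma quiver_of_cong: "n \<ge> 1 \<Longrightarrow> (\<And>k. k \<in> {1..n} \<Longrightarrow> h k = h' k) \<Longrightarrow> quiver_of n h = quiver_of n h'"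
  by (auto simp: quiver_of_def line_edge_def)

lemma fold_bump:
  "fold (bump n) w h k = h k + 2 * int (count_list (map (orbit n) w) k)"
  by (induction w arbitrary: h) (auto simp: bump_def)

text \<open>
  In \<open>first k l m\<close> the entry \<open>k\<close> has to occur, and before any occurrence of \<open>l\<close>; the entry \<open>l\<close> may
  be absent.
\<close>

fun first :: "nat \<Rightarrow> nat \<Rightarrow> nat list \<Rightarrow> bool" where
  "first k l [] \<longleftrightarrow> False"
| "first k l (x # xs) \<longleftrightarrow> x = k \<or> x \<noteq> l \<and> first k l xs"

lemma first_absent: "k \<in> set m \<Longrightarrow> l \<notin> set m \<Longrightarrow> first k l m"
  by (induction m) auto

lemma first_sym: "k \<noteq> l \<Longrightarrow> k \<in> set m \<or> l \<in> set m \<Longrightarrow> first l k m \<longleftrightarrow> \<not> first k l m"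
  by (induction m) auto

lemma orbit_vee [simp]: "orbit n ((transpose n (Suc n) ^^ m) i) = orbit n i"
  by (induction m) (auto simp: transpose_def)

context
  fixes n :: nat
  assumes n3: "n \<ge> 3"
begin

lemma orbit_range: "i \<in> idx n \<Longrightarrow> orbit n i \<in> {1..n}"
  using n3 by (auto simp: idx_def)

lemma adjacent_iff_line_edge:
  assumes "i \<in> idx n" "j \<in> idx n" "orbit n i \<noteq> orbit n j"
  shows "adjacent n i j \<longleftrightarrow> line_edge n (orbit n i) (orbit n j)"
proof -
  have "i \<le> n - 1 \<or> i = n \<or> i = n + 1" "j \<le> n - 1 \<or> j = n \<or> j = n + 1"
    using assms by (auto simp: idx_def)
  then show ?thesis
    using assms n3 unfolding adjacent_iff line_edge_def idx_def by (elim disjE) auto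
qed

lemma line_neighbour_ex: "k \<in> {1..n} \<Longrightarrow> \<exists>l. line_edge n k l"
  using n3 by (cases "k = 1") (auto simp: line_edge_def intro: exI[of _ 2] exI[of _ "k - 1"])

lemma quiver_of_in: "height n h \<Longrightarrow> quiver_of n h \<in> twisted_quivers n"
proof -
  assume h: "height n h"
  have "h (Suc i) < h i \<longleftrightarrow> \<not> h i < h (Suc i)" if "1 \<le> i" "i < n" for i
  proof -
    have "line_edge n i (Suc i)" using that by (auto simp: line_edge_def)
    then show ?thesis using heightD[OF h, of i "Suc i"] by auto
  qed
  then show ?thesis
    by (auto simp: twisted_quivers_def quiver_of_def line_edge_def)
qed

text \<open>
  The heights are sums of \<open>\<plusminus> 1\<close>, normalised to be 0 or 2 at the last vertex. Two height functions
  that are even at the last vertex agree modulo 2 everywhere.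
\<close>

lemma height_ex:
  assumes "t = n \<or> t = n + 1"
  obtains h where "height n h" "\<And>k. k \<in> {1..<n} \<Longrightarrow> h k < h (k + 1) \<longleftrightarrow> D k" "top (quiver_of n h) = t"
    "even (h n)"
proof -
  define g :: "nat \<Rightarrow> int" where "g k = (\<Sum>l = 1..<k. if D l then 1 else - 1)" for k
  define h where "h k = g k - g n + (if t = n then 0 else 2)" for k
  have step: "h (k + 1) = h k + (if D k then 1 else - 1)" if "1 \<le> k" for k
    using that by (simp add: h_def g_def)
  show thesis
  proof (rule that[of h])
    show "height n h"
      using step by (auto simp: height_def line_edge_def)
    show "h k < h (k + 1) \<longleftrightarrow> D k" if "k \<in> {1..<n}" for k
      using step[of k] that by auto
    show "top (quiver_of n h) = t" "even (h n)"
      using assms by (auto simp: quiver_of_def h_def)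
  qed
qed

lemma quiver_height_ex:
  assumes "Q \<in> twisted_quivers n"
  obtains h where "height n h" "quiver_of n h = Q" "even (h n)"
proof -
  obtain h where h: "height n h" "\<And>k. k \<in> {1..<n} \<Longrightarrow> h k < h (k + 1) \<longleftrightarrow> (k + 1, k) \<in> arrows Q"
      "top (quiver_of n h) = top Q" "even (h n)"
    using height_ex[of "top Q" "\<lambda>k. (k + 1, k) \<in> arrows Q"] assms by (auto simp: twisted_quivers_def)
  have Q: "arrows Q \<subseteq> {(i, i + 1) |i. i \<in> {1..<n}} \<union> {(i + 1, i) |i. i \<in> {1..<n}}"
    "\<And>i. i \<in> {1..<n} \<Longrightarrow> (i, i + 1) \<in> arrows Q \<longleftrightarrow> (i + 1, i) \<notin> arrows Q"
    using assms by (auto simp: twisted_quivers_def)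
  have "(k, l) \<in> arrows (quiver_of n h) \<longleftrightarrow> (k, l) \<in> arrows Q" for k l
  proof -
    consider "l = k + 1" "k \<in> {1..<n}" | "k = l + 1" "l \<in> {1..<n}" | "\<not> line_edge n k l"
      by (force simp: line_edge_def)
    then show ?thesis
    proof cases
      case 1
      then have "line_edge n k l" by (simp add: line_edge_def)
      then show ?thesis
        using h(2)[of k] heightD[OF h(1), of k l] Q(2)[of k] 1 by (auto simp: quiver_of_def)
    next
      case 2
      then have "line_edge n k l" by (simp add: line_edge_def)
      then show ?thesis using h(2)[of l] 2 by (simp add: quiver_of_def)
    next
      case 3
      then have "(k, l) \<notin> arrows Q" using Q(1) by (auto simp: line_edge_def)
      then show ?thesis using 3 by (simp add: quiver_of_def)
    qed
  qed
  then have "arrows (quiver_of n h) = arrows Q" by auto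
  then have "quiver_of n h = Q" using h(3) by simp
  then show thesis using that h by blast
qed

lemma is_sink_iff:
  assumes "height n h"
  shows "is_sink n (quiver_of n h) i \<longleftrightarrow> valley n h i"
proof -
  have edge: "h k < h l \<longleftrightarrow> \<not> h l < h k" if "line_edge n k l" for k l
    using heightD[OF assms that] by auto
  consider "i \<in> {1..n - 1}" | "i = n \<or> i = n + 1" | "i \<notin> idx n"
    by (force simp: idx_def)
  then show ?thesis
  proof cases
    case 1
    then have "orbit n i = i" "i \<in> idx n" "\<not> n \<le> i" using n3 by (auto simp: idx_def)
    then show ?thesis
      using 1 edge by (auto simp: is_sink_def valley_def quiver_of_def)
  next
    case 2
    then have i: "orbit n i = n" "i \<in> idx n" "i \<notin> {1..n - 1}" "n \<le> i" using n3 by (auto simp: idx_def)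
    have "line_edge n n l \<longleftrightarrow> l = n - 1" for l
      using n3 by (auto simp: line_edge_def)
    moreover have "(n - 1, n) \<in> arrows (quiver_of n h) \<longleftrightarrow> h n < h (n - 1)"
      using n3 by (auto simp: quiver_of_def line_edge_def)
    moreover have "is_sink n (quiver_of n h) i \<longleftrightarrow>
        i = top (quiver_of n h) \<and> (n - 1, n) \<in> arrows (quiver_of n h)"
      unfolding is_sink_def using 2 i(3) by blast
    ultimately show ?thesis
      unfolding valley_def i(1) using i(2,4) by auto
  next
    case 3
    then show ?thesis using n3 by (auto simp: is_sink_def valley_def idx_def)
  qed
qed

lemma height_bump:
  assumes "height n h" "valley n h i"
  shows "height n (bump n i h)"
  unfolding height_def
proof (intro allI impI)
  fix k l assume kl: "line_edge n k l"
  then have "k \<noteq> l" by (auto simp: line_edge_def)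
  moreover have "h k < h l" if "k = orbit n i" using assms(2) kl that by (auto simp: valley_def)
  moreover have "h l < h k" if "l = orbit n i" using assms(2) kl that line_edge_sym by (auto simp: valley_def)
  ultimately show "\<bar>bump n i h k - bump n i h l\<bar> = 1"
    using heightD[OF assms(1) kl] by (auto simp: bump_def)
qed

lemma reflect_quiver_of:
  assumes "height n h" "valley n h i"
  shows "reflect_quiver n i (quiver_of n h) = quiver_of n (bump n i h)"
proof -
  let ?x = "orbit n i"
  have low: "h ?x < h l" "h l < h ?x + 2" if "line_edge n ?x l" for l
    using assms(2) heightD[OF assms(1) that] that by (auto simp: valley_def)
  have "(k, l) \<in> reverse_at ?x (arrows (quiver_of n h)) \<longleftrightarrow> (k, l) \<in> arrows (quiver_of n (bump n i h))" for k l
  proof (cases "line_edge n k l")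
    case True
    then have "k \<noteq> l" by (auto simp: line_edge_def)
    moreover have "line_edge n l k" using True line_edge_sym by blast
    ultimately show ?thesis
      using True low[of k] low[of l] by (auto simp: reverse_at_def quiver_of_def bump_def)
  next
    case False
    moreover have "\<not> line_edge n l k" using False line_edge_sym by blast
    ultimately show ?thesis by (auto simp: reverse_at_def quiver_of_def)
  qed
  then have arr: "reverse_at ?x (arrows (quiver_of n h)) = arrows (quiver_of n (bump n i h))"
    by auto
  have i: "i \<in> idx n" using assms(2) by (simp add: valley_def)
  show ?thesis
  proof (cases "i < n")
    case True
    then have "i \<in> {1..n - 1}" "?x = i" using i by (auto simp: idx_def)
    moreover have "is_sink n (quiver_of n h) i" using assms is_sink_iff by blast
    moreover have "top (quiver_of n (bump n i h)) = top (quiver_of n h)"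
      using True by (intro top_bump) simp
    ultimately show ?thesis
      using arr by (intro twisted_quiver.equality) (auto simp: reflect_quiver_def)
  next
    case False
    then have "i \<in> {n, n + 1}" "i \<notin> {1..n - 1}" "?x = n" "i = top (quiver_of n h)"
      using i assms(2) by (auto simp: idx_def valley_def)
    moreover have "top (quiver_of n (bump n i h)) = vee n (top (quiver_of n h))"
      using False by (intro top_bump_last) simp
    ultimately show ?thesis
      using arr by (intro twisted_quiver.equality) (auto simp: reflect_quiver_def)
  qed
qed

lemma adapted_Cons:
  assumes "height n h"
  shows "adapted n (quiver_of n h) (i # w) \<longleftrightarrow> valley n h i \<and> adapted n (quiver_of n (bump n i h)) w"
  using assms is_sink_iff reflect_quiver_of by auto

lemma adapted_height_lists:
  "height n h \<Longrightarrow> adapted n (quiver_of n h) w \<Longrightarrow> height n (fold (bump n) w h) \<and> w \<in> lists (idx n)"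
proof (induction w arbitrary: h)
  case (Cons i w)
  then have "valley n h i" "adapted n (quiver_of n (bump n i h)) w"
    using adapted_Cons by blast+
  then show ?case using Cons.IH[OF height_bump] Cons.prems(1) by (auto simp: valley_def)
qed simp

lemma adapted_append:
  "height n h \<Longrightarrow> adapted n (quiver_of n h) (u @ w) \<longleftrightarrow>
    adapted n (quiver_of n h) u \<and> adapted n (quiver_of n (fold (bump n) u h)) w"
proof (induction u arbitrary: h)
  case (Cons i u)
  show ?case
    unfolding append_Cons adapted_Cons[OF Cons.prems]
    using Cons.IH[OF height_bump[OF Cons.prems]] by auto
qed simp

text \<open>
  Of two neighbouring vertices only one is a local minimum, and only one of \<open>n\<close> and \<open>n + 1\<close> is the
  current type.
\<close>

lemma valleys_independent:
  assumes "height n h" "valley n h i" "valley n h j" "i \<noteq> j"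
  shows "orbit n i \<noteq> orbit n j" "\<not> adjacent n i j" "valley n (bump n j h) i"
proof -
  show ne: "orbit n i \<noteq> orbit n j"
    using assms(2-4) by (auto simp: valley_def min_def split: if_splits)
  have nadj: "\<not> line_edge n (orbit n i) (orbit n j)"
    using assms(2,3) line_edge_sym by (force simp: valley_def)
  then show "\<not> adjacent n i j"
    using adjacent_iff_line_edge ne assms(2,3) by (auto simp: valley_def)
  have "top (quiver_of n (bump n j h)) = top (quiver_of n h)" if "n \<le> i"
    using that ne by (intro top_bump) (auto simp: min_def split: if_splits)
  then show "valley n (bump n j h) i"
    using assms(2) ne nadj by (auto simp: valley_def bump_def)
qed

lemma bump_commute: "orbit n i \<noteq> orbit n j \<Longrightarrow> bump n i (bump n j h) = bump n j (bump n i h)"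
  by (auto simp: bump_def fun_eq_iff)

lemma sink_to_front:
  assumes "height n h" "valley n h i" "adapted n (quiver_of n h) (a @ i # b)" "i \<notin> set a"
  shows "(\<forall>j \<in> set a. \<not> adjacent n j i) \<and> adapted n (quiver_of n h) (i # a @ b)"
  using assms
proof (induction a arbitrary: h)
  case (Cons j a)
  have j: "valley n h j" "adapted n (quiver_of n (bump n j h)) (a @ i # b)"
    using Cons.prems adapted_Cons by auto
  have hj: "height n (bump n j h)" and hi: "height n (bump n i h)"
    using height_bump Cons.prems j by auto
  have ij: "i \<noteq> j" using Cons.prems by auto
  note ind = valleys_independent[OF Cons.prems(1,2) j(1) ij]
  have ji: "valley n (bump n i h) j"
    using valleys_independent(3)[OF Cons.prems(1) j(1) Cons.prems(2)] ij by auto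
  have IH: "\<forall>j \<in> set a. \<not> adjacent n j i" "adapted n (quiver_of n (bump n j h)) (i # a @ b)"
    using Cons.IH[OF hj ind(3) j(2)] Cons.prems by auto
  then have "adapted n (quiver_of n (bump n i (bump n j h))) (a @ b)"
    using adapted_Cons[OF hj] by blast
  then have "adapted n (quiver_of n h) (i # j # a @ b)"
    using Cons.prems(1,2) hi ji bump_commute[OF ind(1)] by (simp add: adapted_Cons del: adapted.simps)
  then show ?case using IH ind(2) adjacent_sym by auto
qed simp

text \<open>
  The letters \<open>n\<close> and \<open>n + 1\<close> commute, but are never consecutive in an adapted word, since a vertex
  that has just been raised is a local maximum.
\<close>

lemma adapted_swap:
  assumes "height n h" "adapted n (quiver_of n h) (i # j # w)" "\<not> adjacent n i j"
  shows "adapted n (quiver_of n h) (j # i # w)"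
proof (cases "i = j")
  case False
  have i: "valley n h i" and hi: "height n (bump n i h)"
    using assms adapted_Cons height_bump by blast+
  then have j: "valley n (bump n i h) j" and w: "adapted n (quiver_of n (bump n j (bump n i h))) w"
    using assms adapted_Cons by blast+
  have idx: "i \<in> idx n" "j \<in> idx n" using i j by (auto simp: valley_def)
  have ne: "orbit n i \<noteq> orbit n j"
  proof
    assume eq: "orbit n i = orbit n j"
    obtain l where l: "line_edge n (orbit n i) l" using line_neighbour_ex orbit_range[OF idx(1)] by blast
    then have "h (orbit n i) < h l" "h l = h (orbit n i) + 1 \<or> h l = h (orbit n i) - 1"
      using i heightD[OF assms(1)] by (auto simp: valley_def)
    moreover have "bump n i h (orbit n i) < bump n i h l" "l \<noteq> orbit n i"
      using j l eq by (auto simp: valley_def line_edge_def)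
    ultimately show False by (auto simp: bump_def)
  qed
  have nedge: "\<not> line_edge n (orbit n j) (orbit n i)"
    using assms(3) adjacent_iff_line_edge[OF idx ne] line_edge_sym by blast
  have "top (quiver_of n (bump n i h)) = top (quiver_of n h)" if "n \<le> j"
    using that ne by (intro top_bump) (auto simp: min_def split: if_splits)
  then have j': "valley n h j"
    using j ne nedge by (auto simp: valley_def bump_def split: if_splits)
  then have "valley n (bump n j h) i" "height n (bump n j h)"
    using valleys_independent(3)[OF assms(1) i j'] False height_bump assms(1) by auto
  then show ?thesis
    using assms(1) j' w bump_commute[OF ne, of h] by (simp add: adapted_Cons del: adapted.simps)
qed (use assms in simp)

lemma class_adapted:
  assumes "height n h" "adapted n (quiver_of n h) w" "w' \<in> commutation_class n w"
  shows "adapted n (quiver_of n h) w'"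
proof -
  have "(w, w') \<in> (commutation_step n)\<^sup>*" using assms(3) by (simp add: commutation_class_def)
  then show ?thesis
  proof (induction rule: rtrancl_induct)
    case base
    then show ?case by (rule assms)
  next
    case (step y z)
    then obtain u v i j where y: "y = u @ [i, j] @ v" "z = u @ [j, i] @ v"
        and com: "refl n i \<circ> refl n j = refl n j \<circ> refl n i"
      unfolding commutation_step_def by blast
    have "i \<in> idx n" "j \<in> idx n" using adapted_height_lists[OF assms(1) step.IH] y by auto
    then have "\<not> adjacent n i j" using com refl_commute_iff[OF n3] by blast
    moreover have u: "adapted n (quiver_of n h) u" "adapted n (quiver_of n (fold (bump n) u h)) (i # j # v)"
      using step.IH adapted_append[OF assms(1)] by (auto simp: y)
    moreover have "height n (fold (bump n) u h)" using adapted_height_lists assms(1) u by blast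
    ultimately have "adapted n (quiver_of n (fold (bump n) u h)) (j # i # v)"
      using adapted_swap by blast
    then show ?case using adapted_append[OF assms(1)] u(1) by (simp add: y)
  qed
qed

lemma adapted_first:
  assumes "height n h" "adapted n (quiver_of n h) w" "line_edge n k l"
    "k \<in> orbit n ` set w \<or> l \<in> orbit n ` set w"
  shows "h k < h l \<longleftrightarrow> first k l (map (orbit n) w)"
  using assms
proof (induction w arbitrary: h)
  case (Cons i w)
  have i: "valley n h i" "adapted n (quiver_of n (bump n i h)) w"
    using Cons.prems adapted_Cons by blast+
  have kl: "k \<noteq> l" using Cons.prems(3) by (auto simp: line_edge_def)
  consider "orbit n i = k" | "orbit n i = l" | "orbit n i \<noteq> k" "orbit n i \<noteq> l" by blast
  then show ?case
  proof cases
    case 1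
    then show ?thesis using i(1) Cons.prems(3) by (auto simp: valley_def)
  next
    case 2
    then have "h l < h k" using i(1) Cons.prems(3) line_edge_sym by (auto simp: valley_def)
    then show ?thesis using 2 kl by auto
  next
    case 3
    then have "bump n i h k < bump n i h l \<longleftrightarrow> first k l (map (orbit n) w)"
      using Cons.IH[OF height_bump[OF Cons.prems(1) i(1)] i(2)] Cons.prems(3,4) by auto
    then show ?thesis using 3 by (simp add: bump_def)
  qed
qed simp

lemma adapted_top:
  assumes "height n h" "adapted n (quiver_of n h) w" "n \<in> orbit n ` set w"
  shows "top (quiver_of n h) = hd (filter (\<lambda>i. n \<le> i) w)"
  using assms
proof (induction w arbitrary: h)
  case (Cons i w)
  have i: "valley n h i" "adapted n (quiver_of n (bump n i h)) w"
    using Cons.prems adapted_Cons by blast+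
  show ?case
  proof (cases "n \<le> i")
    case True
    then show ?thesis using i(1) by (simp add: valley_def)
  next
    case False
    then have ne: "orbit n i \<noteq> n" by simp
    then have "n \<in> orbit n ` set w" using Cons.prems(3) by auto
    then show ?thesis
      using Cons.IH[OF height_bump[OF Cons.prems(1) i(1)] i(2)] top_bump[OF ne, of h] False by simp
  qed
qed simp

lemma quiver_determined:
  assumes "height n h" "adapted n (quiver_of n h) w" "height n h'" "adapted n (quiver_of n h') w"
    "{1..n} \<subseteq> orbit n ` set w"
  shows "quiver_of n h = quiver_of n h'"
proof -
  have n: "n \<in> orbit n ` set w" using assms(5) n3 by auto
  have "h l < h k \<longleftrightarrow> h' l < h' k" if "line_edge n k l" for k l
  proof -
    have "line_edge n l k" "l \<in> orbit n ` set w" using that line_edge_sym assms(5) by (auto simp: line_edge_def)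
    then show ?thesis using adapted_first assms by blast
  qed
  then have "arrows (quiver_of n h) = arrows (quiver_of n h')"
    by (auto simp: quiver_of_def)
  moreover have "top (quiver_of n h) = top (quiver_of n h')"
    using adapted_top assms n by metis
  ultimately show ?thesis by simp
qed

text \<open>
  A converse of \<open>adapted_first\<close> and \<open>adapted_top\<close>. The induction needs \<open>h k < h l\<close> also when \<open>l\<close> does not
  occur in the word: then \<open>l\<close> has been raised before, and it lies above \<open>k\<close> from then on.
\<close>

lemma distinct_adapted:
  assumes "height n h" "w \<in> lists (idx n)" "distinct (map (orbit n) w)"
    "\<And>k l. line_edge n k l \<Longrightarrow> k \<in> orbit n ` set w \<Longrightarrow> h k < h l \<longleftrightarrow> first k l (map (orbit n) w)"
    "\<And>i. i \<in> set w \<Longrightarrow> n \<le> i \<Longrightarrow> i = top (quiver_of n h)"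
  shows "adapted n (quiver_of n h) w"
  using assms(2,1,3-)
proof (induction w arbitrary: h)
  case (Cons i w)
  have i: "valley n h i"
    using Cons.hyps(1) Cons.prems(3,4) by (auto simp: valley_def)
  have h': "height n (bump n i h)" using height_bump i Cons.prems(1) by blast
  have "adapted n (quiver_of n (bump n i h)) w"
  proof (rule Cons.IH[OF h'])
    show "distinct (map (orbit n) w)" using Cons.prems(2) by simp
  next
    fix k l assume kl: "line_edge n k l" "k \<in> orbit n ` set w"
    have "orbit n i \<notin> orbit n ` set w" using Cons.prems(2) by simp
    then have k: "k \<noteq> orbit n i" using kl(2) by blast
    show "bump n i h k < bump n i h l \<longleftrightarrow> first k l (map (orbit n) w)"
    proof (cases "l = orbit n i")
      case True
      then have "first k l (map (orbit n) w)" using kl(2) Cons.prems(2) by (intro first_absent) auto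
      moreover have "h k < h l + 2" using heightD[OF Cons.prems(1) kl(1)] by auto
      ultimately show ?thesis using True k by (simp add: bump_def)
    next
      case False
      then show ?thesis using Cons.prems(3)[OF kl(1)] kl(2) k by (simp add: bump_def)
    qed
  next
    fix j assume j: "j \<in> set w" "n \<le> j"
    then have "n \<in> orbit n ` set w" by (intro image_eqI[of _ _ j]) simp_all
    moreover have "orbit n i \<notin> orbit n ` set w" using Cons.prems(2) by simp
    ultimately have "orbit n i \<noteq> n" by metis
    then show "j = top (quiver_of n (bump n i h))"
      using top_bump Cons.prems(4)[of j] j by simp
  qed
  then show ?case using adapted_Cons Cons.prems(1) i by blast
qed simp

text \<open>
  Among the vertices below their target the lowest one is a local minimum: a lower neighbour would
  already be at its target, which is too far from the target of that vertex.
\<close>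

lemma sink_word_ex:
  assumes "height n h" "height n h'" "\<And>k. k \<in> {1..n} \<Longrightarrow> h k \<le> h' k \<and> even (h' k - h k)"
  shows "\<exists>w. adapted n (quiver_of n h) w \<and> (\<forall>k \<in> {1..n}. fold (bump n) w h k = h' k)"
  using assms
proof (induction "nat (\<Sum>k = 1..n. h' k - h k)" arbitrary: h rule: less_induct)
  case less
  show ?case
  proof (cases "\<forall>k \<in> {1..n}. h k = h' k")
    case True
    then show ?thesis by (intro exI[of _ "[]"]) simp
  next
    case False
    let ?S = "{k \<in> {1..n}. h k < h' k}"
    have "finite ?S" "?S \<noteq> {}" using False less.prems(3) by force+
    then obtain k where k: "k \<in> ?S" "\<And>l. l \<in> ?S \<Longrightarrow> h k \<le> h l"
      using ex_is_arg_min_if_finite[of ?S h] unfolding is_arg_min_linorder by blast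
    define i where "i = (if k < n then k else top (quiver_of n h))"
    have i: "orbit n i = k" "i \<in> idx n" "n \<le> i \<longrightarrow> i = top (quiver_of n h)"
      using k(1) by (auto simp: i_def quiver_of_def idx_def)
    have "h k < h l" if "line_edge n k l" for l
    proof (rule ccontr)
      assume "\<not> h k < h l"
      then have l: "h l = h k - 1" using heightD[OF less.prems(1) that] by auto
      have "l \<in> {1..n}" using that by (auto simp: line_edge_def)
      then have "h' l = h l" using k(2)[of l] l less.prems(3)[of l] by force
      then have "h' k \<le> h k" using heightD[OF less.prems(2) that] l by auto
      then show False using k(1) by simp
    qed
    then have val: "valley n h i" using i by (simp add: valley_def)
    have two: "h k + 2 \<le> h' k"
    proof -
      have "h k < h' k" "even (h' k - h k)" using k(1) less.prems(3)[of k] by auto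
      then show ?thesis by presburger
    qed
    have h1: "height n (bump n i h)" using height_bump less.prems(1) val by blast
    have le: "bump n i h l \<le> h' l \<and> even (h' l - bump n i h l)" if "l \<in> {1..n}" for l
      using less.prems(3)[OF that] two i(1) by (auto simp: bump_def)
    have "(\<Sum>l = 1..n. h' l - bump n i h l) < (\<Sum>l = 1..n. h' l - h l)"
      using k(1) i(1) by (intro sum_strict_mono_ex1) (auto simp: bump_def intro!: bexI[of _ k])
    moreover have "0 \<le> (\<Sum>l = 1..n. h' l - bump n i h l)" using le by (intro sum_nonneg) auto
    ultimately have "nat (\<Sum>l = 1..n. h' l - bump n i h l) < nat (\<Sum>l = 1..n. h' l - h l)" by simp
    then obtain w where w: "adapted n (quiver_of n (bump n i h)) w"
        "\<forall>k \<in> {1..n}. fold (bump n) w (bump n i h) k = h' k"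
      using less.hyps[OF _ h1 less.prems(2) le] by blast
    then show ?thesis
      using less.prems(1) val
      by (intro exI[of _ "i # w"]) (simp add: adapted_Cons del: adapted.simps)
  qed
qed

end

section \<open>Adapted reduced words of the longest element\<close>

definition balanced :: "nat \<Rightarrow> nat list \<Rightarrow> bool" where
  "balanced n w \<longleftrightarrow> (\<forall>k \<in> {1..n}. count_list (map (orbit n) w) k = n + 1)"

text \<open>
  The property of the words in the initial class that is propagated along reflections: every vertex is
  raised \<open>n + 1\<close> times. It fixes the quiver that is reached at the end of the word.
\<close>

definition realizable :: "nat \<Rightarrow> (nat \<Rightarrow> int) \<Rightarrow> bool" where
  "realizable n h \<longleftrightarrow> height n h \<and> (\<exists>w \<in> adapted_class n (quiver_of n h). balanced n w)"

text \<open>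
  The words that define the twisted Coxeter elements, see \<open>twisted_coxeter_elements_eq\<close>.
\<close>

definition coxeter_word :: "nat \<Rightarrow> nat list \<Rightarrow> bool" where
  "coxeter_word n w \<longleftrightarrow> w \<in> lists (idx n) \<and> distinct (map (orbit n) w) \<and> orbit n ` set w = {1..n}"

lemma class_count:
  assumes "v \<in> commutation_class n w"
  shows "count_list (map f v) k = count_list (map f w) k"
proof -
  have "(w, v) \<in> (commutation_step n)\<^sup>*" using assms by (simp add: commutation_class_def)
  then show ?thesis
    by (induction rule: rtrancl_induct) (auto simp: commutation_step_def)
qed

lemma balanced_orbits: "balanced n w \<Longrightarrow> {1..n} \<subseteq> orbit n ` set w"
proof
  fix k assume "balanced n w" "k \<in> {1..n}"
  then have "count_list (map (orbit n) w) k \<noteq> 0" by (simp add: balanced_def)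
  then show "k \<in> orbit n ` set w" by (simp add: count_list_0_iff)
qed

lemma adapted_classI:
  "w \<in> reduced_words n (longest n) \<Longrightarrow> adapted n Q w \<Longrightarrow> w \<in> adapted_class n Q"
  by (simp add: adapted_class_def)

lemma adapted_classD:
  "w \<in> adapted_class n Q \<Longrightarrow> w \<in> reduced_words n (longest n) \<and> adapted n Q w"
  by (simp add: adapted_class_def)

context
  fixes n :: nat
  assumes n3: "n \<ge> 3"
begin

text \<open>
  Cancelling first letters. The relation \<open>R\<close> stands for the information on two words that ensures
  that they use the same letters and that survives the cancellation. It is used for reduced words of
  the same element and for Coxeter words.
\<close>

lemma adapted_words_class:
  assumes "height n h" "adapted n (quiver_of n h) w" "adapted n (quiver_of n h) v" "R w v"
    and nil: "\<And>v. R [] v \<Longrightarrow> v = []"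
    and mem: "\<And>i w v. R (i # w) v \<Longrightarrow> i \<in> set v"
    and step: "\<And>i w a b. R (i # w) (a @ i # b) \<Longrightarrow> i \<notin> set a \<Longrightarrow> a @ i # b \<in> lists (idx n) \<Longrightarrow>
      i # a @ b \<in> commutation_class n (a @ i # b) \<Longrightarrow> R w (a @ b)"
  shows "v \<in> commutation_class n w"
  using assms(1-4)
proof (induction w arbitrary: h v)
  case Nil
  then show ?case using nil self_in_class by blast
next
  case (Cons i w)
  obtain a b where v: "v = a @ i # b" "i \<notin> set a"
    using split_list_first[OF mem[OF Cons.prems(4)]] by blast
  have i: "valley n h i" "adapted n (quiver_of n (bump n i h)) w"
    using Cons.prems(1,2) adapted_Cons[OF n3] by blast+
  have lists: "v \<in> lists (idx n)"
    using adapted_height_lists[OF n3 Cons.prems(1,3)] by blast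
  have front: "\<forall>j \<in> set a. \<not> adjacent n j i" "adapted n (quiver_of n h) (i # a @ b)"
    using sink_to_front[OF n3 Cons.prems(1) i(1), of a b] Cons.prems(3) v by auto
  have cls: "i # a @ b \<in> commutation_class n v"
    using move_front[OF n3, of a i "[]" b] lists front(1) v(1) by auto
  then have "R w (a @ b)"
    using step Cons.prems(4) v lists by blast
  moreover have "adapted n (quiver_of n (bump n i h)) (a @ b)"
    using front(2) adapted_Cons[OF n3 Cons.prems(1)] by blast
  ultimately have "a @ b \<in> commutation_class n w"
    using Cons.IH[OF height_bump[OF n3 Cons.prems(1) i(1)] i(2)] by blast
  then have "i # a @ b \<in> commutation_class n (i # w)" by (rule class_Cons)
  then show ?case using commutation_class_eq[OF cls] commutation_class_eq[of "i # a @ b"] self_in_class by metis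
qed

lemma class_reduced:
  assumes "reduced n w" "v \<in> commutation_class n w"
  shows "reduced n v"
  using class_rearranged[OF n3 assms(2)] assms(1) by (simp add: reduced_def)

lemma adapted_reduced_words_class:
  assumes "height n h" "adapted n (quiver_of n h) w" "adapted n (quiver_of n h) v"
    "reduced n w" "reduced n v" "word_prod n v = word_prod n w"
  shows "v \<in> commutation_class n w"
proof (rule adapted_words_class[OF assms(1-3),
      where R = "\<lambda>w v. reduced n w \<and> reduced n v \<and> word_prod n v = word_prod n w"])
  show "reduced n w \<and> reduced n v \<and> word_prod n v = word_prod n w"
    using assms by blast
next
  fix v assume "reduced n [] \<and> reduced n v \<and> word_prod n v = word_prod n []"
  then have "length v \<le> length ([] :: nat list)"
    unfolding reduced_def by (metis lists.Nil)
  then show "v = []" by simp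
next
  fix i w v assume R: "reduced n (i # w) \<and> reduced n v \<and> word_prod n v = word_prod n (i # w)"
  then show "i \<in> set v"
    using reduced_letter_ex[OF n3, of "i # w" v i] reduced_lists by auto
next
  fix i w a b
  assume R: "reduced n (i # w) \<and> reduced n (a @ i # b) \<and> word_prod n (a @ i # b) = word_prod n (i # w)"
    and lists: "a @ i # b \<in> lists (idx n)"
    and cls: "i # a @ b \<in> commutation_class n (a @ i # b)"
  have red: "reduced n (i # a @ b)" using class_reduced R cls by blast
  have "word_prod n (i # a @ b) = word_prod n (i # w)"
    using class_rearranged[OF n3 cls lists] R by simp
  then have "refl n i (word_prod n (a @ b) x) = refl n i (word_prod n w x)" for x
    by (simp add: fun_eq_iff)
  moreover have "i \<in> idx n" using lists by simp
  ultimately have "word_prod n (a @ b) = word_prod n w"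
    using refl_invol[OF n3] by (metis ext)
  then show "reduced n w \<and> reduced n (a @ b) \<and> word_prod n (a @ b) = word_prod n w"
    using R red reduced_append2[of n "[i]"] by simp
qed

lemma adapted_class_eq:
  assumes "height n h" "w \<in> adapted_class n (quiver_of n h)"
  shows "adapted_class n (quiver_of n h) = commutation_class n w"
proof
  have w: "w \<in> reduced_words n (longest n)" "adapted n (quiver_of n h) w"
    using adapted_classD assms(2) by blast+
  show "adapted_class n (quiver_of n h) \<subseteq> commutation_class n w"
  proof
    fix v assume "v \<in> adapted_class n (quiver_of n h)"
    then have "v \<in> reduced_words n (longest n)" "adapted n (quiver_of n h) v"
      using adapted_classD by blast+
    then show "v \<in> commutation_class n w"
      using adapted_reduced_words_class[OF assms(1)] w in_reduced_words_iff by metis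
  qed
  show "commutation_class n w \<subseteq> adapted_class n (quiver_of n h)"
    using class_adapted[OF n3 assms(1) w(2)] class_w0_words[OF n3 w(1)] adapted_classI by blast
qed

lemma realizable_balanced:
  assumes "realizable n h" "w \<in> adapted_class n (quiver_of n h)"
  shows "balanced n w"
proof -
  obtain v where "height n h" "v \<in> adapted_class n (quiver_of n h)" "balanced n v"
    using assms(1) by (auto simp: realizable_def)
  then have "w \<in> commutation_class n v" "balanced n v" using adapted_class_eq assms(2) by blast+
  then show ?thesis using class_count[of w n v "orbit n"] by (simp add: balanced_def)
qed

lemma adapted_class_lists: "w \<in> adapted_class n Q \<Longrightarrow> w \<in> lists (idx n)"
  using adapted_classD w0_words_iff[OF n3] by blast

lemma fold_bump_balanced:
  assumes "balanced n w" "w \<in> lists (idx n)"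
  shows "fold (bump n) w h = shift n (int (n + 1)) h"
proof
  fix k
  have "count_list (map (orbit n) w) k = 0" if "k \<notin> {1..n}"
  proof -
    have "k \<notin> orbit n ` set w" using assms(2) orbit_range[OF n3] that by (auto simp: in_lists_conv_set)
    then show ?thesis by (simp add: count_list_0_iff)
  qed
  then show "fold (bump n) w h k = shift n (int (n + 1)) h k"
    using assms(1) by (auto simp: fold_bump shift_def balanced_def)
qed

lemma top_shift: "top (quiver_of n (shift n (int m) h)) = (vee n ^^ m) (top (quiver_of n h))"
proof (induction m)
  case 0
  then show ?case by (simp add: quiver_of_def shift_def)
next
  case (Suc m)
  have "bump n n (shift n (int m) h) n = shift n (int (Suc m)) h n"
    using n3 by (simp add: bump_def shift_def)
  then have "top (quiver_of n (shift n (int (Suc m)) h)) = top (quiver_of n (bump n n (shift n (int m) h)))"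
    by (simp add: quiver_of_def)
  then show ?case using top_bump_last[of n n "shift n (int m) h"] Suc by simp
qed

text \<open>
  Raising all vertices \<open>m\<close> times amounts to switching the type \<open>m\<close> times.
\<close>

lemma valley_shift: "valley n (shift n (int m) h) ((vee n ^^ m) i) \<longleftrightarrow> valley n h i"
proof -
  have orb: "orbit n ((vee n ^^ m) i) = orbit n i" by simp
  have "n \<le> (vee n ^^ m) i \<longleftrightarrow> orbit n ((vee n ^^ m) i) = n"
    by (auto simp: min_def)
  then have ge: "n \<le> (vee n ^^ m) i \<longleftrightarrow> n \<le> i"
    unfolding orb by (auto simp: min_def)
  have eq: "(vee n ^^ m) i = (vee n ^^ m) t \<longleftrightarrow> i = t" for t
    by (metis vee_funpow_invol[unfolded Suc_eq_plus1])
  have "(vee n ^^ m) i \<in> idx n \<longleftrightarrow> i \<in> idx n" using n3 by simp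
  moreover have "shift n (int m) h k < shift n (int m) h l \<longleftrightarrow> h k < h l" if "line_edge n k l" for k l
    using that by (auto simp: shift_def line_edge_def)
  ultimately show ?thesis
    unfolding valley_def orb ge top_shift eq by auto
qed

lemma height_shift: "height n (shift n m h) \<longleftrightarrow> height n h"
  by (auto simp: height_def shift_def line_edge_def)

lemma orbit_star:
  assumes "i \<in> idx n"
  shows "orbit n (star n i) = orbit n i"
  unfolding star_eq[OF n3 assms] using orbit_vee[of n "n + 1" i] by (simp del: funpow.simps)

text \<open>
  After the whole word every vertex has been raised \<open>n + 1\<close> times. There the sinks are those of
  the start with \<open>n + 1\<close> switches of type, which is also the effect of \<open>*\<close> on letters.
\<close>

lemma rotate_first_realizable:
  assumes "realizable n h" "i # u \<in> adapted_class n (quiver_of n h)"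
  shows "u @ [star n i] \<in> adapted_class n (quiver_of n (bump n i h)) \<and> realizable n (bump n i h)"
proof -
  have h: "height n h" using assms(1) by (simp add: realizable_def)
  have iu: "i # u \<in> reduced_words n (longest n)" "adapted n (quiver_of n h) (i # u)"
    using adapted_classD assms(2) by blast+
  then have i: "valley n h i" "adapted n (quiver_of n (bump n i h)) u"
    using adapted_Cons[OF n3 h] by blast+
  have h': "height n (bump n i h)" using height_bump[OF n3 h i(1)] .
  have bal: "balanced n (i # u)" and lists: "i # u \<in> lists (idx n)"
    using realizable_balanced assms adapted_class_lists by blast+
  then have idx: "i \<in> idx n" by simp
  have "fold (bump n) u (bump n i h) = shift n (int (n + 1)) h"
    using fold_bump_balanced[OF bal lists, of h] by simp
  moreover have "valley n (shift n (int (n + 1)) h) (star n i)"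
    unfolding star_eq[OF n3 idx] using valley_shift i(1) by blast
  moreover have "height n (shift n (int (n + 1)) h)" using h height_shift by blast
  ultimately have "adapted n (quiver_of n (bump n i h)) (u @ [star n i])"
    using i(2) adapted_append[OF n3 h'] adapted_Cons[OF n3, of "shift n (int (n + 1)) h" "star n i" "[]"] by simp
  then have mem: "u @ [star n i] \<in> adapted_class n (quiver_of n (bump n i h))"
    using rotate_first[OF n3 iu(1)] adapted_classI by blast
  moreover have "count_list (map (orbit n) (u @ [star n i])) k = count_list (map (orbit n) (i # u)) k" for k
    using orbit_star[OF idx] by simp
  then have "balanced n (u @ [star n i])"
    using bal by (simp only: balanced_def)
  ultimately show ?thesis using h' by (auto simp: realizable_def)
qed

text \<open>
  Since reflecting twice at the last vertex does not restore the quiver, the new height function is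
  taken from the end of the word: it is the one before the last letter, lowered by \<open>n + 1\<close> raisings
  of each vertex.
\<close>

lemma rotate_last_realizable:
  assumes "realizable n h" "u @ [i] \<in> adapted_class n (quiver_of n h)"
  shows "\<exists>h'. realizable n h' \<and> star n i # u \<in> adapted_class n (quiver_of n h')"
proof -
  have h: "height n h" using assms(1) by (simp add: realizable_def)
  have ui: "u @ [i] \<in> reduced_words n (longest n)" "adapted n (quiver_of n h) (u @ [i])"
    using adapted_classD assms(2) by blast+
  have bal: "balanced n (u @ [i])" and lists: "u @ [i] \<in> lists (idx n)"
    using realizable_balanced assms adapted_class_lists by blast+
  then have idx: "i \<in> idx n" by simp
  define g where "g = fold (bump n) u h"
  have u: "adapted n (quiver_of n h) u" "adapted n (quiver_of n g) [i]"
    using ui(2) adapted_append[OF n3 h] by (auto simp: g_def)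
  have hg: "height n g" using adapted_height_lists[OF n3 h u(1)] by (simp add: g_def)
  have vi: "valley n g i" using u(2) adapted_Cons[OF n3 hg] by blast
  have bump_g: "bump n i g = shift n (int (n + 1)) h"
    using fold_bump_balanced[OF bal lists, of h] by (simp add: g_def)
  define h' where "h' = shift n (- int (n + 1)) g"
  have "shift n (int (n + 1)) h' = g"
    by (auto simp: h'_def shift_def fun_eq_iff)
  moreover have "i = (vee n ^^ (n + 1)) (star n i)"
    unfolding star_eq[OF n3 idx] by (simp only: vee_funpow_invol[unfolded Suc_eq_plus1])
  ultimately have vs: "valley n h' (star n i)"
    using vi valley_shift[of "n + 1" h' "star n i"] by simp
  have hh: "height n h'" using hg height_shift by (simp add: h'_def)
  have "bump n (star n i) h' = h"
  proof
    fix k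
    show "bump n (star n i) h' k = h k"
      using fun_cong[OF bump_g, of k] orbit_range[OF n3 idx] orbit_star[OF idx]
      by (auto simp: bump_def h'_def shift_def split: if_splits)
  qed
  then have "adapted n (quiver_of n h') (star n i # u)"
    using adapted_Cons[OF n3 hh] vs u(1) by simp
  then have "star n i # u \<in> adapted_class n (quiver_of n h')"
    using rotate_last[OF n3 ui(1)] adapted_classI by blast
  moreover have "count_list (map (orbit n) (star n i # u)) k = count_list (map (orbit n) (u @ [i])) k" for k
    using orbit_star[OF idx] by simp
  then have "balanced n (star n i # u)"
    using bal by (simp only: balanced_def)
  ultimately show ?thesis using hh by (auto simp: realizable_def)
qed

lemma realizable_first_letter:
  assumes "realizable n h" "valley n h i"
  obtains u where "i # u \<in> adapted_class n (quiver_of n h)"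
proof -
  have h: "height n h" using assms(1) by (simp add: realizable_def)
  obtain w where w: "w \<in> adapted_class n (quiver_of n h)"
    using assms(1) by (auto simp: realizable_def)
  then have ad: "adapted n (quiver_of n h) w" and bal: "balanced n w" and lists: "w \<in> lists (idx n)"
    using adapted_classD realizable_balanced[OF assms(1)] adapted_class_lists by blast+
  have idx: "i \<in> idx n" using assms(2) by (simp add: valley_def)
  have mem: "orbit n i \<in> orbit n ` set w" using balanced_orbits[OF bal] orbit_range[OF n3 idx] by blast
  have "i \<in> set w"
  proof (cases "n \<le> i")
    case True
    then have n: "n \<in> orbit n ` set w" using mem by (simp add: min_absorb2)
    then have "filter (\<lambda>i. n \<le> i) w \<noteq> []" by (force simp: filter_empty_conv min_def split: if_splits)
    then have "hd (filter (\<lambda>i. n \<le> i) w) \<in> set (filter (\<lambda>i. n \<le> i) w)" by (rule hd_in_set)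
    then have "hd (filter (\<lambda>i. n \<le> i) w) \<in> set w" by simp
    moreover have "i = top (quiver_of n h)" using True assms(2) by (simp add: valley_def)
    ultimately show ?thesis using adapted_top[OF n3 h ad n] by simp
  next
    case False
    then show ?thesis using mem by (auto simp: min_def split: if_splits)
  qed
  then obtain a b where ab: "w = a @ i # b" "i \<notin> set a" by (blast dest: split_list_first)
  then have "\<forall>j \<in> set a. \<not> adjacent n j i" using sink_to_front[OF n3 h assms(2)] ad by blast
  then have "i # a @ b \<in> commutation_class n w"
    using move_front[OF n3, of a i "[]" b] lists ab(1) by auto
  then show thesis using that adapted_class_eq[OF h w] by blast
qed

text \<open>
  Each round raises every vertex once, so the next one starts from the same orientation with the
  other type.
\<close>

lemma rounds_adapted:
  assumes "height n h" "\<And>k. k \<in> {1..<n} \<Longrightarrow> h k < h (k + 1)" "top (quiver_of n h) = n"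
  shows "adapted n (quiver_of n h) (concat (map (\<lambda>k. map (vee n ^^ k) [1..<n + 1]) [0..<m])) \<and>
    fold (bump n) (concat (map (\<lambda>k. map (vee n ^^ k) [1..<n + 1]) [0..<m])) h = shift n (int m) h"
proof (induction m)
  case 0
  then show ?case by (auto simp: shift_def)
next
  case (Suc m)
  let ?r = "map (vee n ^^ m) [1..<n + 1]" and ?h = "shift n (int m) h"
  have map: "map (orbit n) ?r = [1..<n + 1]"
    unfolding map_map by (rule map_idI) auto
  have first: "first k l [a..<b] \<longleftrightarrow> k < l" if "k \<noteq> l" "k \<in> {a..<b}" "l \<in> {a..<b}" for k l a b
    using that
  proof (induction "b - a" arbitrary: a)
    case (Suc d)
    then have "[a..<b] = a # [Suc a..<b]" by (simp add: upt_conv_Cons)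
    moreover have "first k l [Suc a..<b] \<longleftrightarrow> k < l" if "a \<noteq> k" "a \<noteq> l"
      using Suc.hyps Suc.prems that by (intro Suc.hyps(1)) auto
    ultimately show ?case using Suc.prems by (cases "a = k"; cases "a = l") auto
  qed simp
  have count: "count_list [1..<b + 1] k = (if k \<in> {1..b} then 1 else 0)" for b k :: nat
    by (induction b) auto
  have hh: "height n ?h" using assms(1) height_shift by blast
  have "adapted n (quiver_of n ?h) ?r"
  proof (rule distinct_adapted[OF n3 hh])
    show "?r \<in> lists (idx n)" using n3 by (auto simp: idx_def[symmetric]) (auto simp: idx_def)
    show "distinct (map (orbit n) ?r)" unfolding map by simp
  next
    fix k l assume kl: "line_edge n k l" "k \<in> orbit n ` set ?r"
    have "h k < h l \<longleftrightarrow> k < l"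
    proof (cases "l = k + 1")
      case True
      then show ?thesis using assms(2)[of k] kl(1) by (auto simp: line_edge_def)
    next
      case False
      then have "k = l + 1" "l \<in> {1..<n}" using kl(1) by (auto simp: line_edge_def)
      then show ?thesis using assms(2)[of l] by auto
    qed
    then show "?h k < ?h l \<longleftrightarrow> first k l (map (orbit n) ?r)"
      unfolding map using first[of k l 1 "n + 1"] kl(1) by (auto simp: shift_def line_edge_def)
  next
    fix i assume i: "i \<in> set ?r" "n \<le> i"
    then obtain j where "j \<in> set [1..<n + 1]" and ij: "i = (vee n ^^ m) j"
      unfolding set_map by blast
    then have j: "j \<in> {1..n}" "i = (vee n ^^ m) j" by (auto simp del: upt_Suc)
    have "orbit n i = orbit n j" unfolding j(2) by simp
    then have "j = n" using i(2) j(1) by (auto simp: min_def split: if_splits)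
    then show "i = top (quiver_of n ?h)" unfolding top_shift assms(3) using j(2) by simp
  qed
  moreover have "fold (bump n) ?r ?h = shift n (int (Suc m)) h"
  proof
    fix k
    have "count_list (map (orbit n) ?r) k = (if k \<in> {1..n} then 1 else 0)"
      unfolding map by (rule count)
    then show "fold (bump n) ?r ?h k = shift n (int (Suc m)) h k"
      unfolding fold_bump by (auto simp: shift_def)
  qed
  ultimately show ?case
    using Suc.IH adapted_append[OF n3 assms(1)] by (simp del: upt_Suc add: upt_Suc[of 0 m])
qed

end

definition linear_height :: "nat \<Rightarrow> nat \<Rightarrow> int" where
  "linear_height n k = int k - int n"

context
  fixes n :: nat
  assumes n3: "n \<ge> 3"
begin

lemma height_linear: "height n (linear_height n)"
  by (auto simp: height_def line_edge_def linear_height_def)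

lemma initial_adapted:
  "initial_word n \<in> adapted_class n (quiver_of n (linear_height n))" "realizable n (linear_height n)"
proof -
  have "adapted n (quiver_of n (linear_height n)) (initial_word n)"
    and bump: "fold (bump n) (initial_word n) (linear_height n) = shift n (int (n + 1)) (linear_height n)"
    using rounds_adapted[OF n3 height_linear, of "n + 1"]
    unfolding initial_word_def by (auto simp: linear_height_def quiver_of_def)
  moreover have "initial_word n \<in> reduced_words n (longest n)"
    using w0_words_iff[OF n3] initial_lists[OF n3] length_initial[OF n3] word_prod_initial[OF n3] by blast
  ultimately show mem: "initial_word n \<in> adapted_class n (quiver_of n (linear_height n))"
    using adapted_classI by blast
  have "balanced n (initial_word n)"
    unfolding balanced_def
  proof
    fix k assume "k \<in> {1..n}"
    then have "2 * int (count_list (map (orbit n) (initial_word n)) k) = 2 * int (n + 1)"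
      using fun_cong[OF bump, of k] unfolding fold_bump shift_def by simp
    then show "count_list (map (orbit n) (initial_word n)) k = n + 1" by simp
  qed
  then show "realizable n (linear_height n)"
    using mem height_linear by (auto simp: realizable_def)
qed

lemma twisted_class_adapted:
  "C \<in> twisted_adapted_classes n \<Longrightarrow> \<exists>h. realizable n h \<and> C = adapted_class n (quiver_of n h)"
proof (induction rule: twisted_adapted_classes.induct)
  case initial
  then show ?case
    using adapted_class_eq[OF n3 height_linear initial_adapted(1)] initial_adapted(2) by blast
next
  case (reflect_first C i w)
  then obtain h where h: "realizable n h" "i # w \<in> adapted_class n (quiver_of n h)" by blast
  then have "w @ [star n i] \<in> adapted_class n (quiver_of n (bump n i h))" "realizable n (bump n i h)"
    using rotate_first_realizable[OF n3] by blast+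
  then show ?case using adapted_class_eq[OF n3] realizable_def by metis
next
  case (reflect_last C w i)
  then obtain h where h: "realizable n h" "w @ [i] \<in> adapted_class n (quiver_of n h)" by blast
  then obtain h' where "realizable n h'" "star n i # w \<in> adapted_class n (quiver_of n h')"
    using rotate_last_realizable[OF n3] by blast
  then show ?case using adapted_class_eq[OF n3] realizable_def by metis
qed

lemma reachable_twisted:
  assumes "realizable n h" "adapted_class n (quiver_of n h) \<in> twisted_adapted_classes n"
    "adapted n (quiver_of n h) w"
  shows "realizable n (fold (bump n) w h) \<and>
    adapted_class n (quiver_of n (fold (bump n) w h)) \<in> twisted_adapted_classes n"
  using assms
proof (induction w arbitrary: h)
  case (Cons i w)
  have hh: "height n h" using Cons.prems(1) by (simp add: realizable_def)
  have i: "valley n h i" "adapted n (quiver_of n (bump n i h)) w"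
    using Cons.prems(3) adapted_Cons[OF n3 hh] by blast+
  obtain u where u: "i # u \<in> adapted_class n (quiver_of n h)"
    using realizable_first_letter[OF n3 Cons.prems(1) i(1)] .
  have rot: "u @ [star n i] \<in> adapted_class n (quiver_of n (bump n i h))" "realizable n (bump n i h)"
    using rotate_first_realizable[OF n3 Cons.prems(1) u] by blast+
  then have "adapted_class n (quiver_of n (bump n i h)) = commutation_class n (u @ [star n i])"
    using adapted_class_eq[OF n3] realizable_def by blast
  then have "adapted_class n (quiver_of n (bump n i h)) \<in> twisted_adapted_classes n"
    using twisted_adapted_classes.reflect_first[OF Cons.prems(2) u] by simp
  then show ?case using Cons.IH[OF rot(2) _ i(2)] by simp
qed simp

lemma height_parity:
  assumes "height n h" "height n h'" "even (h n - h' n)" "k \<in> {1..n}"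
  shows "even (h k - h' k)"
proof -
  have "k \<le> n" "1 \<le> k" using assms(4) by auto
  then show ?thesis
  proof (induction k rule: inc_induct)
    case (step k)
    then have "line_edge n k (Suc k)" by (auto simp: line_edge_def)
    then have "h (Suc k) = h k + 1 \<or> h (Suc k) = h k - 1" "h' (Suc k) = h' k + 1 \<or> h' (Suc k) = h' k - 1"
      using heightD assms(1,2) by blast+
    moreover have "even (h (Suc k) - h' (Suc k))" using step by simp
    ultimately show ?case by (elim disjE) auto
  qed (use assms in simp)
qed

text \<open>
  The heights are lifted by a multiple of 4 above the linear ones, which leaves the quiver unchanged;
  then they are reached from the linear ones by raising local minima.
\<close>

lemma quiver_realizable:
  assumes "Q \<in> twisted_quivers n"
  obtains h where "realizable n h" "quiver_of n h = Q" "adapted_class n Q \<in> twisted_adapted_classes n"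
proof -
  obtain h where h: "height n h" "quiver_of n h = Q" "even (h n)"
    using quiver_height_ex[OF n3 assms] .
  \<comment> \<open>Any bound for the differences would do.\<close>
  define c where "c = (\<Sum>k = 1..n. \<bar>linear_height n k - h k\<bar>)"
  define h' where "h' = shift n (2 * c) h"
  have h': "height n h'" using h(1) height_shift[OF n3] by (simp add: h'_def)
  have "quiver_of n h' = quiver_of n h"
  proof -
    have "(h n + 2 * (2 * c)) mod 4 = h n mod 4" by presburger
    moreover have "h' n = h n + 2 * (2 * c)" using n3 by (simp add: h'_def shift_def)
    ultimately have "h' n mod 4 = h n mod 4" by simp
    moreover have "h' l < h' k \<longleftrightarrow> h l < h k" if "line_edge n k l" for k l
      using that by (auto simp: h'_def shift_def line_edge_def)
    ultimately show ?thesis by (auto simp: quiver_of_def)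
  qed
  moreover have le: "linear_height n k \<le> h' k \<and> even (h' k - linear_height n k)" if "k \<in> {1..n}" for k
  proof
    have "\<bar>linear_height n k - h k\<bar> \<le> c"
      unfolding c_def using that by (intro member_le_sum) auto
    moreover have "h' k = h k + 2 * (2 * c)" using that by (simp add: h'_def shift_def)
    ultimately show "linear_height n k \<le> h' k" by linarith
    have "even (h' n - linear_height n n)"
      using h(3) n3 by (simp add: h'_def shift_def linear_height_def)
    then show "even (h' k - linear_height n k)"
      using height_parity[OF h' height_linear _ that] by blast
  qed
  obtain w where w: "adapted n (quiver_of n (linear_height n)) w"
      "\<forall>k \<in> {1..n}. fold (bump n) w (linear_height n) k = h' k"
    using sink_word_ex[OF n3 height_linear h' le] by blast
  have "adapted_class n (quiver_of n (linear_height n)) \<in> twisted_adapted_classes n"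
    using adapted_class_eq[OF n3 height_linear initial_adapted(1)] twisted_adapted_classes.initial by simp
  then have realizable: "realizable n (fold (bump n) w (linear_height n))"
      "adapted_class n (quiver_of n (fold (bump n) w (linear_height n))) \<in> twisted_adapted_classes n"
    using reachable_twisted[OF initial_adapted(2) _ w(1)] by blast+
  moreover have "quiver_of n (fold (bump n) w (linear_height n)) = quiver_of n h'"
    using w(2) n3 by (intro quiver_of_cong) auto
  ultimately show thesis using that h(2) by metis
qed

lemma common_word_quiver_eq:
  assumes "Q \<in> twisted_quivers n" "Q' \<in> twisted_quivers n" "w \<in> adapted_class n Q" "w \<in> adapted_class n Q'"
  shows "Q = Q'"
proof -
  obtain h where h: "realizable n h" "quiver_of n h = Q" by (rule quiver_realizable[OF assms(1)])
  obtain h' where h': "realizable n h'" "quiver_of n h' = Q'" by (rule quiver_realizable[OF assms(2)])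
  have "{1..n} \<subseteq> orbit n ` set w"
    using realizable_balanced[OF n3 h(1)] h(2) assms(3) balanced_orbits by blast
  then show ?thesis
    using quiver_determined[OF n3, of h w h'] h h' assms(3,4) adapted_classD realizable_def by metis
qed

lemma adapted_class_nonempty:
  assumes "Q \<in> twisted_quivers n"
  obtains w where "w \<in> adapted_class n Q" "adapted_class n Q = commutation_class n w"
    "w \<in> reduced_words n (longest n)" "w \<in> lists (idx n)"
proof -
  obtain h where h: "realizable n h" "quiver_of n h = Q" by (rule quiver_realizable[OF assms])
  then obtain w where w: "w \<in> adapted_class n Q" by (auto simp: realizable_def)
  then show thesis
    using that[of w] adapted_class_eq[OF n3, of h w] h adapted_classD adapted_class_lists[OF n3 w] by (auto simp: realizable_def)
qed

lemma bij_adapted_class: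
  "bij_betw (adapted_class n) (twisted_quivers n) (twisted_adapted_classes n)"
  unfolding bij_betw_def
proof
  show "inj_on (adapted_class n) (twisted_quivers n)"
  proof (rule inj_onI)
    fix Q Q' assume Q: "Q \<in> twisted_quivers n" "Q' \<in> twisted_quivers n" "adapted_class n Q = adapted_class n Q'"
    obtain w where "w \<in> adapted_class n Q" by (rule adapted_class_nonempty[OF Q(1)])
    then show "Q = Q'" using common_word_quiver_eq Q by blast
  qed
  show "adapted_class n ` twisted_quivers n = twisted_adapted_classes n"
  proof
    show "adapted_class n ` twisted_quivers n \<subseteq> twisted_adapted_classes n"
      using quiver_realizable by blast
    show "twisted_adapted_classes n \<subseteq> adapted_class n ` twisted_quivers n"
      using twisted_class_adapted quiver_of_in[OF n3] realizable_def by blast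
  qed
qed

text \<open>
  The common core of the two injectivity statements below: both the order and the Auslander-Reiten
  quiver know the relative position of each root and its nearest adjacent predecessors.
\<close>

lemma word_order_quiver_eq:
  assumes "Q \<in> twisted_quivers n" "Q' \<in> twisted_quivers n" "w \<in> adapted_class n Q"
    and ord: "\<And>v j k. v \<in> adapted_class n Q' \<Longrightarrow> j < k \<Longrightarrow> k < length v \<Longrightarrow>
      adjacent n (v ! j) (v ! k) \<Longrightarrow> (\<And>l. j < l \<Longrightarrow> l < k \<Longrightarrow> \<not> dependent n (v ! l) (v ! k)) \<Longrightarrow>
      (beta n v j, beta n v k) \<in> word_order n w"
  shows "Q = Q'"
proof -
  obtain v where v: "v \<in> adapted_class n Q'" "adapted_class n Q' = commutation_class n v"
      "v \<in> reduced_words n (longest n)"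
    by (rule adapted_class_nonempty[OF assms(2)])
  have "w \<in> reduced_words n (longest n)" using assms(3) adapted_classD by blast
  then have "w \<in> adapted_class n Q'"
    unfolding v(2) using v(3) ord unfolding v(2) by (rule word_in_class[OF n3])
  then show ?thesis using common_word_quiver_eq assms by blast
qed

lemma beta_pos_roots:
  assumes "reduced n w" "k < length w"
  shows "beta n w k \<in> pos_roots n"
proof -
  have "w \<in> lists (idx n)" using assms(1) by (rule reduced_lists)
  then have "take k w \<in> lists (idx n)" "w ! k \<in> idx n"
    using assms(2) by (auto simp: in_lists_conv_set dest: in_set_takeD)
  then have "beta n w k \<in> roots n"
    unfolding roots_def weyl_def beta_def by blast
  then show ?thesis
    using beta_pos[OF n3 assms] by (simp add: pos_roots_def pos_vecs_def)
qed

lemma adjacent_class_order: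
  assumes "Q \<in> twisted_quivers n" "v \<in> adapted_class n Q" "j < k" "k < length v" "adjacent n (v ! j) (v ! k)"
  shows "(beta n v j, beta n v k) \<in> class_order n (adapted_class n Q)"
proof -
  have v: "v \<in> reduced_words n (longest n)" "v \<in> lists (idx n)"
    using assms(2) adapted_classD adapted_class_lists[OF n3] by blast+
  then have red: "reduced n v" using in_reduced_words_iff by blast
  obtain h where h: "realizable n h" "quiver_of n h = Q" by (rule quiver_realizable[OF assms(1)])
  have cls: "adapted_class n Q = commutation_class n v"
    using adapted_class_eq[OF n3, of h v] h assms(2) by (simp add: realizable_def)
  have "(beta n v j, beta n v k) \<in> word_order n w" if w: "w \<in> commutation_class n v" for w
  proof -
    have "rearranged n v w" using class_rearranged[OF n3 w v(2)] by blast
    then obtain p where p: "\<forall>k<length v. p k < length w \<and> w ! p k = v ! k \<and> beta n w (p k) = beta n v k"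
        "\<forall>j<length v. \<forall>k<length v. dependent n (v ! j) (v ! k) \<longrightarrow> (j < k \<longleftrightarrow> p j < p k)"
      by (rule rearranged_obtain)
    have "j < length v" using assms by simp
    moreover have "dependent n (v ! j) (v ! k)" using assms(5) by (simp add: dependent_def)
    ultimately have "p j < p k" using p(2) assms(3,4) by blast
    then have "(beta n w (p j), beta n w (p k)) \<in> word_order n w"
      using p(1) assms(4) by (intro word_order_beta) auto
    then show ?thesis using p(1) assms(4) \<open>j < length v\<close> by simp
  qed
  then show ?thesis
    using beta_pos_roots[OF red] assms(3,4) by (auto simp: class_order_def cls)
qed

lemma inj_class_order: "inj_on (\<lambda>Q. class_order n (adapted_class n Q)) (twisted_quivers n)"
proof (rule inj_onI)
  fix Q Q' assume Q: "Q \<in> twisted_quivers n" "Q' \<in> twisted_quivers n"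
    and eq: "class_order n (adapted_class n Q) = class_order n (adapted_class n Q')"
  obtain w where w: "w \<in> adapted_class n Q" by (rule adapted_class_nonempty[OF Q(1)])
  show "Q = Q'"
  proof (rule word_order_quiver_eq[OF Q w])
    fix v j k assume "v \<in> adapted_class n Q'" "j < k" "k < length v" "adjacent n (v ! j) (v ! k)"
    then have "(beta n v j, beta n v k) \<in> class_order n (adapted_class n Q)"
      unfolding eq using adjacent_class_order Q(2) by blast
    then show "(beta n v j, beta n v k) \<in> word_order n w"
      using w by (simp add: class_order_def)
  qed
qed

lemma adapted_class_ar_quiver:
  assumes "Q \<in> twisted_quivers n" "w \<in> adapted_class n Q"
  shows "class_ar_quiver n (adapted_class n Q) = word_ar_quiver n w"
proof -
  obtain v where "adapted_class n Q = commutation_class n v" "v \<in> lists (idx n)"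
    by (rule adapted_class_nonempty[OF assms(1)])
  then show ?thesis using class_ar_quiver_eq[OF n3, of w v] assms(2) by simp
qed

lemma inj_class_ar_quiver: "inj_on (\<lambda>Q. class_ar_quiver n (adapted_class n Q)) (twisted_quivers n)"
proof (rule inj_onI)
  fix Q Q' assume Q: "Q \<in> twisted_quivers n" "Q' \<in> twisted_quivers n"
    and eq: "class_ar_quiver n (adapted_class n Q) = class_ar_quiver n (adapted_class n Q')"
  obtain w where w: "w \<in> adapted_class n Q" by (rule adapted_class_nonempty[OF Q(1)])
  show "Q = Q'"
  proof (rule word_order_quiver_eq[OF Q w])
    fix v j k assume v: "v \<in> adapted_class n Q'" and jk: "j < k" "k < length v"
      and adj: "adjacent n (v ! j) (v ! k)" and near: "\<And>l. j < l \<Longrightarrow> l < k \<Longrightarrow> \<not> dependent n (v ! l) (v ! k)"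
    have same: "word_ar_quiver n v = word_ar_quiver n w"
      using eq adapted_class_ar_quiver[OF Q(1) w] adapted_class_ar_quiver[OF Q(2) v] by simp
    have "v ! l \<noteq> v ! j \<and> v ! l \<noteq> v ! k" if "j < l" "l < k" for l
      using near[OF that] adj by (auto simp: dependent_def)
    then have "(beta n v k, beta n v j) \<in> ar_arrows (word_ar_quiver n v)"
      unfolding ar_arrows_nearest using jk adj adjacent_sym by blast
    then have "(beta n v k, beta n v j) \<in> ar_arrows (word_ar_quiver n w)"
      unfolding same .
    then obtain k' j' where "beta n v k = beta n w k'" "beta n v j = beta n w j'" "j' < k'" "k' < length w"
      unfolding ar_arrows_nearest by blast
    then show "(beta n v j, beta n v k) \<in> word_order n w"
      using word_order_beta by simp
  qed
qed

end

section \<open>Twisted Coxeter words\<close>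

context
  fixes n :: nat
  assumes n3: "n \<ge> 3"
begin

lemma coxeter_wordD:
  assumes "coxeter_word n w"
  shows "w \<in> lists (idx n)" "distinct w" "orbit n ` set w = {1..n}" "inj_on (orbit n) (set w)"
  using assms distinct_map[of "orbit n" w] by (simp_all add: coxeter_word_def)

lemma twisted_coxeter_elements_eq:
  "twisted_coxeter_elements n = {word_prod n w \<circ> vee_map n |w. coxeter_word n w}"
proof -
  have orb: "x \<in> {i, vee n i} \<longleftrightarrow> orbit n x = orbit n i" if "x \<in> idx n" "i \<in> idx n" for x i
    using that by (auto simp: idx_def transpose_def min_def)
  have key: "(length w = n \<and> (\<forall>orb \<in> vee_orbits n. \<exists>!k. k < length w \<and> w ! k \<in> orb)) \<longleftrightarrow> coxeter_word n w"
    if w: "w \<in> lists (idx n)" for w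
  proof -
    have letter: "w ! k \<in> idx n" if "k < length w" for k
      using w that by (simp add: in_lists_conv_set)
    have "(\<forall>orb \<in> vee_orbits n. \<exists>!k. k < length w \<and> w ! k \<in> orb) \<longleftrightarrow>
        (\<forall>i \<in> idx n. \<exists>!k. k < length w \<and> orbit n (w ! k) = orbit n i)"
      unfolding vee_orbits_def ball_simps using orb letter by (intro ball_cong refl) (metis (no_types, lifting))
    also have "\<dots> \<longleftrightarrow> distinct (map (orbit n) w) \<and> orbit n ` set w = {1..n}"
    proof
      assume unique: "\<forall>i \<in> idx n. \<exists>!k. k < length w \<and> orbit n (w ! k) = orbit n i"
      have "distinct (map (orbit n) w)"
        unfolding distinct_conv_nth
      proof (intro allI impI)
        fix p q assume pq: "p < length (map (orbit n) w)" "q < length (map (orbit n) w)" "p \<noteq> q"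
        then have "\<exists>!k. k < length w \<and> orbit n (w ! k) = orbit n (w ! p)"
          using unique letter[of p] by simp
        then obtain k where k: "\<And>l. l < length w \<Longrightarrow> orbit n (w ! l) = orbit n (w ! p) \<Longrightarrow> l = k"
          by (elim ex1E) blast
        show "map (orbit n) w ! p \<noteq> map (orbit n) w ! q"
          using k[of p] k[of q] pq by force
      qed
      moreover have "orbit n ` set w \<subseteq> {1..n}"
        using orbit_range[OF n3] w by (auto simp: in_lists_conv_set)
      moreover have "k \<in> orbit n ` set w" if k: "k \<in> {1..n}" for k
      proof -
        have "k \<in> idx n" "orbit n k = k" using k by (auto simp: idx_def)
        then obtain p where "p < length w" "orbit n (w ! p) = k" using unique by metis
        then show ?thesis by force
      qed
      ultimately show "distinct (map (orbit n) w) \<and> orbit n ` set w = {1..n}" by blast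
    next
      assume cox: "distinct (map (orbit n) w) \<and> orbit n ` set w = {1..n}"
      show "\<forall>i \<in> idx n. \<exists>!k. k < length w \<and> orbit n (w ! k) = orbit n i"
      proof
        fix i assume "i \<in> idx n"
        then have "orbit n i \<in> orbit n ` set w" using cox orbit_range[OF n3] by blast
        then obtain k where k: "k < length w" "orbit n (w ! k) = orbit n i"
          by (auto simp: in_set_conv_nth)
        moreover have "l = k" if "l < length w" "orbit n (w ! l) = orbit n i" for l
          using cox that k nth_eq_iff_index_eq[of "map (orbit n) w" l k] by simp
        ultimately show "\<exists>!k. k < length w \<and> orbit n (w ! k) = orbit n i" by blast
      qed
    qed
    finally have iff: "(\<forall>orb \<in> vee_orbits n. \<exists>!k. k < length w \<and> w ! k \<in> orb) \<longleftrightarrow>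
        distinct (map (orbit n) w) \<and> orbit n ` set w = {1..n}" .
    have "length w = n" if "distinct (map (orbit n) w) \<and> orbit n ` set w = {1..n}"
      using distinct_card[of "map (orbit n) w"] that by simp
    then show ?thesis unfolding iff coxeter_word_def using w by blast
  qed
  have "(w \<in> lists (idx n) \<and> length w = n \<and>
      (\<forall>orb \<in> vee_orbits n. \<exists>!k. k < length w \<and> w ! k \<in> orb)) \<longleftrightarrow> coxeter_word n w" for w
    using key[of w] coxeter_wordD(1)[of w] by argo
  then show ?thesis
    unfolding twisted_coxeter_elements_def by simp
qed

lemma coxeter_word_height_ex:
  assumes "coxeter_word n w"
  obtains h where "height n h" "adapted n (quiver_of n h) w"
proof -
  note w = coxeter_wordD[OF assms]
  let ?m = "map (orbit n) w"
  have "n \<in> orbit n ` set w" using w(3) n3 by simp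
  then obtain t where t: "t \<in> set w" "orbit n t = n" by auto
  then have "t = n \<or> t = n + 1" using w(1) by (auto simp: in_lists_conv_set idx_def min_def split: if_splits)
  then obtain h where h: "height n h" "\<And>k. k \<in> {1..<n} \<Longrightarrow> h k < h (k + 1) \<longleftrightarrow> first k (k + 1) ?m"
      "top (quiver_of n h) = t"
    using height_ex[OF n3, of t "\<lambda>k. first k (k + 1) ?m"] by blast
  have "adapted n (quiver_of n h) w"
  proof (rule distinct_adapted[OF n3 h(1) w(1)])
    show "distinct ?m" using assms by (simp add: coxeter_word_def)
  next
    fix k l assume kl: "line_edge n k l" "k \<in> orbit n ` set w"
    show "h k < h l \<longleftrightarrow> first k l ?m"
    proof (cases "l = k + 1")
      case True
      then show ?thesis using h(2)[of k] kl(1) by (auto simp: line_edge_def)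
    next
      case False
      then have l: "k = l + 1" "l \<in> {1..<n}" using kl(1) by (auto simp: line_edge_def)
      have "first k l ?m \<longleftrightarrow> \<not> first l k ?m"
        using first_sym[of l k ?m] kl(2) l(1) by simp
      then show ?thesis using h(2)[OF l(2)] heightD[OF h(1) kl(1)] l(1) by auto
    qed
  next
    fix i assume "i \<in> set w" "n \<le> i"
    then have "i = t" using inj_onD[OF w(4), of i t] t by simp
    then show "i = top (quiver_of n h)" using h(3) by simp
  qed
  then show thesis using that h(1) by blast
qed

text \<open>
  Raise each vertex exactly once.
\<close>

lemma coxeter_word_ex:
  assumes "height n h"
  obtains w where "coxeter_word n w" "adapted n (quiver_of n h) w"
proof -
  obtain w where w: "adapted n (quiver_of n h) w" "\<forall>k \<in> {1..n}. fold (bump n) w h k = shift n 1 h k"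
    using sink_word_ex[OF n3 assms, of "shift n 1 h"] assms height_shift[OF n3] by (auto simp: shift_def)
  have lists: "w \<in> lists (idx n)" using adapted_height_lists[OF n3 assms w(1)] by blast
  have count: "count_list (map (orbit n) w) k = 1" if "k \<in> {1..n}" for k
    using w(2) that by (auto simp: fold_bump shift_def)
  have sub: "orbit n ` set w \<subseteq> {1..n}"
    using lists orbit_range[OF n3] by (auto simp: in_lists_conv_set)
  moreover have "k \<in> orbit n ` set w" if "k \<in> {1..n}" for k
    using count[OF that] count_list_0_iff[of "map (orbit n) w" k] by simp
  ultimately have "orbit n ` set w = {1..n}" by blast
  moreover have "distinct (map (orbit n) w)"
  proof (rule ccontr)
    assume "\<not> distinct (map (orbit n) w)"
    then obtain xs ys zs y where dec: "map (orbit n) w = xs @ [y] @ ys @ [y] @ zs"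
      using not_distinct_decomp by blast
    then have "y \<in> set (map (orbit n) w)" by simp
    then have "y \<in> {1..n}" using sub by auto
    then show False using count[of y] unfolding dec by simp
  qed
  ultimately show thesis using that w(1) lists by (simp add: coxeter_word_def)
qed

text \<open>
  The type can be switched only by the letter for the last vertex, which therefore is the
  initial type.
\<close>

lemma adapted_coxeter_set:
  assumes "height n h" "coxeter_word n w" "adapted n (quiver_of n h) w"
  shows "set w = insert (top (quiver_of n h)) {1..<n}"
proof -
  note w = coxeter_wordD[OF assms(2)]
  let ?t = "hd (filter (\<lambda>i. n \<le> i) w)"
  have n: "n \<in> orbit n ` set w" using w(3) n3 by simp
  then have "filter (\<lambda>i. n \<le> i) w \<noteq> []" by (force simp: filter_empty_conv min_def split: if_splits)
  then have "?t \<in> set (filter (\<lambda>i. n \<le> i) w)" by (rule hd_in_set)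
  then have t: "?t \<in> set w" "n \<le> ?t" by auto
  have top: "top (quiver_of n h) = ?t" using adapted_top[OF n3 assms(1,3) n] .
  have "x = ?t" if "x \<in> set w" "n \<le> x" for x
    using inj_onD[OF w(4), of x ?t] that t by (simp add: min_absorb2)
  moreover have "x \<in> {1..<n}" if "x \<in> set w" "\<not> n \<le> x" for x
    using that w(1) by (auto simp: in_lists_conv_set idx_def)
  moreover have "x \<in> set w" if x: "x \<in> {1..<n}" for x
  proof -
    have "x \<in> orbit n ` set w" unfolding w(3) using x by auto
    then show ?thesis using x by (auto simp: min_def split: if_splits)
  qed
  ultimately show ?thesis unfolding top using t(1) by blast
qed

lemma adapted_coxeter_class:
  assumes "height n h" "coxeter_word n w" "adapted n (quiver_of n h) w"
    "coxeter_word n v" "adapted n (quiver_of n h) v"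
  shows "v \<in> commutation_class n w"
proof (rule adapted_words_class[OF n3 assms(1,3,5),
      where R = "\<lambda>w v. distinct w \<and> distinct v \<and> set v = set w"])
  show "distinct w \<and> distinct v \<and> set v = set w"
    using adapted_coxeter_set assms coxeter_wordD(2) by simp
next
  fix i :: nat and w a b :: "nat list"
  assume "distinct (i # w) \<and> distinct (a @ i # b) \<and> set (a @ i # b) = set (i # w)"
  then show "distinct w \<and> distinct (a @ b) \<and> set (a @ b) = set w" by auto
qed auto

text \<open>
  The reduced words of a Coxeter word's product are the words of its commutation class, so they are
  adapted together; and adapted Coxeter words lie in one class.
\<close>

lemma is_phi_iff:
  assumes "height n h" "coxeter_word n w" "adapted n (quiver_of n h) w"
  shows "is_phi n (quiver_of n h) \<phi> \<longleftrightarrow> \<phi> = word_prod n w"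
proof
  assume phi: "is_phi n (quiver_of n h) \<phi>"
  then obtain v where v: "coxeter_word n v" "\<phi> \<circ> vee_map n = word_prod n v \<circ> vee_map n"
    unfolding is_phi_def twisted_coxeter_elements_eq by blast
  have "\<phi> x = word_prod n v x" for x
    using fun_cong[OF v(2), of "vee_map n x"] by simp
  then have eq: "\<phi> = word_prod n v" by blast
  then have "v \<in> reduced_words n \<phi>"
    using distinct_reduced[OF n3] coxeter_wordD(1,2) v(1) by blast
  then have "adapted n (quiver_of n h) v" using phi by (simp add: is_phi_def)
  then have "v \<in> commutation_class n w" using adapted_coxeter_class assms v(1) by blast
  then show "\<phi> = word_prod n w"
    using class_rearranged[OF n3] coxeter_wordD(1)[OF assms(2)] eq by simp
next
  assume eq: "\<phi> = word_prod n w"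
  have "adapted n (quiver_of n h) v" if "v \<in> reduced_words n \<phi>" for v
    using class_adapted[OF n3 assms(1,3)] distinct_reduced_words_class[OF n3 coxeter_wordD(1,2)[OF assms(2)]]
      that eq by blast
  then show "is_phi n (quiver_of n h) \<phi>"
    unfolding is_phi_def twisted_coxeter_elements_eq using eq assms(2) by blast
qed

lemma phi_eq:
  assumes "height n h" "coxeter_word n w" "adapted n (quiver_of n h) w"
  shows "phi n (quiver_of n h) = word_prod n w"
  unfolding phi_def is_phi_iff[OF assms] by simp

lemma is_phi_ex1: "Q \<in> twisted_quivers n \<Longrightarrow> \<exists>!\<phi>. is_phi n Q \<phi>"
proof -
  assume "Q \<in> twisted_quivers n"
  then obtain h where h: "height n h" "quiver_of n h = Q" by (rule quiver_height_ex[OF n3])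
  obtain w where "coxeter_word n w" "adapted n (quiver_of n h) w" by (rule coxeter_word_ex[OF h(1)])
  then have "is_phi n Q \<phi> \<longleftrightarrow> \<phi> = word_prod n w" for \<phi> using is_phi_iff h by blast
  then show ?thesis by simp
qed

lemma bij_phi:
  "bij_betw (\<lambda>Q. phi n Q \<circ> vee_map n) (twisted_quivers n) (twisted_coxeter_elements n)"
  unfolding bij_betw_def
proof
  show "inj_on (\<lambda>Q. phi n Q \<circ> vee_map n) (twisted_quivers n)"
  proof (rule inj_onI)
    fix Q Q' assume Q: "Q \<in> twisted_quivers n" "Q' \<in> twisted_quivers n"
      and eq: "phi n Q \<circ> vee_map n = phi n Q' \<circ> vee_map n"
    have "phi n Q x = phi n Q' x" for x
      using fun_cong[OF eq, of "vee_map n x"] by simp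
    then have phi: "phi n Q = phi n Q'" by blast
    obtain h where h: "height n h" "quiver_of n h = Q" by (rule quiver_height_ex[OF n3 Q(1)])
    obtain h' where h': "height n h'" "quiver_of n h' = Q'" by (rule quiver_height_ex[OF n3 Q(2)])
    obtain w where w: "coxeter_word n w" "adapted n (quiver_of n h) w" by (rule coxeter_word_ex[OF h(1)])
    obtain w' where w': "coxeter_word n w'" "adapted n (quiver_of n h') w'" by (rule coxeter_word_ex[OF h'(1)])
    have prod: "word_prod n w = word_prod n w'"
      using phi_eq[OF h(1) w] phi_eq[OF h'(1) w'] phi h(2) h'(2) by simp
    have "w \<in> reduced_words n (word_prod n w')"
      using distinct_reduced[OF n3 coxeter_wordD(1,2)[OF w(1)]] prod by simp
    then have "w \<in> commutation_class n w'"
      using distinct_reduced_words_class[OF n3 coxeter_wordD(1,2)[OF w'(1)]] by blast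
    then have "adapted n (quiver_of n h') w" using class_adapted[OF n3 h'(1) w'(2)] by blast
    then show "Q = Q'"
      using quiver_determined[OF n3 h(1) w(2) h'(1)] coxeter_wordD(3)[OF w(1)] h(2) h'(2) by simp
  qed
  show "(\<lambda>Q. phi n Q \<circ> vee_map n) ` twisted_quivers n = twisted_coxeter_elements n"
  proof
    show "(\<lambda>Q. phi n Q \<circ> vee_map n) ` twisted_quivers n \<subseteq> twisted_coxeter_elements n"
    proof (rule image_subsetI)
      fix Q assume "Q \<in> twisted_quivers n"
      then have "\<exists>!\<phi>. is_phi n Q \<phi>" by (rule is_phi_ex1)
      then have "is_phi n Q (phi n Q)" unfolding phi_def by (rule theI')
      then show "phi n Q \<circ> vee_map n \<in> twisted_coxeter_elements n" by (simp add: is_phi_def)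
    qed
    show "twisted_coxeter_elements n \<subseteq> (\<lambda>Q. phi n Q \<circ> vee_map n) ` twisted_quivers n"
    proof
      fix c assume "c \<in> twisted_coxeter_elements n"
      then obtain w where w: "coxeter_word n w" "c = word_prod n w \<circ> vee_map n"
        unfolding twisted_coxeter_elements_eq by blast
      obtain h where h: "height n h" "adapted n (quiver_of n h) w" by (rule coxeter_word_height_ex[OF w(1)])
      show "c \<in> (\<lambda>Q. phi n Q \<circ> vee_map n) ` twisted_quivers n"
        using phi_eq[OF h(1) w(1) h(2)] w(2) quiver_of_in[OF n3 h(1)] by (intro image_eqI) auto
    qed
  qed
qed

end

section \<open>The correspondences\<close>

theorem theorem7p11:
  fixes n :: nat
  assumes "n \<ge> 3"
  shows "(\<forall>Q \<in> twisted_quivers n. \<exists>!\<phi>. is_phi n Q \<phi>) \<and>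
    bij_betw (\<lambda>Q. phi n Q \<circ> vee_map n) (twisted_quivers n) (twisted_coxeter_elements n) \<and>
    bij_betw (\<lambda>Q. adapted_class n Q) (twisted_quivers n) (twisted_adapted_classes n) \<and>
    bij_betw (\<lambda>Q. class_ar_quiver n (adapted_class n Q)) (twisted_quivers n)
      (class_ar_quiver n ` twisted_adapted_classes n) \<and>
    bij_betw (\<lambda>Q. class_order n (adapted_class n Q)) (twisted_quivers n)
      (class_order n ` twisted_adapted_classes n)"
proof -
  have classes: "adapted_class n ` twisted_quivers n = twisted_adapted_classes n"
    using bij_adapted_class[OF assms] by (simp add: bij_betw_def)
  have "bij_betw (\<lambda>Q. class_ar_quiver n (adapted_class n Q)) (twisted_quivers n)
      (class_ar_quiver n ` twisted_adapted_classes n)"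
    using inj_class_ar_quiver[OF assms] by (simp add: bij_betw_def classes[symmetric] image_image)
  moreover have "bij_betw (\<lambda>Q. class_order n (adapted_class n Q)) (twisted_quivers n)
      (class_order n ` twisted_adapted_classes n)"
    using inj_class_order[OF assms] by (simp add: bij_betw_def classes[symmetric] image_image)
  ultimately show ?thesis
    using is_phi_ex1[OF assms] bij_phi[OF assms] bij_adapted_class[OF assms] by blast
qed

end
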